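(* There is a constant $c>0$ such that, for every sufficiently small $\varepsilon>0$: $$T_{m,\varepsilon}\le c(1/\rho)^{n-1}\big(mn\log\tfrac1\varepsilon\big)^m;$$ $$T^{\mathrm{REV}}_{m,\varepsilon}\le c\big(\tfrac{n^2}{\rho}\log\tfrac1\varepsilon\big)^m;$$ $$T^{\mathrm{EXP}}_{m,\varepsilon}\le c\big(\tfrac{d^3mn}{h^2}\log\tfrac1\varepsilon\big)^m\quad\text{and}\quad T^{\mathrm{EXP}}_{1,\varepsilon}\le \tfrac{cd^3}{h^2}\log\tfrac1\varepsilon;$$ and $\mathbb{E}\,T^{\mathrm{RAN}}_{1,\varepsilon}\le c\log\tfrac1\varepsilon$.
   Context: Averaging systems are considered on $[n]$ with weight threshold $\rho\in(0,1/2]$. There are graphs $G_t$ on $[n]$ with self-loops and row-stochastic $P_t$ whose positive entries are exactly the edges of $G_t$ and are all $\ge\rho$; the dynamics is $x(t+1)=P_tx(t)$. The special classes are: - REV: $P_t=\mathrm{diag}(q)^{-1}M_t$ with $M_t$ symmetric, nonzero entries $\ge1$ exactly on the edges, $M_t\mathbf 1=q$ fixed, $q\le\mathbf 1/\rho$. - EXP: REV with $M_t$ a $0/1$ matrix, $q=d\mathbf1$, and every connected component of $G_t$ having Cheeger constant at least $h$. - RAN: each $G_t$ is an independent uniformly random simple $(d-1)$-regular graph on $[n]$ with self-loops added, $P_t=M_t/d$, with fixed $d>3$. $T_\varepsilon$ is the number of times $t$ at which $G_t$ has an edge $\{i,j\}$ with $|x_i(t)-x_j(t)|\ge\varepsilon$.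 $T_{m,\varepsilon}$ is the maximum of $T_\varepsilon$ over all $n$-vertex graph sequences whose graphs have at most $m$ connected components. The superscripts restrict to the corresponding classes. The initial conditions are: - $x(0)\in[0,1]^n$ in the general case; - $\sum_iq_i(x_i(0)-\mu)^2\le1$ with $\mu=\sum_iq_ix_i(0)/\sum_iq_i$ in the REV, EXP and RAN cases. *)

theory Defs
  imports "HOL-Probability.Probability"
begin

text \<open>Vertices are 0..<n. A (time-varying) averaging system is a sequence of
  matrices P t i j. The graph G_t is the support of P t.\<close>

definition stoch_system :: "nat \<Rightarrow> real \<Rightarrow> (nat \<Rightarrow> nat \<Rightarrow> nat \<Rightarrow> real) \<Rightarrow> bool" where
  "stoch_system n \<rho> P \<longleftrightarrow>
     (\<forall>t. (\<forall>i<n. \<forall>j<n. P t i j \<ge> 0 \<and> (P t i j > 0 \<longrightarrow> P t i j \<ge> \<rho>)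
                     \<and> (P t i j > 0 \<longleftrightarrow> P t j i > 0))
        \<and> (\<forall>i<n. P t i i > 0)
        \<and> (\<forall>i<n. (\<Sum>j<n. P t i j) = 1))"

definition graph_edges :: "nat \<Rightarrow> (nat \<Rightarrow> nat \<Rightarrow> nat \<Rightarrow> real) \<Rightarrow> nat \<Rightarrow> (nat \<times> nat) set" where
  "graph_edges n P t = {(i, j). i < n \<and> j < n \<and> P t i j > 0}"

text \<open>Connected components of a graph with edge set E on vertex set 0..<n.\<close>
definition components :: "nat \<Rightarrow> (nat \<times> nat) set \<Rightarrow> nat set set" where
  "components n E = {0..<n} // (E\<^sup>*)"

definition n_components :: "nat \<Rightarrow> (nat \<times> nat) set \<Rightarrow> nat" where
  "n_components n E = card (components n E)"

fun traj :: "nat \<Rightarrow> (nat \<Rightarrow> nat \<Rightarrow> nat \<Rightarrow> real) \<Rightarrow> (nat \<Rightarrow> real) \<Rightarrow> nat \<Rightarrow> nat \<Rightarrow> real" where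
  "traj n P x0 0 = x0"
| "traj n P x0 (Suc t) = (\<lambda>i. \<Sum>j<n. P t i j * traj n P x0 t j)"

definition long_edge_times :: "nat \<Rightarrow> real \<Rightarrow> (nat \<Rightarrow> nat \<Rightarrow> nat \<Rightarrow> real) \<Rightarrow> (nat \<Rightarrow> real) \<Rightarrow> nat set" where
  "long_edge_times n \<epsilon> P x0 =
     {t. \<exists>i<n. \<exists>j<n. P t i j > 0 \<and> \<bar>traj n P x0 t i - traj n P x0 t j\<bar> \<ge> \<epsilon>}"

text \<open>T_eps (possibly infinite).\<close>
definition T_eps :: "nat \<Rightarrow> real \<Rightarrow> (nat \<Rightarrow> nat \<Rightarrow> nat \<Rightarrow> real) \<Rightarrow> (nat \<Rightarrow> real) \<Rightarrow> ennreal" where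
  "T_eps n \<epsilon> P x0 =
     (if finite (long_edge_times n \<epsilon> P x0) then of_nat (card (long_edge_times n \<epsilon> P x0)) else \<infinity>)"

definition T_gen :: "nat \<Rightarrow> real \<Rightarrow> nat \<Rightarrow> real \<Rightarrow> ennreal" where
  "T_gen n \<rho> m \<epsilon> =
     (SUP (P, x0) \<in> {(P, x0). stoch_system n \<rho> P
                       \<and> (\<forall>t. n_components n (graph_edges n P t) \<le> m)
                       \<and> (\<forall>i<n. 0 \<le> x0 i \<and> x0 i \<le> 1)}.
        T_eps n \<epsilon> P x0)"

text \<open>Reversible systems: P t = diag(q)^{-1} M t.\<close>
definition rev_system :: "nat \<Rightarrow> real \<Rightarrow> (nat \<Rightarrow> nat \<Rightarrow> nat \<Rightarrow> real) \<Rightarrow> (nat \<Rightarrow> real)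
    \<Rightarrow> (nat \<Rightarrow> nat \<Rightarrow> nat \<Rightarrow> real) \<Rightarrow> bool" where
  "rev_system n \<rho> P q M \<longleftrightarrow>
     stoch_system n \<rho> P
     \<and> (\<forall>i<n. q i \<le> 1 / \<rho>)
     \<and> (\<forall>t. \<forall>i<n. \<forall>j<n. M t i j = M t j i
                 \<and> (M t i j \<noteq> 0 \<longleftrightarrow> P t i j > 0)
                 \<and> (M t i j \<noteq> 0 \<longrightarrow> M t i j \<ge> 1)
                 \<and> P t i j = M t i j / q i)
     \<and> (\<forall>t. \<forall>i<n. (\<Sum>j<n. M t i j) = q i)"

definition qvar :: "nat \<Rightarrow> (nat \<Rightarrow> real) \<Rightarrow> (nat \<Rightarrow> real) \<Rightarrow> real" where
  "qvar n q x0 =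
     (let \<mu> = (\<Sum>i<n. q i * x0 i) / (\<Sum>i<n. q i) in \<Sum>i<n. q i * (x0 i - \<mu>)\<^sup>2)"

definition T_rev :: "nat \<Rightarrow> real \<Rightarrow> nat \<Rightarrow> real \<Rightarrow> ennreal" where
  "T_rev n \<rho> m \<epsilon> =
     (SUP (P, q, M, x0) \<in> {(P, q, M, x0). rev_system n \<rho> P q M
                       \<and> (\<forall>t. n_components n (graph_edges n P t) \<le> m)
                       \<and> qvar n q x0 \<le> 1}.
        T_eps n \<epsilon> P x0)"

text \<open>Cheeger constant (edge expansion) of a component C is at least h:
  for every nonempty S \<subseteq> C with |S| \<le> |C|/2, the number of edges from S to C-S
  is at least h |S|.\<close>
definition cheeger_ge :: "(nat \<times> nat) set \<Rightarrow> nat set \<Rightarrow> real \<Rightarrow> bool" where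
  "cheeger_ge E C h \<longleftrightarrow>
     (\<forall>S. S \<subseteq> C \<and> S \<noteq> {} \<and> 2 * card S \<le> card C \<longrightarrow>
        real (card {(i, j) \<in> E. i \<in> S \<and> j \<in> C - S}) \<ge> h * real (card S))"

definition exp_system :: "nat \<Rightarrow> real \<Rightarrow> nat \<Rightarrow> real \<Rightarrow> (nat \<Rightarrow> nat \<Rightarrow> nat \<Rightarrow> real) \<Rightarrow> (nat \<Rightarrow> real)
    \<Rightarrow> (nat \<Rightarrow> nat \<Rightarrow> nat \<Rightarrow> real) \<Rightarrow> bool" where
  "exp_system n \<rho> d h P q M \<longleftrightarrow>
     rev_system n \<rho> P q M
     \<and> (\<forall>t. \<forall>i<n. \<forall>j<n. M t i j = 0 \<or> M t i j = 1)
     \<and> (\<forall>i<n. q i = real d)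
     \<and> (\<forall>t. \<forall>C \<in> components n (graph_edges n P t). cheeger_ge (graph_edges n P t) C h)"

definition T_exp :: "nat \<Rightarrow> real \<Rightarrow> nat \<Rightarrow> real \<Rightarrow> nat \<Rightarrow> real \<Rightarrow> ennreal" where
  "T_exp n \<rho> d h m \<epsilon> =
     (SUP (P, q, M, x0) \<in> {(P, q, M, x0). exp_system n \<rho> d h P q M
                       \<and> (\<forall>t. n_components n (graph_edges n P t) \<le> m)
                       \<and> qvar n q x0 \<le> 1}.
        T_eps n \<epsilon> P x0)"

text \<open>Random model: simple k-regular graphs on 0..<n (as symmetric irreflexive
  edge relations), chosen independently and uniformly at each time step.\<close>
definition reg_graphs :: "nat \<Rightarrow> nat \<Rightarrow> (nat \<times> nat) set set" where
  "reg_graphs n k = {E. E \<subseteq> {0..<n} \<times> {0..<n} \<and> sym E \<and> (\<forall>i. (i, i) \<notin> E)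
                        \<and> (\<forall>i<n. card {j. (i, j) \<in> E} = k)}"

definition ran_space :: "nat \<Rightarrow> nat \<Rightarrow> (nat \<Rightarrow> (nat \<times> nat) set) measure" where
  "ran_space n d = PiM UNIV (\<lambda>_::nat. measure_pmf (pmf_of_set (reg_graphs n (d - 1))))"

text \<open>P_t = M_t / d with M_t the adjacency matrix plus self-loops.\<close>
definition ran_P :: "nat \<Rightarrow> (nat \<Rightarrow> (nat \<times> nat) set) \<Rightarrow> nat \<Rightarrow> nat \<Rightarrow> nat \<Rightarrow> real" where
  "ran_P d \<omega> t i j = (if i = j \<or> (i, j) \<in> \<omega> t then 1 / real d else 0)"

definition T_ran :: "nat \<Rightarrow> nat \<Rightarrow> real \<Rightarrow> (nat \<Rightarrow> (nat \<times> nat) set) \<Rightarrow> ennreal" where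
  "T_ran n d \<epsilon> \<omega> = (SUP x0 \<in> {x0. qvar n (\<lambda>_. real d) x0 \<le> 1}. T_eps n \<epsilon> (ran_P d \<omega>) x0)"

end

theory Submission
  imports Defs
begin

text \<open>
  The deterministic bounds come from one scheme. A nonincreasing potential \<open>\<Phi>\<close> controls the
  spread of the opinions. Wait until a certain cut (for reversible systems: every cut) of the vertex set
  has been crossed by an edge. Until then the system splits into two independent subsystems with fewer
  components, to which induction on \<open>m\<close> applies; afterwards \<open>\<Phi>\<close> has dropped by a factor
  \<open>1 - r\<close>. Counting with \<open>\<Phi>\<^sup>s\<close> solves this recursion by \<open>(\<Phi>/\<epsilon>)\<^sup>s (C/(s r))\<^sup>m\<close>, and
  \<open>s = m / (m + log (1/\<epsilon>))\<close> makes the constant uniform in \<open>m\<close>.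

  For reversible systems \<open>\<Phi>\<close> is the \<open>q\<close>-weighted variance: each gap of the sorted opinions
  contributes its square to the drop when it is first crossed. With expansion, Cheeger's
  inequality replaces the gaps inside a component by the diameter of the component.

  For general systems let \<open>X\<^sub>1 \<le> \<dots> \<le> X\<^sub>n\<close> be the sorted opinions and \<open>\<theta> = (1 + 1/n) / \<rho>\<close>; then
  \<open>\<Phi> = \<Sum>\<^sub>i (\<theta>\<^bsup>i-1\<^esup> - \<theta>\<^bsup>n-i\<^esup>) X\<^sub>i\<close>. Crossing a cut with \<open>p\<close> vertices on one side and a gap of the
  order of the diameter costs \<open>\<Phi>\<close> at least the order of \<open>\<theta>\<^bsup>p-1\<^esup> + \<theta>\<^bsup>n-p-1\<^esup>\<close>, which is
  exactly what the two subsystems consumed while the cut was not crossed. Hence the factor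
  \<open>(1/\<rho>)\<^bsup>n-1\<^esup>\<close> appears only once.

  For random graphs a switching argument shows that a fixed set \<open>S\<close> of \<open>s\<close> vertices has fewer than
  \<open>s/8\<close> boundary edges with probability at most \<open>(s/4n)\<^bsup>s/16\<^esup>\<close>. So the union of 32
  consecutive graphs is an expander with probability at least \<open>1/2\<close>, and then the variance drops by a
  constant factor over these 32 steps.
\<close>

section \<open>Averaging systems on closed vertex sets\<close>

text \<open>Counting phases directly, about L/r of them at each of m levels with L = log
  (1/\<epsilon>), leaves a factor C^m, while the theorem allows one constant outside the power m. A
  power s of the potential lets a phase spend more while the potential is large; the choice s = m /
  (m + L) yields (C * (1 + L/m))^m, and for large m the division by m absorbs C.

  In the general case an opinion may fall by its distance to the bottom of its block, while the one
  ranked below it is pulled up by \<rho> times that distance. So the weights have to change by at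
  least 1/\<rho> from rank to rank. At \<theta> = 1/\<rho> the potential is merely nonincreasing;
  the surplus \<rho> * \<theta> - 1 = 1/n makes it drop, and its price is (1 + 1/n)^(n-1) \<le> e.

  For random graphs the power of the potential shrinks in expectation from block to block, so a
  geometric series bounds the expected count without tail estimates. A block has 32 graphs because
  independence then raises the exponent p/16 for a set of size p to at least 2 * p, which beats the
  number of such sets.\<close>

locale averaging =
  fixes n :: nat and \<rho> :: real and P :: "nat \<Rightarrow> nat \<Rightarrow> nat \<Rightarrow> real" and x0 :: "nat \<Rightarrow> real"
  assumes stoch: "stoch_system n \<rho> P" and rho_pos: "0 < \<rho>"
begin

abbreviation "E t \<equiv> graph_edges n P t"
abbreviation "x \<equiv> traj n P x0"
abbreviation "comps B t \<equiv> B // (E t)\<^sup>*"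

text \<open>Closed sets are unions of connected components at time t. On such a set the step uses
  only opinions from the set, so it is an averaging system of its own; the induction on the number
  of components runs on these.\<close>

definition closed_at :: "nat set \<Rightarrow> nat \<Rightarrow> bool" where
  "closed_at B t \<longleftrightarrow> B \<subseteq> {..<n} \<and> (\<forall>i\<in>B. \<forall>j<n. P t i j > 0 \<longrightarrow> j \<in> B)"

definition long_at :: "real \<Rightarrow> nat set \<Rightarrow> nat \<Rightarrow> bool" where
  "long_at \<epsilon> B t \<longleftrightarrow> (\<exists>i\<in>B. \<exists>j\<in>B. P t i j > 0 \<and> \<bar>x t i - x t j\<bar> \<ge> \<epsilon>)"

text \<open>Relative to a vertex set and a finite window, because the recursion cuts both;
  infinitely many long times are excluded only at the end, by \<open>T_eps_le\<close>.\<close>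

definition cnt :: "real \<Rightarrow> nat set \<Rightarrow> nat \<Rightarrow> nat \<Rightarrow> nat" where
  "cnt \<epsilon> B a b = card {t \<in> {a..<b}. long_at \<epsilon> B t}"

lemma P_nonneg: "i < n \<Longrightarrow> j < n \<Longrightarrow> 0 \<le> P t i j"
  and P_ge: "i < n \<Longrightarrow> j < n \<Longrightarrow> P t i j > 0 \<Longrightarrow> \<rho> \<le> P t i j"
  and P_sym: "i < n \<Longrightarrow> j < n \<Longrightarrow> P t i j > 0 \<longleftrightarrow> P t j i > 0"
  and P_diag: "i < n \<Longrightarrow> P t i i > 0"
  and P_sum: "i < n \<Longrightarrow> (\<Sum>j<n. P t i j) = 1"
  using stoch unfolding stoch_system_def by (simp_all)

lemma edge_iff: "(i, j) \<in> E t \<longleftrightarrow> i < n \<and> j < n \<and> P t i j > 0"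
  by (simp add: graph_edges_def)

lemma closed_at_UNIV: "closed_at {..<n} t"
  by (simp add: closed_at_def)

lemma closed_at_subset: "closed_at B t \<Longrightarrow> i \<in> B \<Longrightarrow> i < n"
  by (auto simp: closed_at_def)

lemma closed_at_finite: "closed_at B t \<Longrightarrow> finite B"
  by (auto simp: closed_at_def intro: finite_subset)

lemma closed_at_outside:
  assumes "closed_at B t" "i \<in> B" "j < n" "j \<notin> B"
  shows "P t i j = 0"
  using assms P_nonneg[of i j t] unfolding closed_at_def by force

lemma closed_at_Diff:
  assumes "closed_at A t" "closed_at B t"
  shows "closed_at (A - B) t"
  unfolding closed_at_def
proof (intro conjI ballI allI impI)
  show "A - B \<subseteq> {..<n}" using assms(1) by (auto simp: closed_at_def)
  fix i j assume ij: "i \<in> A - B" "j < n" "P t i j > 0"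
  then have "i < n" using closed_at_subset[OF assms(1)] by blast
  then have "P t j i > 0" using ij P_sym by blast
  then show "j \<in> A - B" using ij assms \<open>i < n\<close> by (auto simp: closed_at_def)
qed

lemma closed_sum:
  assumes "closed_at B t" "i \<in> B"
  shows "(\<Sum>j<n. P t i j * f j) = (\<Sum>j\<in>B. P t i j * f j)"
  using assms closed_at_outside[OF assms]
  by (intro sum.mono_neutral_right) (auto simp: closed_at_def)

lemma closed_sum_P:
  assumes "closed_at B t" "i \<in> B"
  shows "(\<Sum>j\<in>B. P t i j) = 1"
  using closed_sum[OF assms, of "\<lambda>_. 1"] P_sum closed_at_subset[OF assms] by simp

lemma step_le:
  assumes "closed_at B t" "i \<in> B" "\<And>j. j \<in> B \<Longrightarrow> x t j \<le> u"
  shows "x (Suc t) i \<le> u"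
proof -
  have "x (Suc t) i = (\<Sum>j\<in>B. P t i j * x t j)"
    using closed_sum[OF assms(1,2)] by simp
  also have "\<dots> \<le> (\<Sum>j\<in>B. P t i j * u)"
    using assms(3) closed_at_subset[OF assms(1)] assms(2) by (intro sum_mono mult_left_mono P_nonneg) auto
  also have "\<dots> = u"
    using closed_sum_P[OF assms(1,2)] by (simp flip: sum_distrib_right)
  finally show ?thesis .
qed

lemma step_ge:
  assumes "closed_at B t" "i \<in> B" "\<And>j. j \<in> B \<Longrightarrow> u \<le> x t j"
  shows "u \<le> x (Suc t) i"
proof -
  have "u = (\<Sum>j\<in>B. P t i j * u)"
    using closed_sum_P[OF assms(1,2)] by (simp flip: sum_distrib_right)
  also have "\<dots> \<le> (\<Sum>j\<in>B. P t i j * x t j)"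
    using assms(3) closed_at_subset[OF assms(1)] assms(2) by (intro sum_mono mult_left_mono P_nonneg) auto
  also have "\<dots> = x (Suc t) i"
    using closed_sum[OF assms(1,2)] by simp
  finally show ?thesis .
qed

text \<open>Averaging never leaves the convex hull, so a bound persists for as long as the set stays
  closed.\<close>

lemma window_le:
  assumes "a \<le> b" "\<And>t. t \<in> {a..<b} \<Longrightarrow> closed_at B t" "\<And>i. i \<in> B \<Longrightarrow> x a i \<le> u"
  shows "\<forall>i\<in>B. x b i \<le> u"
  using assms(1,2)
proof (induction b rule: dec_induct)
  case (step b)
  then have "closed_at B b" "\<forall>i\<in>B. x b i \<le> u"
    by (auto simp: less_Suc_eq)
  then show ?case
    using step_le by blast
qed (use assms in auto)

lemma window_ge:
  assumes "a \<le> b" "\<And>t. t \<in> {a..<b} \<Longrightarrow> closed_at B t" "\<And>i. i \<in> B \<Longrightarrow> u \<le> x a i"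
  shows "\<forall>i\<in>B. u \<le> x b i"
  using assms(1,2)
proof (induction b rule: dec_induct)
  case (step b)
  then have "closed_at B b" "\<forall>i\<in>B. u \<le> x b i"
    by (auto simp: less_Suc_eq)
  then show ?case
    using step_ge by blast
qed (use assms in auto)

lemma class_subset:
  assumes "closed_at B t" "i \<in> B"
  shows "(E t)\<^sup>* `` {i} \<subseteq> B"
proof
  fix j assume "j \<in> (E t)\<^sup>* `` {i}"
  then have "(i, j) \<in> (E t)\<^sup>*" by simp
  then show "j \<in> B"
    by induction (use assms in \<open>auto simp: edge_iff closed_at_def\<close>)
qed

lemma finite_comps: "closed_at B t \<Longrightarrow> finite (comps B t)"
  using closed_at_finite by (simp add: quotient_def)

lemma comps_nonempty:
  assumes "closed_at B t" "B \<noteq> {}"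
  shows "card (comps B t) \<ge> 1"
proof -
  have "comps B t \<noteq> {}" using assms(2) by (simp add: quotient_def)
  then show ?thesis
    using finite_comps[OF assms(1)] by (simp add: Suc_leI card_gt_0_iff)
qed

text \<open>A component that starts in a closed set stays in it, so no component of A meets both B
  and A - B.\<close>

lemma card_comps_split:
  assumes "closed_at A t" "closed_at B t" "B \<subseteq> A"
  shows "card (comps A t) = card (comps B t) + card (comps (A - B) t)"
proof -
  note AB = closed_at_Diff[OF assms(1,2)]
  have "comps A t = comps B t \<union> comps (A - B) t"
    using assms(3) unfolding quotient_def by blast
  moreover have "comps B t \<inter> comps (A - B) t = {}"
  proof -
    have "False" if C: "C \<in> comps B t" "C \<in> comps (A - B) t" for C
    proof -
      obtain i where "i \<in> B" "C = (E t)\<^sup>* `` {i}" using C(1) by (blast elim: quotientE)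
      moreover have "C \<subseteq> A - B" using C(2) class_subset[OF AB] by (auto simp: quotient_def)
      ultimately show False by auto
    qed
    then show ?thesis by blast
  qed
  ultimately show ?thesis
    using finite_comps[OF assms(2)] finite_comps[OF AB] by (simp add: card_Un_disjoint)
qed

lemma sym_rtrancl_E: "sym ((E t)\<^sup>*)"
proof (intro sym_rtrancl symI)
  fix i j assume "(i, j) \<in> E t"
  then show "(j, i) \<in> E t" using P_sym[of i j t] by (simp add: edge_iff)
qed

lemma comps_closed:
  assumes "C \<in> comps A t" "closed_at A t"
  shows "closed_at C t"
proof -
  obtain i where i: "i \<in> A" "C = (E t)\<^sup>* `` {i}" using assms(1) by (auto simp: quotient_def)
  then have "C \<subseteq> A" using class_subset assms(2) by blast
  moreover have "j \<in> C" if "k \<in> C" "j < n" "P t k j > 0" for j k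
  proof -
    have "(k, j) \<in> E t" using that assms(2) \<open>C \<subseteq> A\<close> closed_at_subset by (auto simp: edge_iff)
    then show ?thesis using that(1) i by (auto intro: rtrancl.rtrancl_into_rtrancl)
  qed
  ultimately show ?thesis using assms(2) by (auto simp: closed_at_def)
qed

lemma comps_subset: "C \<in> comps A t \<Longrightarrow> closed_at A t \<Longrightarrow> C \<subseteq> A"
  using class_subset by (auto simp: quotient_def)

lemma comps_disjoint:
  assumes "C \<in> comps A t" "C' \<in> comps A t" "C \<noteq> C'"
  shows "C \<inter> C' = {}"
proof -
  have "equiv UNIV ((E t)\<^sup>*)"
    by (simp add: equiv_def sym_rtrancl_E refl_rtrancl trans_rtrancl)
  then show ?thesis
    using quotient_disj[of UNIV "(E t)\<^sup>*" C C'] assms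
    by (blast elim: quotientE intro: quotientI)
qed

lemma comps_mem: "i \<in> A \<Longrightarrow> \<exists>C \<in> comps A t. i \<in> C"
  by (auto simp: quotient_def)

lemma cnt_append:
  assumes "a \<le> c" "c \<le> b"
  shows "cnt \<epsilon> B a b = cnt \<epsilon> B a c + cnt \<epsilon> B c b"
proof -
  have "{t \<in> {a..<b}. long_at \<epsilon> B t} = {t \<in> {a..<c}. long_at \<epsilon> B t} \<union> {t \<in> {c..<b}. long_at \<epsilon> B t}"
    using assms by auto
  then show ?thesis
    unfolding cnt_def by (simp add: card_Un_disjoint disjoint_iff)
qed

lemma cnt_single: "cnt \<epsilon> B a (Suc a) \<le> 1"
proof -
  have "{t \<in> {a..<Suc a}. long_at \<epsilon> B t} \<subseteq> {a}" by auto
  then show ?thesis unfolding cnt_def using card_mono[of "{a}"] by fastforce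
qed

lemma cnt_zero: "(\<And>t. t \<in> {a..<b} \<Longrightarrow> \<not> long_at \<epsilon> B t) \<Longrightarrow> cnt \<epsilon> B a b = 0"
  unfolding cnt_def by simp

text \<open>No edge joins two complementary closed sets, so a long edge of A lies on one
  side.\<close>

lemma cnt_split:
  assumes "\<And>t. t \<in> {a..<b} \<Longrightarrow> closed_at A t" "\<And>t. t \<in> {a..<b} \<Longrightarrow> closed_at B t" "B \<subseteq> A"
  shows "cnt \<epsilon> A a b \<le> cnt \<epsilon> B a b + cnt \<epsilon> (A - B) a b"
proof -
  have "long_at \<epsilon> B t \<or> long_at \<epsilon> (A - B) t" if t: "t \<in> {a..<b}" and l: "long_at \<epsilon> A t" for t
  proof -
    obtain i j where ij: "i \<in> A" "j \<in> A" "P t i j > 0" "\<epsilon> \<le> \<bar>x t i - x t j\<bar>"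
      using l by (auto simp: long_at_def)
    have "i < n" "j < n" using ij assms(1)[OF t] closed_at_subset by auto
    then have "P t j i > 0" using ij P_sym by blast
    then have "i \<in> B \<longleftrightarrow> j \<in> B"
      using ij assms(2)[OF t] \<open>i < n\<close> \<open>j < n\<close> by (auto simp: closed_at_def)
    then show ?thesis using ij by (auto simp: long_at_def)
  qed
  then have "{t \<in> {a..<b}. long_at \<epsilon> A t} \<subseteq> {t \<in> {a..<b}. long_at \<epsilon> B t} \<union> {t \<in> {a..<b}. long_at \<epsilon> (A - B) t}"
    by blast
  then have "cnt \<epsilon> A a b \<le> card ({t \<in> {a..<b}. long_at \<epsilon> B t} \<union> {t \<in> {a..<b}. long_at \<epsilon> (A - B) t})"
    unfolding cnt_def by (intro card_mono) auto
  also have "\<dots> \<le> cnt \<epsilon> B a b + cnt \<epsilon> (A - B) a b"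
    unfolding cnt_def by (rule card_Un_le)
  finally show ?thesis .
qed

text \<open>Every finite set of long times lies in some window, so a uniform bound on windows bounds
  its size; this excludes the value \<infinity> of \<open>T_eps\<close>.\<close>

lemma T_eps_le:
  assumes "\<And>b. real (cnt \<epsilon> {..<n} 0 b) \<le> N" "0 \<le> N"
  shows "T_eps n \<epsilon> P x0 \<le> ennreal N"
proof -
  let ?S = "long_edge_times n \<epsilon> P x0"
  have S: "?S \<inter> {..<b} = {t \<in> {0..<b}. long_at \<epsilon> {..<n} t}" for b
    by (auto simp: long_edge_times_def long_at_def)
  have *: "finite F \<Longrightarrow> F \<subseteq> ?S \<Longrightarrow> card F \<le> nat \<lfloor>N\<rfloor>" for F
  proof -
    assume F: "finite F" "F \<subseteq> ?S"
    then obtain b where "F \<subseteq> {..<b}" using finite_nat_bounded[of F] by blast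
    then have "card F \<le> card (?S \<inter> {..<b})" using F by (intro card_mono) auto
    then show ?thesis using assms(1)[of b] S by (simp add: cnt_def le_nat_floor)
  qed
  have fin: "finite ?S" and "card ?S \<le> nat \<lfloor>N\<rfloor>"
    using finite_if_finite_subsets_card_bdd[of ?S "nat \<lfloor>N\<rfloor>"] * by auto
  then have "real (card ?S) \<le> N" using assms(2) by linarith
  then show ?thesis
    using fin assms(2) by (simp add: T_eps_def ennreal_of_nat_eq_real_of_nat ennreal_leI)
qed

end

section \<open>Sorted enumerations of a finite set\<close>

lemma sorted_enumeration:
  fixes f :: "nat \<Rightarrow> real"
  assumes "finite A"
  obtains e where "bij_betw e {..<card A} A" "\<And>i j. i \<le> j \<Longrightarrow> j < card A \<Longrightarrow> f (e i) \<le> f (e j)"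
proof -
  let ?l = "sort_key f (sorted_list_of_set A)"
  have l: "distinct ?l" "set ?l = A" "sorted (map f ?l)" "length ?l = card A"
    using assms by auto
  show thesis
  proof (rule that)
    show "bij_betw ((!) ?l) {..<card A} A"
      using bij_betw_nth[of ?l "{..<card A}" A] l by metis
    show "f (?l ! i) \<le> f (?l ! j)" if "i \<le> j" "j < card A" for i j
      using sorted_nth_mono[OF l(3) that(1)] that l(4) by simp
  qed
qed

text \<open>A relation and not a function of f and A, since ties leave the order open; only the
  values f (e i) are determined, see \<open>senum_unique\<close>. Ranks start at 0.\<close>

definition senum :: "(nat \<Rightarrow> nat) \<Rightarrow> (nat \<Rightarrow> real) \<Rightarrow> nat set \<Rightarrow> bool" where
  "senum e f A \<longleftrightarrow> bij_betw e {..<card A} A \<and> (\<forall>i j. i \<le> j \<longrightarrow> j < card A \<longrightarrow> f (e i) \<le> f (e j))"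

lemma senum_exists: "finite A \<Longrightarrow> \<exists>e. senum e f A"
  using sorted_enumeration[of A f] unfolding senum_def by metis

lemma senum_mono: "senum e f A \<Longrightarrow> i \<le> j \<Longrightarrow> j < card A \<Longrightarrow> f (e i) \<le> f (e j)"
  unfolding senum_def by blast

lemma senum_mem: "senum e f A \<Longrightarrow> i < card A \<Longrightarrow> e i \<in> A"
  unfolding senum_def bij_betw_def by auto

lemma senum_inj: "senum e f A \<Longrightarrow> i < card A \<Longrightarrow> j < card A \<Longrightarrow> e i = e j \<longleftrightarrow> i = j"
  unfolding senum_def bij_betw_def inj_on_def by auto

lemma senum_inj_on: "senum e f A \<Longrightarrow> I \<subseteq> {..<card A} \<Longrightarrow> inj_on e I"
  unfolding senum_def bij_betw_def using inj_on_subset by blast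

lemma senum_card_image: "senum e f A \<Longrightarrow> I \<subseteq> {..<card A} \<Longrightarrow> card (e ` I) = card I"
  by (intro card_image senum_inj_on)

lemma senum_obtain:
  assumes "senum e f A" "v \<in> A"
  obtains i where "i < card A" "v = e i"
  using assms unfolding senum_def bij_betw_def by blast

text \<open>Filling K up to the interval from Min K to Max K adds only nonnegative gaps, and the
  full sum telescopes.\<close>

lemma sum_gaps:
  fixes X :: "nat \<Rightarrow> real"
  assumes mono: "\<And>i j. i \<le> j \<Longrightarrow> j < N \<Longrightarrow> X i \<le> X j"
    and K: "K \<subseteq> {..<N - 1}" "\<And>c. c \<in> K \<Longrightarrow> lo \<le> X c" "\<And>c. c \<in> K \<Longrightarrow> X (Suc c) \<le> hi"
    and ne: "lo \<le> hi"
  shows "(\<Sum>c\<in>K. X (Suc c) - X c) \<le> hi - lo"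
proof (cases "K = {}")
  case False
  have fin: "finite K" using K(1) finite_subset by blast
  let ?a = "Min K" and ?b = "Max K"
  have ab: "?a \<in> K" "?b \<in> K" "?a \<le> ?b" using fin False by auto
  have "(\<Sum>c\<in>K. X (Suc c) - X c) \<le> (\<Sum>c=?a..?b. X (Suc c) - X c)"
  proof (rule sum_mono2)
    fix c assume "c \<in> {?a..?b} - K"
    moreover have "?b < N - 1" using ab K(1) by blast
    ultimately show "0 \<le> X (Suc c) - X c" using mono[of c "Suc c"] by auto
  qed (use fin in auto)
  also have "\<dots> = X (Suc ?b) - X ?a"
    using ab(3) by (intro sum_Suc_diff) auto
  also have "\<dots> \<le> hi - lo"
    using K(2)[OF ab(1)] K(3)[OF ab(2)] by simp
  finally show ?thesis .
qed (use ne in auto)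

lemma sum_squares_le_square_sum:
  fixes f :: "'a \<Rightarrow> real"
  assumes "finite K" "\<And>c. c \<in> K \<Longrightarrow> 0 \<le> f c"
  shows "(\<Sum>c\<in>K. (f c)\<^sup>2) \<le> (\<Sum>c\<in>K. f c)\<^sup>2"
  using assms
proof (induction K rule: finite_induct)
  case (insert c K)
  then have "0 \<le> 2 * f c * sum f K" by (simp add: sum_nonneg)
  then show ?case using insert by (simp add: power2_sum)
qed simp

section \<open>Variance in reversible systems\<close>

text \<open>Variance with unnormalised weights, as second moment minus a term fixed by the weighted
  sum: a step that preserves the weighted sum changes only the first term.\<close>

definition wvar :: "('a \<Rightarrow> real) \<Rightarrow> 'a set \<Rightarrow> ('a \<Rightarrow> real) \<Rightarrow> real" where
  "wvar q B f = (\<Sum>i\<in>B. q i * (f i)\<^sup>2) - (\<Sum>i\<in>B. q i * f i)\<^sup>2 / (\<Sum>i\<in>B. q i)"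

lemma sum_sq_dev:
  fixes q f :: "'a \<Rightarrow> real"
  assumes "(\<Sum>i\<in>B. q i) > 0"
  shows "(\<Sum>i\<in>B. q i * (f i - c)\<^sup>2)
    = wvar q B f + (c * (\<Sum>i\<in>B. q i) - (\<Sum>i\<in>B. q i * f i))\<^sup>2 / (\<Sum>i\<in>B. q i)"
proof -
  let ?Q = "\<Sum>i\<in>B. q i" and ?S = "\<Sum>i\<in>B. q i * f i"
  have "(\<Sum>i\<in>B. q i * (f i - c)\<^sup>2) = (\<Sum>i\<in>B. q i * (f i)\<^sup>2 - 2 * c * (q i * f i) + c\<^sup>2 * q i)"
    by (intro sum.cong) (auto simp: power2_eq_square algebra_simps)
  also have "\<dots> = (\<Sum>i\<in>B. q i * (f i)\<^sup>2) - 2 * c * ?S + c\<^sup>2 * ?Q"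
    by (simp add: sum.distrib sum_subtractf sum_distrib_left)
  finally have "(\<Sum>i\<in>B. q i * (f i - c)\<^sup>2) = (\<Sum>i\<in>B. q i * (f i)\<^sup>2) - 2 * c * ?S + c\<^sup>2 * ?Q" .
  moreover have alg: "T - 2 * c * S + c\<^sup>2 * Q = T - S\<^sup>2 / Q + (c * Q - S)\<^sup>2 / Q" if "Q > 0" for T S Q :: real
    using that by (simp add: field_simps power2_eq_square)
  ultimately show ?thesis
    unfolding wvar_def using alg[OF assms, of "\<Sum>i\<in>B. q i * (f i)\<^sup>2" ?S] by linarith
qed

lemma wvar_le:
  fixes q f :: "'a \<Rightarrow> real"
  assumes "(\<Sum>i\<in>B. q i) > 0"
  shows "wvar q B f \<le> (\<Sum>i\<in>B. q i * (f i - c)\<^sup>2)"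
  using assms by (simp add: sum_sq_dev)

lemma wvar_eq:
  fixes q f :: "'a \<Rightarrow> real"
  assumes "(\<Sum>i\<in>B. q i) > 0"
  shows "wvar q B f = (\<Sum>i\<in>B. q i * (f i - (\<Sum>i\<in>B. q i * f i) / (\<Sum>i\<in>B. q i))\<^sup>2)"
  using assms by (simp add: sum_sq_dev)

text \<open>Measure B from the mean of A: the mean of B does at least as well, and the remaining
  vertices of A only add.\<close>

lemma wvar_mono:
  fixes q f :: "'a \<Rightarrow> real"
  assumes "finite A" "B \<subseteq> A" "B \<noteq> {}" "\<And>i. i \<in> A \<Longrightarrow> 0 < q i"
  shows "wvar q B f \<le> wvar q A f"
proof -
  have fB: "finite B" using assms finite_subset by blast
  have B: "(\<Sum>i\<in>B. q i) > 0" using assms fB by (intro sum_pos) auto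
  have A: "(\<Sum>i\<in>A. q i) > 0" using assms by (intro sum_pos) auto
  show ?thesis
    unfolding wvar_eq[OF A]
    by (rule order_trans[OF wvar_le[OF B] sum_mono2]) (use assms in \<open>auto simp: less_imp_le\<close>)
qed

text \<open>From any centre, the squares of the two deviations add up to at least half the squared
  difference. This is how a long edge forces a variance of at least
  \<open>\<epsilon>\<^sup>2 / 2\<close>.\<close>

lemma wvar_ge_pair:
  fixes q f :: "'a \<Rightarrow> real"
  assumes "finite B" "\<And>i. i \<in> B \<Longrightarrow> 1 \<le> q i" "i \<in> B" "j \<in> B"
  shows "(f i - f j)\<^sup>2 / 2 \<le> wvar q B f"
proof -
  have Q: "(\<Sum>i\<in>B. q i) > 0" using assms(2) assms(1,3) by (intro sum_pos) (force intro: less_le_trans[of 0 1])+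
  define c where "c = (\<Sum>i\<in>B. q i * f i) / (\<Sum>i\<in>B. q i)"
  have pos: "0 \<le> q k * (f k - c)\<^sup>2" if "k \<in> B" for k using assms(2)[OF that] by simp
  have one: "(f k - c)\<^sup>2 \<le> q k * (f k - c)\<^sup>2" if "k \<in> B" for k
    using mult_right_mono[OF assms(2)[OF that], of "(f k - c)\<^sup>2"] by simp
  have eq: "wvar q B f = (\<Sum>k\<in>B. q k * (f k - c)\<^sup>2)" unfolding c_def by (rule wvar_eq[OF Q])
  show ?thesis
  proof (cases "i = j")
    case True
    then show ?thesis using pos by (simp add: eq sum_nonneg)
  next
    case False
    have "(f i - f j)\<^sup>2 / 2 \<le> (f i - c)\<^sup>2 + (f j - c)\<^sup>2"
    proof -
      have "(f i - c)\<^sup>2 + (f j - c)\<^sup>2 - (f i - f j)\<^sup>2 / 2 = ((f i - c) + (f j - c))\<^sup>2 / 2"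
        by (simp add: power2_eq_square field_simps)
      then show ?thesis by (smt (verit) zero_le_power2 divide_nonneg_pos)
    qed
    also have "\<dots> \<le> (\<Sum>k\<in>{i,j}. q k * (f k - c)\<^sup>2)"
      using False one assms(3,4) by (simp add: add_mono)
    also have "\<dots> \<le> wvar q B f"
      unfolding eq using assms pos by (intro sum_mono2) auto
    finally show ?thesis .
  qed
qed

lemma wvar_pairs:
  fixes m f :: "'a \<Rightarrow> real"
  assumes "(\<Sum>i\<in>B. m i) > 0"
  shows "wvar m B f = 1 / (2 * (\<Sum>i\<in>B. m i)) * (\<Sum>i\<in>B. \<Sum>j\<in>B. m i * m j * (f i - f j)\<^sup>2)"
proof -
  let ?Q = "\<Sum>i\<in>B. m i" and ?S = "\<Sum>i\<in>B. m i * f i" and ?T = "\<Sum>i\<in>B. m i * (f i)\<^sup>2"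
  have "(\<Sum>i\<in>B. \<Sum>j\<in>B. m i * m j * (f i - f j)\<^sup>2)
      = (\<Sum>i\<in>B. \<Sum>j\<in>B. (m i * (f i)\<^sup>2) * m j + m i * (m j * (f j)\<^sup>2) - 2 * ((m i * f i) * (m j * f j)))"
    by (intro sum.cong) (auto simp: power2_eq_square algebra_simps)
  also have "\<dots> = ?T * ?Q + ?Q * ?T - 2 * (?S * ?S)"
    by (simp add: sum.distrib sum_subtractf sum_product flip: sum_distrib_left)
  finally have "(\<Sum>i\<in>B. \<Sum>j\<in>B. m i * m j * (f i - f j)\<^sup>2) = ?T * ?Q + ?Q * ?T - 2 * (?S * ?S)" .
  moreover have alg: "T - S\<^sup>2 / Q = 1 / (2 * Q) * (T * Q + Q * T - 2 * (S * S))" if "Q > 0" for T S Q :: real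
    using that by (simp add: field_simps power2_eq_square)
  ultimately show ?thesis
    unfolding wvar_def using alg[OF assms, of ?T ?S] by simp
qed

text \<open>Concavity of the power, as an instance of Young's inequality. It turns a contraction of
  the potential by 1 - r into a saving s * r for its power s, the quantity that the counting
  recursion balances.\<close>

lemma powr_one_minus_le:
  fixes r s :: real
  assumes "0 \<le> r" "r \<le> 1" "0 < s" "s \<le> 1"
  shows "(1 - r) powr s \<le> 1 - s * r"
proof (cases "r = 1")
  case False
  then show ?thesis
    using Youngs_inequality_0[of s "1 - s" "1 - r" 1] assms by (simp add: algebra_simps)
qed (use assms in simp)

locale reversible = averaging +
  fixes q :: "nat \<Rightarrow> real" and M :: "nat \<Rightarrow> nat \<Rightarrow> nat \<Rightarrow> real"
  assumes rev: "rev_system n \<rho> P q M"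
begin

lemma q_le: "i < n \<Longrightarrow> q i \<le> 1 / \<rho>"
  and M_sym: "i < n \<Longrightarrow> j < n \<Longrightarrow> M t i j = M t j i"
  and M_iff: "i < n \<Longrightarrow> j < n \<Longrightarrow> M t i j \<noteq> 0 \<longleftrightarrow> P t i j > 0"
  and M_ge: "i < n \<Longrightarrow> j < n \<Longrightarrow> P t i j > 0 \<Longrightarrow> 1 \<le> M t i j"
  and P_eq: "i < n \<Longrightarrow> j < n \<Longrightarrow> P t i j = M t i j / q i"
  using rev unfolding rev_system_def by (simp_all)

lemma M_sum: "i < n \<Longrightarrow> (\<Sum>j<n. M t i j) = q i"
  using rev unfolding rev_system_def by blast

lemma M_nonneg: "i < n \<Longrightarrow> j < n \<Longrightarrow> 0 \<le> M t i j"
  using M_ge[of i j t] M_iff[of i j t] by (cases "M t i j = 0") auto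

lemma q_ge: assumes "i < n" shows "1 \<le> q i"
proof -
  have "M 0 i i \<le> (\<Sum>j<n. M 0 i j)"
    using assms M_nonneg by (intro member_le_sum) auto
  then show ?thesis using M_sum[OF assms] M_ge[OF assms assms P_diag[OF assms], of 0] by simp
qed

lemma closed_M_sum:
  assumes "closed_at A t" "i \<in> A"
  shows "(\<Sum>j\<in>A. M t i j) = q i"
proof -
  have "i < n" using closed_at_subset assms by blast
  have "(\<Sum>j\<in>A. M t i j) = (\<Sum>j<n. M t i j)"
  proof (rule sum.mono_neutral_left)
    show "\<forall>j\<in>{..<n} - A. M t i j = 0"
      using closed_at_outside[OF assms] M_iff[OF \<open>i < n\<close>] by force
  qed (use assms in \<open>auto simp: closed_at_def\<close>)
  then show ?thesis using M_sum[OF \<open>i < n\<close>] by simp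
qed

lemma step_eq:
  assumes "closed_at A t" "k \<in> A"
  shows "x (Suc t) k = (\<Sum>j\<in>A. M t k j * x t j) / q k"
proof -
  have "k < n" using closed_at_subset assms by blast
  have "x (Suc t) k = (\<Sum>j\<in>A. P t k j * x t j)"
    using closed_sum[OF assms] by simp
  also have "\<dots> = (\<Sum>j\<in>A. M t k j * x t j / q k)"
    using P_eq[OF \<open>k < n\<close>] closed_at_subset[OF assms(1)] by (intro sum.cong) auto
  finally show ?thesis by (simp add: sum_divide_distrib)
qed

text \<open>By symmetry of M the weighted sum is conserved, and the second moment can be
  redistributed so that vertex k receives \<open>M t k i * (x t i)\<^sup>2\<close> from i. What k
  then loses by averaging is the variance of x under the row M t k, which \<open>wvar_pairs\<close>
  writes over pairs of neighbours of k.\<close>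

lemma step_drop:
  assumes A: "closed_at A t"
  shows "wvar q A (x t) - wvar q A (x (Suc t))
    = (\<Sum>k\<in>A. 1 / (2 * q k) * (\<Sum>i\<in>A. \<Sum>j\<in>A. M t k i * M t k j * (x t i - x t j)\<^sup>2))"
proof -
  have q0: "q k > 0" if "k \<in> A" for k
    using q_ge[OF closed_at_subset[OF A that]] by simp
  have sym: "M t k j = M t j k" if "k \<in> A" "j \<in> A" for j k
    using M_sym closed_at_subset[OF A] that by blast
  have mean: "(\<Sum>k\<in>A. q k * x (Suc t) k) = (\<Sum>j\<in>A. q j * x t j)"
  proof -
    have "(\<Sum>k\<in>A. q k * x (Suc t) k) = (\<Sum>k\<in>A. \<Sum>j\<in>A. M t j k * x t j)"
      using q0 sym by (intro sum.cong refl) (force simp: step_eq[OF A] simp del: traj.simps intro!: sum.cong)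
    also have "\<dots> = (\<Sum>j\<in>A. \<Sum>k\<in>A. M t j k * x t j)" by (rule sum.swap)
    also have "\<dots> = (\<Sum>j\<in>A. q j * x t j)"
      by (intro sum.cong refl) (simp add: closed_M_sum[OF A] flip: sum_distrib_right)
    finally show ?thesis .
  qed
  have sq: "(\<Sum>k\<in>A. \<Sum>i\<in>A. M t k i * (x t i)\<^sup>2) = (\<Sum>i\<in>A. q i * (x t i)\<^sup>2)"
  proof -
    have "(\<Sum>k\<in>A. \<Sum>i\<in>A. M t k i * (x t i)\<^sup>2) = (\<Sum>k\<in>A. \<Sum>i\<in>A. M t i k * (x t i)\<^sup>2)"
      using sym by (intro sum.cong refl) auto
    also have "\<dots> = (\<Sum>i\<in>A. \<Sum>k\<in>A. M t i k * (x t i)\<^sup>2)" by (rule sum.swap)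
    also have "\<dots> = (\<Sum>i\<in>A. q i * (x t i)\<^sup>2)"
      by (intro sum.cong refl) (simp add: closed_M_sum[OF A] flip: sum_distrib_right)
    finally show ?thesis .
  qed
  have "wvar q A (x t) - wvar q A (x (Suc t))
      = (\<Sum>k\<in>A. (\<Sum>i\<in>A. M t k i * (x t i)\<^sup>2) - q k * (x (Suc t) k)\<^sup>2)"
    unfolding wvar_def mean by (simp add: sq sum_subtractf del: traj.simps)
  also have "\<dots> = (\<Sum>k\<in>A. wvar (M t k) A (x t))"
  proof (intro sum.cong refl)
    fix k assume k: "k \<in> A"
    show "(\<Sum>i\<in>A. M t k i * (x t i)\<^sup>2) - q k * (x (Suc t) k)\<^sup>2 = wvar (M t k) A (x t)"
      using q0[OF k] unfolding wvar_def closed_M_sum[OF A k] step_eq[OF A k]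
      by (simp add: power2_eq_square)
  qed
  also have "\<dots> = (\<Sum>k\<in>A. 1 / (2 * q k) * (\<Sum>i\<in>A. \<Sum>j\<in>A. M t k i * M t k j * (x t i - x t j)\<^sup>2))"
    using q0 by (intro sum.cong refl) (simp add: wvar_pairs closed_M_sum[OF A])
  finally show ?thesis .
qed

lemma wvar_Suc_le:
  assumes "closed_at A t"
  shows "wvar q A (x (Suc t)) \<le> wvar q A (x t)"
proof -
  have "0 \<le> (\<Sum>k\<in>A. 1 / (2 * q k) * (\<Sum>i\<in>A. \<Sum>j\<in>A. M t k i * M t k j * (x t i - x t j)\<^sup>2))"
    using closed_at_subset[OF assms] M_nonneg q_ge
    by (intro sum_nonneg mult_nonneg_nonneg) (auto intro: order_trans[of 0 1])
  then show ?thesis using step_drop[OF assms] by linarith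
qed

lemma wvar_window:
  assumes "a \<le> b" "\<And>t. t \<in> {a..<b} \<Longrightarrow> closed_at A t"
  shows "wvar q A (x b) \<le> wvar q A (x a)"
  using assms
proof (induction b rule: dec_induct)
  case (step b)
  then have "wvar q A (x b) \<le> wvar q A (x a)" "closed_at A b" by auto
  then show ?case using wvar_Suc_le[of A b] by linarith
qed simp

text \<open>Because of the self-loops, both ends of a crossing edge have neighbours on both sides of
  the cut. Such a vertex k splits q k = a + b with a, b \<ge> 1, and then a * b / (2 * (a + b))
  \<ge> 1/4.\<close>

lemma cut_weight:
  assumes A: "closed_at A t" and S: "S \<subseteq> A" and ij: "i \<in> S" "j \<in> A - S" "P t i j > 0"
  shows "1 / 2 \<le> (\<Sum>k\<in>A. 1 / (2 * q k) * ((\<Sum>i\<in>S. M t k i) * (\<Sum>j\<in>A - S. M t k j)))"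
proof -
  have fin: "finite A" "finite S" using closed_at_finite[OF A] S finite_subset by auto
  have lt: "k \<in> A \<Longrightarrow> k < n" for k using closed_at_subset[OF A] .
  have nn: "k \<in> A \<Longrightarrow> l \<in> A \<Longrightarrow> 0 \<le> M t k l" for k l using M_nonneg lt by blast
  let ?a = "\<lambda>k. \<Sum>i\<in>S. M t k i" and ?b = "\<lambda>k. \<Sum>j\<in>A - S. M t k j"
  have sum: "?a k + ?b k = q k" if "k \<in> A" for k
    using closed_M_sum[OF A that] sum.subset_diff[OF S fin(1), of "M t k"] by simp
  have quarter: "1 / 4 \<le> 1 / (2 * q k) * (?a k * ?b k)"
    if k: "k \<in> A" and u: "u \<in> S" "P t k u > 0" and v: "v \<in> A - S" "P t k v > 0" for k u v
  proof -
    have "M t k u \<le> ?a k" using u nn k S fin by (intro member_le_sum) auto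
    then have a: "1 \<le> ?a k" using M_ge[of k u t] u k lt S by force
    have "M t k v \<le> ?b k" using v nn k fin by (intro member_le_sum) auto
    then have b: "1 \<le> ?b k" using M_ge[of k v t] v k lt by force
    have "0 \<le> (?a k - 1) * (?b k - 1)" using a b by simp
    moreover have "1 \<le> ?a k * ?b k" using a b by (metis mult_mono mult_1 order_trans zero_le_one)
    ultimately have "?a k + ?b k \<le> 2 * (?a k * ?b k)" by (simp add: algebra_simps)
    then have "q k \<le> 2 * (?a k * ?b k)" using sum[OF k] by simp
    then show ?thesis using q_ge[OF lt[OF k]] by (simp add: field_simps)
  qed
  have iA: "i \<in> A" and jA: "j \<in> A" and ne: "i \<noteq> j" using ij S by auto
  have "1 / 4 \<le> 1 / (2 * q i) * (?a i * ?b i)"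
    using quarter[of i i j] iA ij P_diag lt by auto
  moreover have "1 / 4 \<le> 1 / (2 * q j) * (?a j * ?b j)"
    using quarter[of j i j] jA ij P_diag lt P_sym[of i j t] iA by auto
  ultimately have "1 / 2 \<le> (\<Sum>k\<in>{i, j}. 1 / (2 * q k) * (?a k * ?b k))"
    using ne by simp
  also have "\<dots> \<le> (\<Sum>k\<in>A. 1 / (2 * q k) * (?a k * ?b k))"
    using iA jA fin nn S q_ge lt
    by (intro sum_mono2 mult_nonneg_nonneg sum_nonneg) (auto intro: order_trans[of 0 1])
  finally show ?thesis .
qed

text \<open>Exchange of sums. The weight g c is spread over the pairs that cut c separates, where
  \<open>cut_weight\<close> collects at least half of it; \<open>sep\<close> says that no pair is
  charged more than the squared difference it contributes to \<open>step_drop\<close>.\<close>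

lemma cuts_drop:
  assumes A: "closed_at A t" and K: "finite K" "\<And>c. c \<in> K \<Longrightarrow> S c \<subseteq> A"
    and cross: "\<And>c. c \<in> K \<Longrightarrow> \<exists>i\<in>S c. \<exists>j\<in>A - S c. P t i j > 0"
    and sep: "\<And>i j. i \<in> A \<Longrightarrow> j \<in> A \<Longrightarrow> (\<Sum>c\<in>{c \<in> K. i \<in> S c \<and> j \<notin> S c}. g c) \<le> (x t i - x t j)\<^sup>2"
    and g: "\<And>c. c \<in> K \<Longrightarrow> 0 \<le> g c"
  shows "(\<Sum>c\<in>K. g c) / 2 \<le> wvar q A (x t) - wvar q A (x (Suc t))"
proof -
  have fin: "finite A" using closed_at_finite[OF A] .
  have lt: "k \<in> A \<Longrightarrow> k < n" for k using closed_at_subset[OF A] .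
  have nn: "k \<in> A \<Longrightarrow> l \<in> A \<Longrightarrow> 0 \<le> M t k l" for k l using M_nonneg lt by blast
  have q0: "k \<in> A \<Longrightarrow> 0 < q k" for k using q_ge lt by (force intro: less_le_trans[of 0 1])
  let ?w = "\<lambda>k c. 1 / (2 * q k) * ((\<Sum>i\<in>S c. M t k i) * (\<Sum>j\<in>A - S c. M t k j))"
  have "(\<Sum>c\<in>K. g c) / 2 = (\<Sum>c\<in>K. g c * (1 / 2))" by (simp add: sum_divide_distrib)
  also have "\<dots> \<le> (\<Sum>c\<in>K. g c * (\<Sum>k\<in>A. ?w k c))"
  proof (intro sum_mono mult_left_mono g)
    fix c assume c: "c \<in> K"
    obtain i j where "i \<in> S c" "j \<in> A - S c" "P t i j > 0" using cross[OF c] by blast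
    then show "1 / 2 \<le> (\<Sum>k\<in>A. ?w k c)" using cut_weight[OF A K(2)[OF c]] by blast
  qed
  also have "\<dots> = (\<Sum>k\<in>A. \<Sum>c\<in>K. g c * ?w k c)"
    by (simp only: sum_distrib_left) (rule sum.swap)
  also have "\<dots> \<le> (\<Sum>k\<in>A. 1 / (2 * q k) * (\<Sum>i\<in>A. \<Sum>j\<in>A. M t k i * M t k j * (x t i - x t j)\<^sup>2))"
  proof (intro sum_mono)
    fix k assume k: "k \<in> A"
    have w: "(\<Sum>i\<in>S c. M t k i) * (\<Sum>j\<in>A - S c. M t k j)
      = (\<Sum>i\<in>A. \<Sum>j\<in>A. M t k i * M t k j * of_bool (i \<in> S c \<and> j \<notin> S c))" if "c \<in> K" for c
    proof -
      have "(\<Sum>i\<in>S c. M t k i) = (\<Sum>i\<in>A. M t k i * of_bool (i \<in> S c))"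
        using K(2)[OF that] fin by (intro sum.mono_neutral_cong_left) auto
      moreover have "(\<Sum>j\<in>A - S c. M t k j) = (\<Sum>j\<in>A. M t k j * of_bool (j \<notin> S c))"
        using fin by (intro sum.mono_neutral_cong_left) auto
      ultimately show ?thesis
        by (simp add: sum_product mult_ac of_bool_conj)
    qed
    have "(\<Sum>c\<in>K. g c * ?w k c)
      = 1 / (2 * q k) * (\<Sum>c\<in>K. \<Sum>i\<in>A. \<Sum>j\<in>A. M t k i * M t k j * (g c * of_bool (i \<in> S c \<and> j \<notin> S c)))"
    proof -
      have "g c * ?w k c = 1 / (2 * q k) * (\<Sum>i\<in>A. \<Sum>j\<in>A. M t k i * M t k j * (g c * of_bool (i \<in> S c \<and> j \<notin> S c)))"
        if "c \<in> K" for c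
        unfolding w[OF that] by (simp add: sum_distrib_left mult_ac)
      then show ?thesis by (subst sum_distrib_left) (rule sum.cong[OF refl])
    qed
    also have "(\<Sum>c\<in>K. \<Sum>i\<in>A. \<Sum>j\<in>A. M t k i * M t k j * (g c * of_bool (i \<in> S c \<and> j \<notin> S c)))
       = (\<Sum>i\<in>A. \<Sum>j\<in>A. M t k i * M t k j * (\<Sum>c\<in>K. g c * of_bool (i \<in> S c \<and> j \<notin> S c)))"
      unfolding sum_distrib_left by (subst sum.swap) (intro sum.cong refl sum.swap)
    also have "1 / (2 * q k) * \<dots> \<le> 1 / (2 * q k) * (\<Sum>i\<in>A. \<Sum>j\<in>A. M t k i * M t k j * (x t i - x t j)\<^sup>2)"
    proof (intro mult_left_mono sum_mono)
      fix i j assume ij: "i \<in> A" "j \<in> A"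
      have "(\<Sum>c\<in>K. g c * of_bool (i \<in> S c \<and> j \<notin> S c)) = (\<Sum>c\<in>{c \<in> K. i \<in> S c \<and> j \<notin> S c}. g c)"
        using K(1) by (intro sum.mono_neutral_cong_right) auto
      then show "(\<Sum>c\<in>K. g c * of_bool (i \<in> S c \<and> j \<notin> S c)) \<le> (x t i - x t j)\<^sup>2"
        using sep[OF ij] by simp
      show "0 \<le> M t k i * M t k j" using nn k ij by simp
    qed (use q0[OF k] in simp)
    finally show "(\<Sum>c\<in>K. g c * ?w k c)
      \<le> 1 / (2 * q k) * (\<Sum>i\<in>A. \<Sum>j\<in>A. M t k i * M t k j * (x t i - x t j)\<^sup>2)" .
  qed
  also have "\<dots> = wvar q A (x t) - wvar q A (x (Suc t))" using step_drop[OF A] by simp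
  finally show ?thesis .
qed

end

section \<open>Phases and the counting recursion\<close>

context averaging begin

text \<open>For a set A that is closed throughout the window: the union of the graphs over the
  window is connected on A. Phases are the shortest windows with this property.\<close>

definition no_split :: "nat set \<Rightarrow> nat \<Rightarrow> nat \<Rightarrow> bool" where
  "no_split A a b \<longleftrightarrow> (\<forall>B\<subseteq>A. B \<noteq> {} \<longrightarrow> B \<noteq> A \<longrightarrow> (\<exists>t\<in>{a..<b}. \<not> closed_at B t))"

lemma initial_mem:
  assumes "senum e (x t) A" "c < card A" "i < card A"
  shows "e i \<in> e ` {..c} \<longleftrightarrow> i \<le> c"
  using assms senum_inj[OF assms(1)] by (auto simp: image_iff)

lemma initial_subset: "senum e (x t) A \<Longrightarrow> c < card A \<Longrightarrow> e ` {..c} \<subseteq> A"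
  using senum_mem by force

lemma initial_proper:
  assumes "senum e (x t) A" "Suc c < card A"
  shows "e ` {..c} \<noteq> {}" "e ` {..c} \<noteq> A"
  using initial_mem[OF assms(1), of c "Suc c"] senum_mem[OF assms(1,2)] assms(2) by auto

lemma crossing_edge:
  assumes "closed_at A t" "S \<subseteq> A" "\<not> closed_at S t"
  shows "\<exists>i\<in>S. \<exists>j\<in>A - S. P t i j > 0"
  using assms unfolding closed_at_def by blast

text \<open>Until a cut is crossed, each side keeps to its own convex hull, so the gap measured at
  time a stays empty.\<close>

lemma cut_bounds:
  assumes e: "senum e (x a) A" and c: "Suc c < card A" and ab: "a \<le> b"
    and A: "\<And>t. t \<in> {a..<b} \<Longrightarrow> closed_at A t"
    and S: "\<And>t. t \<in> {a..<b} \<Longrightarrow> closed_at (e ` {..c}) t"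
  shows "i \<in> e ` {..c} \<Longrightarrow> x b i \<le> x a (e c)"
    and "j \<in> A - e ` {..c} \<Longrightarrow> x a (e (Suc c)) \<le> x b j"
proof -
  have "\<forall>i\<in>e ` {..c}. x b i \<le> x a (e c)"
    by (rule window_le[OF ab S]) (use senum_mono[OF e] c in auto)
  then show "i \<in> e ` {..c} \<Longrightarrow> x b i \<le> x a (e c)" by blast
  have "\<forall>j\<in>A - e ` {..c}. x a (e (Suc c)) \<le> x b j"
  proof (rule window_ge[OF ab])
    show "closed_at (A - e ` {..c}) t" if "t \<in> {a..<b}" for t
      using closed_at_Diff A S that by blast
    fix j assume j: "j \<in> A - e ` {..c}"
    then obtain l where l: "l < card A" "j = e l" using senum_obtain[OF e] by blast
    then have "Suc c \<le> l" using j initial_mem[OF e, of c l] c by auto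
    then show "x a (e (Suc c)) \<le> x a j" using senum_mono[OF e] l by blast
  qed
  then show "j \<in> A - e ` {..c} \<Longrightarrow> x a (e (Suc c)) \<le> x b j" by blast
qed

text \<open>If cut c is uncrossed, the component of e c lies in the ranks up to c. So the components
  of e c, for c in K and for the top rank, are pairwise different.\<close>

lemma uncrossed_cuts:
  assumes e: "senum e (x t') A" and A: "closed_at A t" "A \<noteq> {}"
    and K: "K \<subseteq> {..<card A - 1}" "\<And>c. c \<in> K \<Longrightarrow> closed_at (e ` {..c}) t"
  shows "card K + 1 \<le> card (comps A t)"
proof -
  have fin: "finite A" "card A > 0" using closed_at_finite[OF A(1)] A(2) by (auto simp: card_gt_0_iff)
  have fK: "finite K" using K(1) finite_subset by blast
  let ?f = "\<lambda>c. (E t)\<^sup>* `` {e c}"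
  have lt: "c < card A" if "c \<in> insert (card A - 1) K" for c using that K(1) fin by auto
  have neq: "?f c \<noteq> ?f c'" if c: "c \<in> K" "c < c'" "c' < card A" for c c'
  proof
    assume eq: "?f c = ?f c'"
    have "?f c \<subseteq> e ` {..c}" by (rule class_subset[OF K(2)[OF c(1)]]) auto
    moreover have "e c' \<in> ?f c'" by auto
    ultimately have "e c' \<in> e ` {..c}" using eq by blast
    then show False using initial_mem[OF e, of c c'] c by simp
  qed
  have neq2: "?f c \<noteq> ?f c'" if "c \<in> insert (card A - 1) K" "c' \<in> insert (card A - 1) K" "c < c'" for c c'
  proof -
    have "c' \<le> card A - 1" using lt[OF that(2)] by simp
    then have "c \<in> K" using that by auto
    then show ?thesis using neq lt that by blast
  qed
  have "inj_on ?f (insert (card A - 1) K)"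
    by (rule linorder_inj_onI) (use neq2 in auto)
  moreover have "?f ` insert (card A - 1) K \<subseteq> comps A t"
    using lt senum_mem[OF e] by (auto intro!: quotientI)
  ultimately have "card (insert (card A - 1) K) \<le> card (comps A t)"
    using card_inj_on_le finite_comps[OF A(1)] by blast
  moreover have "card A - 1 \<notin> K" using K(1) by auto
  ultimately show ?thesis using fK by simp
qed

text \<open>Each part owns at least one component at every time, so neither can have all m.\<close>

lemma split_off:
  assumes A: "\<And>t. t \<in> {a..<b} \<Longrightarrow> closed_at A t \<and> card (comps A t) \<le> m" and "a < b" and nc: "\<not> no_split A a b"
  obtains B where "B \<subseteq> A" "B \<noteq> {}" "A - B \<noteq> {}" "1 < m"
    "\<And>t. t \<in> {a..<b} \<Longrightarrow> closed_at B t \<and> card (comps B t) \<le> m - 1"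
    "\<And>t. t \<in> {a..<b} \<Longrightarrow> closed_at (A - B) t \<and> card (comps (A - B) t) \<le> m - 1"
proof -
  obtain B where B: "B \<subseteq> A" "B \<noteq> {}" "B \<noteq> A" "\<And>t. t \<in> {a..<b} \<Longrightarrow> closed_at B t"
    using nc unfolding no_split_def by blast
  have ne: "A - B \<noteq> {}" using B by blast
  have *: "closed_at B t \<and> card (comps B t) \<le> m - 1 \<and> closed_at (A - B) t \<and> card (comps (A - B) t) \<le> m - 1 \<and> 1 < m"
    if t: "t \<in> {a..<b}" for t
  proof -
    have cl: "closed_at A t" "closed_at B t" "closed_at (A - B) t"
      using A[OF t] B(4)[OF t] closed_at_Diff by auto
    then show ?thesis
      using card_comps_split[OF cl(1,2) B(1)] A[OF t] comps_nonempty[OF cl(2) B(2)] comps_nonempty[OF cl(3) ne]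
      by linarith
  qed
  have "1 < m" using *[of a] \<open>a < b\<close> by auto
  then show thesis using that[OF B(1,2) ne] * by blast
qed

end

context reversible begin

text \<open>The cuts of K are crossed at t for the first time, so their gaps from time a are still
  empty. Those separating i from j are disjoint pieces of the interval between the two opinions, and
  a sum of squares is at most the square of the sum.\<close>

lemma cuts_drop_at:
  assumes e: "senum e (x a) A" and "a \<le> t" and A: "\<And>t'. t' \<in> {a..t} \<Longrightarrow> closed_at A t'"
    and K: "K \<subseteq> {..<card A - 1}"
    and before: "\<And>c t'. c \<in> K \<Longrightarrow> t' \<in> {a..<t} \<Longrightarrow> closed_at (e ` {..c}) t'"
    and now: "\<And>c. c \<in> K \<Longrightarrow> \<not> closed_at (e ` {..c}) t"
  shows "(\<Sum>c\<in>K. (x a (e (Suc c)) - x a (e c))\<^sup>2) / 2 \<le> wvar q A (x t) - wvar q A (x (Suc t))"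
proof (rule cuts_drop[where S = "\<lambda>c. e ` {..c}"])
  show At: "closed_at A t" using A \<open>a \<le> t\<close> by simp
  show fK: "finite K" using K finite_subset by blast
  have lt: "Suc c < card A" if "c \<in> K" for c using that K by auto
  show sub: "e ` {..c} \<subseteq> A" if "c \<in> K" for c
    using initial_subset[OF e] lt[OF that] by simp
  show "\<exists>i\<in>e ` {..c}. \<exists>j\<in>A - e ` {..c}. P t i j > 0" if "c \<in> K" for c
    using crossing_edge[OF At sub now] that by blast
  fix i j assume ij: "i \<in> A" "j \<in> A"
  let ?K = "{c \<in> K. i \<in> e ` {..c} \<and> j \<notin> e ` {..c}}" and ?g = "\<lambda>c. x a (e (Suc c)) - x a (e c)"
  have g: "0 \<le> ?g c" if "c \<in> K" for c using senum_mono[OF e, of c "Suc c"] lt[OF that] by simp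
  show "(\<Sum>c\<in>?K. (?g c)\<^sup>2) \<le> (x t i - x t j)\<^sup>2"
  proof (cases "?K = {}")
    case False
    have b: "x t i \<le> x a (e c)" "x a (e (Suc c)) \<le> x t j" if "c \<in> ?K" for c
      using cut_bounds[OF e lt \<open>a \<le> t\<close> _ before, of c i]  cut_bounds[OF e lt \<open>a \<le> t\<close> _ before, of c j]
        that A ij by auto
    have "x t i \<le> x t j" using False b g by (smt (verit) Collect_empty_eq mem_Collect_eq)
    then have "(\<Sum>c\<in>?K. ?g c) \<le> x t j - x t i"
      by (intro sum_gaps[where N = "card A"]) (use senum_mono[OF e] K b in auto)
    moreover have "0 \<le> (\<Sum>c\<in>?K. ?g c)" using g by (intro sum_nonneg) auto
    ultimately have "(\<Sum>c\<in>?K. ?g c)\<^sup>2 \<le> (x t j - x t i)\<^sup>2" by (intro power_mono)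
    moreover have "(\<Sum>c\<in>?K. (?g c)\<^sup>2) \<le> (\<Sum>c\<in>?K. ?g c)\<^sup>2"
      using fK g by (intro sum_squares_le_square_sum) auto
    ultimately show ?thesis by (simp add: power2_commute)
  next
    case True
    show ?thesis unfolding True by simp
  qed
qed auto

text \<open>Each cut is charged at its first crossing. Charging starts at b, possibly later than the
  time a at which the gaps are measured: the expander case takes b = Suc a.\<close>

lemma cuts_drop_window:
  assumes e: "senum e (x a) A" and "a \<le> b" "b \<le> d" and A: "\<And>t. t \<in> {a..<d} \<Longrightarrow> closed_at A t"
    and K: "K \<subseteq> {..<card A - 1}"
    and before: "\<And>c t. c \<in> K \<Longrightarrow> t \<in> {a..<b} \<Longrightarrow> closed_at (e ` {..c}) t"
    and crossed: "\<And>c. c \<in> K \<Longrightarrow> \<exists>t\<in>{b..<d}. \<not> closed_at (e ` {..c}) t"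
  shows "(\<Sum>c\<in>K. (x a (e (Suc c)) - x a (e c))\<^sup>2) / 2 \<le> wvar q A (x b) - wvar q A (x d)"
  using \<open>b \<le> d\<close> A K before crossed
proof (induction d arbitrary: K rule: dec_induct)
  case base
  then have "K = {}" by auto
  then show ?case by simp
next
  case (step d)
  let ?g = "\<lambda>c. (x a (e (Suc c)) - x a (e c))\<^sup>2"
  define K1 where "K1 = {c \<in> K. \<exists>t\<in>{b..<d}. \<not> closed_at (e ` {..c}) t}"
  define K2 where "K2 = K - K1"
  have fK: "finite K" using step.prems(2) finite_subset by blast
  have "(\<Sum>c\<in>K1. ?g c) / 2 \<le> wvar q A (x b) - wvar q A (x d)"
    by (rule step.IH) (use step.prems K1_def in auto)
  moreover have "(\<Sum>c\<in>K2. ?g c) / 2 \<le> wvar q A (x d) - wvar q A (x (Suc d))"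
  proof (rule cuts_drop_at[OF e])
    show "closed_at (e ` {..c}) t" if "c \<in> K2" "t \<in> {a..<d}" for c t
      using that step.prems(3)[of c t] unfolding K2_def K1_def by (cases "t < b") auto
    show "\<not> closed_at (e ` {..c}) d" if "c \<in> K2" for c
      using that step.prems(4)[of c] unfolding K2_def K1_def by (auto simp: less_Suc_eq)
  qed (use step \<open>a \<le> b\<close> K2_def in auto)
  moreover have "(\<Sum>c\<in>K. ?g c) = (\<Sum>c\<in>K1. ?g c) + (\<Sum>c\<in>K2. ?g c)"
    using fK sum.subset_diff[of K1 K ?g] unfolding K2_def K1_def by auto
  ultimately show ?case by linarith
qed

lemma range_eq_sum_gaps:
  assumes "card A > 0"
  shows "x a (e (card A - 1)) - x a (e 0) = (\<Sum>c<card A - 1. x a (e (Suc c)) - x a (e c))"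
  using sum_lessThan_telescope[of "\<lambda>c. x a (e c)" "card A - 1"] by simp

lemma wvar_le_range:
  assumes e: "senum e (x a) A" and A: "closed_at A a" "A \<noteq> {}" and Q: "\<And>i. i \<in> A \<Longrightarrow> q i \<le> Q"
  shows "wvar q A (x a) \<le> Q * real (card A) * (x a (e (card A - 1)) - x a (e 0))\<^sup>2"
proof -
  have fin: "finite A" using closed_at_finite[OF A(1)] .
  have q1: "1 \<le> q i" if "i \<in> A" for i using q_ge closed_at_subset[OF A(1)] that by blast
  have q0: "0 \<le> q i" "0 < q i" if "i \<in> A" for i using q1[OF that] by auto
  have "(\<Sum>i\<in>A. q i) > 0" using q0 A(2) fin by (intro sum_pos) auto
  then have "wvar q A (x a) \<le> (\<Sum>i\<in>A. q i * (x a i - x a (e 0))\<^sup>2)" by (rule wvar_le)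
  also have "\<dots> \<le> (\<Sum>i\<in>A. Q * (x a (e (card A - 1)) - x a (e 0))\<^sup>2)"
  proof (intro sum_mono mult_mono)
    fix i assume i: "i \<in> A"
    then obtain l where l: "l < card A" "i = e l" using senum_obtain[OF e] by blast
    then have "x a (e 0) \<le> x a i" "x a i \<le> x a (e (card A - 1))"
      using senum_mono[OF e] by auto
    then show "(x a i - x a (e 0))\<^sup>2 \<le> (x a (e (card A - 1)) - x a (e 0))\<^sup>2"
      by (intro power_mono) auto
    show "0 \<le> Q" using Q[OF i] q0[OF i] by linarith
  qed (use Q in auto)
  finally show ?thesis by (simp add: mult_ac)
qed

text \<open>Every sorted cut is crossed within the phase, so each squared gap enters the drop with
  factor 1/2. With N vertices, Cauchy-Schwarz over fewer than N gaps and weights of at most 1/\<rho>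
  bound the variance by N^2/\<rho> times the sum of the squared gaps.\<close>

lemma phase_contraction:
  assumes A: "A \<noteq> {}" "a < b" "\<And>t. t \<in> {a..<b} \<Longrightarrow> closed_at A t" and ns: "no_split A a b"
  shows "wvar q A (x b) \<le> (1 - \<rho> / (2 * (real (card A))\<^sup>2)) * wvar q A (x a)"
proof -
  have Aa: "closed_at A a" using A by simp
  have fin: "finite A" using closed_at_finite[OF Aa] .
  then have pos: "card A > 0" using A(1) by (simp add: card_gt_0_iff)
  obtain e where e: "senum e (x a) A" using senum_exists[OF fin] by blast
  let ?g = "\<lambda>c. x a (e (Suc c)) - x a (e c)" and ?N = "real (card A)"
  have drop: "(\<Sum>c<card A - 1. (?g c)\<^sup>2) / 2 \<le> wvar q A (x a) - wvar q A (x b)"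
  proof (rule cuts_drop_window[OF e])
    show "\<exists>t\<in>{a..<b}. \<not> closed_at (e ` {..c}) t" if "c \<in> {..<card A - 1}" for c
      using ns initial_subset[OF e, of c] initial_proper[OF e, of c] that unfolding no_split_def by simp
  qed (use A in auto)
  have "wvar q A (x a) \<le> 1 / \<rho> * ?N * (x a (e (card A - 1)) - x a (e 0))\<^sup>2"
    using wvar_le_range[OF e Aa A(1)] q_le closed_at_subset[OF Aa] by blast
  also have "\<dots> \<le> 1 / \<rho> * ?N * ((\<Sum>c<card A - 1. (?g c)\<^sup>2) * ?N)"
  proof (rule mult_left_mono)
    have "(x a (e (card A - 1)) - x a (e 0))\<^sup>2 \<le> (\<Sum>c<card A - 1. (?g c)\<^sup>2) * real (card {..<card A - 1})"
      unfolding range_eq_sum_gaps[OF pos] by (rule sum_squared_le_sum_of_squares)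
    also have "\<dots> \<le> (\<Sum>c<card A - 1. (?g c)\<^sup>2) * ?N"
      by (intro mult_left_mono sum_nonneg) auto
    finally show "(x a (e (card A - 1)) - x a (e 0))\<^sup>2 \<le> (\<Sum>c<card A - 1. (?g c)\<^sup>2) * ?N" .
  qed (use rho_pos in simp)
  also have "\<dots> \<le> 1 / \<rho> * ?N * (2 * (wvar q A (x a) - wvar q A (x b)) * ?N)"
    using drop rho_pos by (intro mult_left_mono mult_right_mono) auto
  finally have "\<rho> * wvar q A (x a) \<le> 2 * ?N\<^sup>2 * (wvar q A (x a) - wvar q A (x b))"
    using rho_pos by (simp add: field_simps power2_eq_square)
  then show ?thesis using pos by (simp add: field_simps)
qed

text \<open>The rate r is left open so that the reversible and the expander case share the
  recursion; \<open>contr\<close> refers to m0 because the expander rate depends on the component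
  bound. Superadditivity of 1/r makes two subsystems together no dearer than the whole, which avoids
  a factor 2^m.\<close>

lemma cnt_bound:
  fixes r :: "nat \<Rightarrow> real"
  assumes eps: "0 < \<epsilon>" and s: "0 < s" "s \<le> 1"
    and r: "\<And>k. 0 < k \<Longrightarrow> 0 < r k \<and> r k \<le> 1"
    and super: "\<And>k l. 0 < k \<Longrightarrow> 0 < l \<Longrightarrow> 1 / r k + 1 / r l \<le> 1 / r (k + l)"
    and contr: "\<And>A a b. A \<noteq> {} \<Longrightarrow> a < b \<Longrightarrow>
      (\<And>t. t \<in> {a..<b} \<Longrightarrow> closed_at A t \<and> card (comps A t) \<le> m0) \<Longrightarrow> no_split A a b \<Longrightarrow>
      wvar q A (x b) \<le> (1 - r (card A)) * wvar q A (x a)"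
  shows "m \<le> m0 \<Longrightarrow> A \<noteq> {} \<Longrightarrow> A \<subseteq> {..<n} \<Longrightarrow>
      (\<And>t. t \<in> {a..<b} \<Longrightarrow> closed_at A t \<and> card (comps A t) \<le> m) \<Longrightarrow>
      real (cnt \<epsilon> A a b) \<le> (2 * wvar q A (x a) / \<epsilon>\<^sup>2) powr s * (2 / (s * r (card A))) ^ m"
proof (induction m arbitrary: A a b)
  case 0
  then show ?case
  proof (cases "a < b")
    case True
    then show ?thesis using 0(4)[of a] comps_nonempty[of A a] 0(2) by auto
  qed (simp add: cnt_def)
next
  case (Suc m)
  note IH_m = Suc.IH
  define k where "k = card A"
  define y where "y k = 2 / (s * r k)" for k
  let ?W = "\<lambda>A a. (2 * wvar q A (x a) / \<epsilon>\<^sup>2) powr s"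
  have finA: "finite A" using Suc.prems(3) finite_subset by blast
  have k0: "0 < k" unfolding k_def using Suc.prems(2) finA by (simp add: card_gt_0_iff)
  have y2: "2 \<le> y k" if "0 < k" for k
  proof -
    have "s * r k \<le> 1" using r[OF that] s by (simp add: mult_le_one)
    then show ?thesis using r[OF that] s by (simp add: y_def field_simps)
  qed
  have rhs0: "0 \<le> ?W A a * y (card A) ^ Suc m" for a
    using order_trans[OF _ y2[OF k0], of 0] unfolding k_def by (intro mult_nonneg_nonneg zero_le_power) simp_all
  have q1: "1 \<le> q i" if "i \<in> A" for i
    using q_ge[of i] Suc.prems(3) that by auto
  have qpos: "0 < q i" if "i \<in> A" for i
    using q_ge[of i] Suc.prems(3) that by auto
  \<comment> \<open>While \<open>no_split\<close> fails, some proper part is closed throughout, so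
    both sides fall under the induction hypothesis with one component less.\<close>
  have part: "real (cnt \<epsilon> A a c) \<le> ?W A a * y k ^ m \<and> 0 < m"
    if "a < c" "c \<le> b" and ns: "\<not> no_split A a c" and cl: "\<And>t. t \<in> {a..<b} \<Longrightarrow> closed_at A t \<and> card (comps A t) \<le> Suc m"
    for a c b
  proof -
    have cl': "closed_at A t \<and> card (comps A t) \<le> Suc m" if "t \<in> {a..<c}" for t
      using cl that \<open>c \<le> b\<close> by auto
    obtain B where B: "B \<subseteq> A" "B \<noteq> {}" "A - B \<noteq> {}" "1 < Suc m"
      "\<And>t. t \<in> {a..<c} \<Longrightarrow> closed_at B t \<and> card (comps B t) \<le> Suc m - 1"
      "\<And>t. t \<in> {a..<c} \<Longrightarrow> closed_at (A - B) t \<and> card (comps (A - B) t) \<le> Suc m - 1"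
      using split_off[OF cl' \<open>a < c\<close> ns] by metis
    have sub: "B \<subseteq> {..<n}" "A - B \<subseteq> {..<n}" using B(1) Suc.prems(3) by auto
    have one: "real (cnt \<epsilon> D a c) \<le> ?W A a * y (card D) ^ m"
      if D: "D \<subseteq> A" "D \<noteq> {}" "\<And>t. t \<in> {a..<c} \<Longrightarrow> closed_at D t \<and> card (comps D t) \<le> m" for D
    proof -
      have fD: "finite D" "0 < card D"
        using finite_subset[OF D(1) finA] D(2) by (auto simp: card_gt_0_iff)
      have "real (cnt \<epsilon> D a c) \<le> ?W D a * y (card D) ^ m"
        unfolding y_def using D Suc.prems(1,3) by (intro IH_m) auto
      also have "\<dots> \<le> ?W A a * y (card D) ^ m"
      proof (intro mult_right_mono powr_mono2)
        show "2 * wvar q D (x a) / \<epsilon>\<^sup>2 \<le> 2 * wvar q A (x a) / \<epsilon>\<^sup>2"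
          using wvar_mono[OF finA D(1,2), of q "x a"] qpos eps by (intro divide_right_mono) auto
        obtain i where "i \<in> D" using D(2) by blast
        then have "0 \<le> wvar q D (x a)"
          using wvar_ge_pair[OF fD(1), of q i i "x a"] q_ge D(1) Suc.prems(3) by auto
        then show "0 \<le> 2 * wvar q D (x a) / \<epsilon>\<^sup>2" by simp
        show "0 \<le> y (card D) ^ m" using y2[OF fD(2)] by (intro zero_le_power) linarith
      qed (use s in auto)
      finally show ?thesis .
    qed
    have fB: "finite B" using finite_subset[OF B(1) finA] .
    have cB: "0 < card B" "0 < card (A - B)"
      using B(2,3) finA fB by (auto simp: card_gt_0_iff)
    have kk: "card B + card (A - B) = k"
      unfolding k_def using card_Diff_subset[OF fB B(1)] card_mono[OF finA B(1)] by simp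
    have ysum: "y (card B) + y (card (A - B)) \<le> y k"
    proof -
      have "y (card B) + y (card (A - B)) = 2 / s * (1 / r (card B) + 1 / r (card (A - B)))"
        by (simp add: y_def distrib_left)
      also have "\<dots> \<le> 2 / s * (1 / r k)"
        using super[OF cB] s unfolding kk by (intro mult_left_mono) auto
      finally show ?thesis by (simp add: y_def)
    qed
    obtain m' where m': "m = Suc m'" using B(4) by (cases m) auto
    \<comment> \<open>Superadditivity passes to the power m because m > 0: a split set has at least
      two components.\<close>
    have "y (card B) ^ m + y (card (A - B)) ^ m \<le> y k ^ m"
    proof -
      have u: "0 \<le> y (card B)" "0 \<le> y (card (A - B))" using y2[OF cB(1)] y2[OF cB(2)] by linarith+
      have "y (card B) ^ m + y (card (A - B)) ^ m
          \<le> y (card B) * y k ^ m' + y (card (A - B)) * y k ^ m'"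
        unfolding m' power_Suc using u ysum by (intro add_mono mult_left_mono power_mono) linarith+
      also have "\<dots> \<le> y k * y k ^ m'"
        using ysum u by (simp only: flip: distrib_right) (intro mult_right_mono zero_le_power, linarith+)
      finally show ?thesis by (simp add: m')
    qed
    moreover have "real (cnt \<epsilon> A a c) \<le> real (cnt \<epsilon> B a c) + real (cnt \<epsilon> (A - B) a c)"
      using cnt_split[of a c A B \<epsilon>] cl' B(1,5) by (metis of_nat_add of_nat_le_iff)
    moreover have "real (cnt \<epsilon> B a c) \<le> ?W A a * y (card B) ^ m"
      using B by (intro one) auto
    moreover have "real (cnt \<epsilon> (A - B) a c) \<le> ?W A a * y (card (A - B)) ^ m"
      using B by (intro one) auto
    ultimately have "real (cnt \<epsilon> A a c) \<le> ?W A a * (y (card B) ^ m + y (card (A - B)) ^ m)"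
      and "y (card B) ^ m + y (card (A - B)) ^ m \<le> y k ^ m"
      by (auto simp: distrib_left)
    then show ?thesis
      using m' mult_left_mono[of "y (card B) ^ m + y (card (A - B)) ^ m" "y k ^ m" "?W A a"] by simp
  qed
  \<comment> \<open>Inner induction over the phases, on the length of the remaining window.\<close>
  have "real (cnt \<epsilon> A a b) \<le> ?W A a * y (card A) ^ Suc m" using Suc.prems(4)
  proof (induction "b - a" arbitrary: a rule: less_induct)
    case less
    show ?case
    proof (cases "a < b")
      case False
      then have "cnt \<epsilon> A a b = 0" by (simp add: cnt_def)
      then show ?thesis using rhs0[of a] by simp
    next
      case ab: True
      show ?thesis
      proof (cases "\<exists>t\<in>{a..<b}. long_at \<epsilon> A t")
        case False
        then have "cnt \<epsilon> A a b = 0" by (intro cnt_zero) auto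
        then show ?thesis using rhs0[of a] by simp
      next
        case True
        then obtain t where t: "t \<in> {a..<b}" "long_at \<epsilon> A t" by blast
        \<comment> \<open>A long edge still to come keeps the potential above the threshold. Hence W
          \<ge> 1, which pays for the crossing step itself.\<close>
        have big: "\<epsilon>\<^sup>2 \<le> 2 * wvar q A (x a)"
        proof -
          obtain i j where ij: "i \<in> A" "j \<in> A" "\<epsilon> \<le> \<bar>x t i - x t j\<bar>" using t(2) by (auto simp: long_at_def)
          have "\<epsilon>\<^sup>2 \<le> (x t i - x t j)\<^sup>2" using ij(3) eps by (metis abs_le_square_iff abs_of_pos)
          also have "\<dots> \<le> 2 * wvar q A (x t)"
            using wvar_ge_pair[where q = q and f = "x t", OF finA q1 ij(1,2)] by simp
          also have "\<dots> \<le> 2 * wvar q A (x a)"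
            using wvar_window[of a t A] less.prems t by auto
          finally show ?thesis .
        qed
        have W1: "1 \<le> ?W A a" using big eps s by (intro ge_one_powr_ge_zero) auto
        have ym: "1 \<le> y k ^ m" using y2[OF k0] by (intro one_le_power) simp
        have Wy: "0 \<le> ?W A a * y k ^ m" using W1 ym by simp
        show ?thesis
        proof (cases "no_split A a b")
          case False
          have "real (cnt \<epsilon> A a b) \<le> ?W A a * y k ^ m"
            using part[OF ab order_refl False less.prems] by blast
          also have "\<dots> \<le> ?W A a * y k ^ Suc m"
            using W1 y2[OF k0] by (intro mult_left_mono power_increasing) auto
          finally show ?thesis by (simp add: k_def)
        next
          case True
          \<comment> \<open>The first phase ends at d = Suc e. The window up to e is still split, so
            \<open>part\<close> applies to it; the step at e counts for at most 1.\<close>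
          define d where "d = (LEAST d. a < d \<and> no_split A a d)"
          have ab': "a < b \<and> no_split A a b" using True ab by simp
          have "a < d \<and> no_split A a d" unfolding d_def by (rule LeastI[of _ b]) (rule ab')
          then have ad: "a < d" and d: "no_split A a d" by simp_all
          have db: "d \<le> b" unfolding d_def by (rule Least_le) (rule ab')
          have dmin: "\<not> no_split A a c" if "a < c" "c < d" for c
            using that not_less_Least[of c "\<lambda>d. a < d \<and> no_split A a d"] unfolding d_def by blast
          obtain e where e: "d = Suc e" "a \<le> e" using ad by (cases d) auto
          have "real (cnt \<epsilon> A a b) = real (cnt \<epsilon> A a e) + real (cnt \<epsilon> A e (Suc e)) + real (cnt \<epsilon> A d b)"
            using cnt_append[of a e b \<epsilon> A] cnt_append[of e "Suc e" b \<epsilon> A] e db by simp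
          moreover have "real (cnt \<epsilon> A e (Suc e)) \<le> ?W A a * y k ^ m"
            using cnt_single[of \<epsilon> A e] mult_mono[OF W1 ym] W1 by simp
          moreover have "real (cnt \<epsilon> A a e) \<le> ?W A a * y k ^ m"
          proof (cases "a < e")
            case True
            have "e \<le> b" "e < d" using e(1) db by auto
              then show ?thesis using part[OF True _ dmin[OF True] less.prems, of b] by blast
          next
            case False
            then show ?thesis using Wy by (simp add: cnt_def)
          qed
          moreover have "real (cnt \<epsilon> A d b) \<le> (1 - s * r k) * ?W A a * y k ^ Suc m"
          proof -
            have "real (cnt \<epsilon> A d b) \<le> ?W A d * y k ^ Suc m"
              unfolding k_def using less.hyps[of d] less.prems ad db ab by auto
            also have "?W A d \<le> ((1 - r k) * (2 * wvar q A (x a) / \<epsilon>\<^sup>2)) powr s"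
            proof (rule powr_mono2)
              obtain i where "i \<in> A" using Suc.prems(2) by blast
              then have "0 \<le> wvar q A (x d)"
                using wvar_ge_pair[where q = q and f = "x d" and i = i and j = i, OF finA q1] by simp
              then show "0 \<le> 2 * wvar q A (x d) / \<epsilon>\<^sup>2" by simp
              have "closed_at A t \<and> card (comps A t) \<le> m0" if "t \<in> {a..<d}" for t
                using less.prems[of t] that db Suc.prems(1) by auto
              then have "wvar q A (x d) \<le> (1 - r k) * wvar q A (x a)"
                using contr[OF Suc.prems(2) ad _ d] unfolding k_def by blast
              then show "2 * wvar q A (x d) / \<epsilon>\<^sup>2 \<le> (1 - r k) * (2 * wvar q A (x a) / \<epsilon>\<^sup>2)"
                using eps by (simp add: field_simps)
            qed (use s in auto)
            also have "\<dots> = (1 - r k) powr s * ?W A a"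
              using r[OF k0] big by (intro powr_mult)
            also have "\<dots> \<le> (1 - s * r k) * ?W A a"
              using r[OF k0] s by (intro mult_right_mono powr_one_minus_le) auto
            finally show ?thesis using y2[OF k0] by (simp add: mult_right_mono)
          qed
          ultimately have "real (cnt \<epsilon> A a b)
              \<le> ?W A a * (2 * y k ^ m + (1 - s * r k) * y k ^ Suc m)"
            by (simp add: algebra_simps)
          \<comment> \<open>The balance that fixes y: s * r * y = 2 pays for the two terms
            y^m.\<close>
          also have "2 * y k ^ m + (1 - s * r k) * y k ^ Suc m = y k ^ Suc m"
            using r[OF k0] s by (simp add: field_simps y_def)
          finally show ?thesis by (simp add: k_def)
        qed
      qed
    qed
  qed
  then show ?case by (simp only: y_def)
qed

end

section \<open>Cheeger's inequality\<close>

text \<open>A discrete co-area argument. Subtracting the smallest positive value v on the support S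
  lowers the right side by 2 * v times the weight of the cut of S, the left side by 2 * h * v * card
  S, and the support shrinks.\<close>

lemma layered_cut_bound:
  fixes a :: "nat \<Rightarrow> nat \<Rightarrow> real"
  assumes fin: "finite C" and a0: "\<And>i j. i \<in> C \<Longrightarrow> j \<in> C \<Longrightarrow> 0 \<le> a i j"
    and sym: "\<And>i j. i \<in> C \<Longrightarrow> j \<in> C \<Longrightarrow> a i j = a j i"
    and cut: "\<And>S. S \<subseteq> C \<Longrightarrow> S \<noteq> {} \<Longrightarrow> 2 * card S \<le> card C \<Longrightarrow>
       h * real (card S) \<le> (\<Sum>i\<in>S. \<Sum>j\<in>C - S. a i j)"
    and f0: "\<And>i. i \<in> C \<Longrightarrow> 0 \<le> f i" and supp: "2 * card {i \<in> C. f i > 0} \<le> card C"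
  shows "2 * h * (\<Sum>i\<in>C. f i) \<le> (\<Sum>i\<in>C. \<Sum>j\<in>C. a i j * \<bar>f i - f j\<bar>)"
  using f0 supp
proof (induction "card {i \<in> C. f i > 0}" arbitrary: f rule: less_induct)
  case less
  define S where "S = {i \<in> C. f i > 0}"
  have S: "S \<subseteq> C" "finite S" using fin by (auto simp: S_def)
  show ?case
  proof (cases "S = {}")
    case True
    have "f i = 0" if "i \<in> C" for i
    proof -
      have "\<not> f i > 0" using True that unfolding S_def by blast
      then show ?thesis using less.prems(1)[OF that] by simp
    qed
    then have "(\<Sum>i\<in>C. f i) = 0" by simp
    moreover have "0 \<le> (\<Sum>i\<in>C. \<Sum>j\<in>C. a i j * \<bar>f i - f j\<bar>)"
      using a0 by (intro sum_nonneg mult_nonneg_nonneg) auto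
    ultimately show ?thesis by simp
  next
    case False
    define v where "v = Min (f ` S)"
    have vle: "v \<le> f i" if "i \<in> S" for i unfolding v_def using S that by simp
    have "v \<in> f ` S" unfolding v_def using S(2) False by (intro Min_in) auto
    then obtain k where k: "k \<in> S" "f k = v" by blast
    have v0: "v > 0" using k by (auto simp: S_def)
    define g where "g = (\<lambda>i. if i \<in> S then f i - v else f i)"
    have fz: "f i = 0" if "i \<in> C - S" for i
    proof -
      have "\<not> f i > 0" using that unfolding S_def by blast
      then show ?thesis using less.prems(1)[of i] that by simp
    qed
    have "i \<in> S - {k}" if "i \<in> C" "g i > 0" for i
      using that k fz[of i] by (cases "i \<in> S"; cases "i = k") (simp_all add: g_def)
    then have gs: "{i \<in> C. g i > 0} \<subset> S" using k(1) by blast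
    have lt: "card {i \<in> C. g i > 0} < card {i \<in> C. f i > 0}"
      using psubset_card_mono[OF S(2) gs] by (simp add: S_def)
    have IH: "2 * h * (\<Sum>i\<in>C. g i) \<le> (\<Sum>i\<in>C. \<Sum>j\<in>C. a i j * \<bar>g i - g j\<bar>)"
    proof (rule less.hyps[OF lt])
      show "0 \<le> g i" if "i \<in> C" for i using less.prems(1)[OF that] vle by (auto simp: g_def)
      show "2 * card {i \<in> C. 0 < g i} \<le> card C" using lt less.prems(2) by linarith
    qed
    let ?o = "\<lambda>i j. of_bool (i \<in> S \<and> j \<notin> S) :: real"
    have eq: "\<bar>f i - f j\<bar> = \<bar>g i - g j\<bar> + v * ?o i j + v * ?o j i" if "i \<in> C" "j \<in> C" for i j
      using that fz[of i] fz[of j] vle[of i] vle[of j] v0 by (auto simp: g_def)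
    have o1: "(\<Sum>i\<in>C. \<Sum>j\<in>C. a i j * ?o i j) = (\<Sum>i\<in>S. \<Sum>j\<in>C - S. a i j)"
    proof -
      have "(\<Sum>i\<in>C. \<Sum>j\<in>C. a i j * ?o i j) = (\<Sum>i\<in>S. \<Sum>j\<in>C. a i j * ?o i j)"
        using fin S by (intro sum.mono_neutral_right) auto
      also have "\<dots> = (\<Sum>i\<in>S. \<Sum>j\<in>C - S. a i j)"
        using fin S by (intro sum.cong refl sum.mono_neutral_cong_right) auto
      finally show ?thesis .
    qed
    have o2: "(\<Sum>i\<in>C. \<Sum>j\<in>C. a i j * ?o j i) = (\<Sum>i\<in>S. \<Sum>j\<in>C - S. a i j)"
    proof -
      have "(\<Sum>i\<in>C. \<Sum>j\<in>C. a i j * ?o j i) = (\<Sum>j\<in>C. \<Sum>i\<in>C. a j i * ?o j i)"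
        by (subst sum.swap) (use sym in \<open>auto intro!: sum.cong\<close>)
      then show ?thesis using o1 by simp
    qed
    have "(\<Sum>i\<in>C. \<Sum>j\<in>C. a i j * \<bar>f i - f j\<bar>)
      = (\<Sum>i\<in>C. \<Sum>j\<in>C. a i j * \<bar>g i - g j\<bar> + v * (a i j * ?o i j) + v * (a i j * ?o j i))"
      by (intro sum.cong refl) (simp only: eq distrib_left mult_ac)
    also have "\<dots> = (\<Sum>i\<in>C. \<Sum>j\<in>C. a i j * \<bar>g i - g j\<bar>) + v * (\<Sum>i\<in>C. \<Sum>j\<in>C. a i j * ?o i j)
        + v * (\<Sum>i\<in>C. \<Sum>j\<in>C. a i j * ?o j i)"
      by (simp only: sum.distrib sum_distrib_left)
    also have "\<dots> = (\<Sum>i\<in>C. \<Sum>j\<in>C. a i j * \<bar>g i - g j\<bar>) + 2 * v * (\<Sum>i\<in>S. \<Sum>j\<in>C - S. a i j)"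
      unfolding o1 o2 by simp
    finally have L: "(\<Sum>i\<in>C. \<Sum>j\<in>C. a i j * \<bar>f i - f j\<bar>)
      = (\<Sum>i\<in>C. \<Sum>j\<in>C. a i j * \<bar>g i - g j\<bar>) + 2 * v * (\<Sum>i\<in>S. \<Sum>j\<in>C - S. a i j)" .
    have sg: "(\<Sum>i\<in>C. f i) = (\<Sum>i\<in>C. g i) + v * real (card S)"
    proof -
      have "(\<Sum>i\<in>C. f i) = (\<Sum>i\<in>C. g i + (if i \<in> S then v else 0))"
        by (intro sum.cong) (auto simp: g_def)
      also have "\<dots> = (\<Sum>i\<in>C. g i) + v * real (card S)"
        using fin S by (simp add: sum.distrib sum.inter_restrict[symmetric] Int_absorb1)
      finally show ?thesis .
    qed
    have "h * real (card S) \<le> (\<Sum>i\<in>S. \<Sum>j\<in>C - S. a i j)"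
      using cut[OF S(1) False] less.prems(2) by (simp add: S_def)
    then have "2 * v * (h * real (card S)) \<le> 2 * v * (\<Sum>i\<in>S. \<Sum>j\<in>C - S. a i j)"
      using v0 by (intro mult_left_mono) auto
    then show ?thesis unfolding L sg using IH by (simp add: algebra_simps)
  qed
qed

text \<open>\<open>layered_cut_bound\<close> is applied to the squares, and each difference of
  squares is factored. The weights in the AM-GM step are tuned so that the sums g i + g j cost h
  times the sum of squares, half of the left side.\<close>

lemma cheeger_half:
  fixes a :: "nat \<Rightarrow> nat \<Rightarrow> real"
  assumes fin: "finite C" and a0: "\<And>i j. i \<in> C \<Longrightarrow> j \<in> C \<Longrightarrow> 0 \<le> a i j"
    and sym: "\<And>i j. i \<in> C \<Longrightarrow> j \<in> C \<Longrightarrow> a i j = a j i"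
    and row: "\<And>i. i \<in> C \<Longrightarrow> (\<Sum>j\<in>C. a i j) \<le> \<Delta>" and pos: "0 < \<Delta>" "0 < h"
    and cut: "\<And>S. S \<subseteq> C \<Longrightarrow> S \<noteq> {} \<Longrightarrow> 2 * card S \<le> card C \<Longrightarrow>
       h * real (card S) \<le> (\<Sum>i\<in>S. \<Sum>j\<in>C - S. a i j)"
    and g0: "\<And>i. i \<in> C \<Longrightarrow> 0 \<le> g i" and supp: "2 * card {i \<in> C. g i > 0} \<le> card C"
  shows "h\<^sup>2 / \<Delta> * (\<Sum>i\<in>C. (g i)\<^sup>2) \<le> (\<Sum>i\<in>C. \<Sum>j\<in>C. a i j * (g i - g j)\<^sup>2)"
proof -
  let ?G = "\<Sum>i\<in>C. (g i)\<^sup>2" and ?D = "\<Sum>i\<in>C. \<Sum>j\<in>C. a i j * (g i - g j)\<^sup>2"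
  have rows: "(\<Sum>i\<in>C. \<Sum>j\<in>C. a i j * (g i)\<^sup>2) \<le> \<Delta> * ?G"
  proof -
    have "(\<Sum>i\<in>C. \<Sum>j\<in>C. a i j * (g i)\<^sup>2) = (\<Sum>i\<in>C. (\<Sum>j\<in>C. a i j) * (g i)\<^sup>2)"
      by (simp add: sum_distrib_right)
    also have "\<dots> \<le> (\<Sum>i\<in>C. \<Delta> * (g i)\<^sup>2)" using row by (intro sum_mono mult_right_mono) auto
    finally show ?thesis by (simp add: sum_distrib_left)
  qed
  have cols: "(\<Sum>i\<in>C. \<Sum>j\<in>C. a i j * (g j)\<^sup>2) \<le> \<Delta> * ?G"
  proof -
    have "(\<Sum>i\<in>C. \<Sum>j\<in>C. a i j * (g j)\<^sup>2) = (\<Sum>j\<in>C. \<Sum>i\<in>C. a j i * (g j)\<^sup>2)"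
      by (subst sum.swap) (use sym in \<open>auto intro!: sum.cong\<close>)
    then show ?thesis using rows by simp
  qed
  have supp': "2 * card {i \<in> C. (g i)\<^sup>2 > 0} \<le> card C"
  proof -
    have "{i \<in> C. (g i)\<^sup>2 > 0} = {i \<in> C. g i > 0}" using g0 by force
    then show ?thesis using supp by simp
  qed
  have "2 * h * ?G \<le> (\<Sum>i\<in>C. \<Sum>j\<in>C. a i j * \<bar>(g i)\<^sup>2 - (g j)\<^sup>2\<bar>)"
    by (rule layered_cut_bound[OF fin a0 sym cut _ supp']) auto
  also have "\<dots> \<le> (\<Sum>i\<in>C. \<Sum>j\<in>C. \<Delta> / h * (a i j * (g i - g j)\<^sup>2) + h / (2 * \<Delta>) * (a i j * (g i)\<^sup>2 + a i j * (g j)\<^sup>2))"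
  proof (intro sum_mono)
    fix i j assume ij: "i \<in> C" "j \<in> C"
    define u where "u = \<bar>g i - g j\<bar>"
    define w where "w = g i + g j"
    have "\<bar>(g i)\<^sup>2 - (g j)\<^sup>2\<bar> = u * w"
      using g0 ij by (simp add: u_def w_def power2_eq_square square_diff_square_factored abs_mult mult.commute)
    also have "\<dots> \<le> \<Delta> / h * u\<^sup>2 + h / (4 * \<Delta>) * w\<^sup>2"
    proof -
      have "0 \<le> \<Delta> / h * (u - h / (2 * \<Delta>) * w)\<^sup>2" using pos by simp
      also have "\<dots> = \<Delta> / h * u\<^sup>2 + h / (4 * \<Delta>) * w\<^sup>2 - u * w"
        using pos by (simp add: field_simps power2_eq_square)
      finally show ?thesis by simp
    qed
    also have "w\<^sup>2 \<le> 2 * ((g i)\<^sup>2 + (g j)\<^sup>2)"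
      unfolding w_def using sum_squares_bound[of "g i" "g j"] by (simp add: power2_sum)
    then have "h / (4 * \<Delta>) * w\<^sup>2 \<le> h / (4 * \<Delta>) * (2 * ((g i)\<^sup>2 + (g j)\<^sup>2))"
      using pos by (intro mult_left_mono) auto
    also have "h / (4 * \<Delta>) * (2 * ((g i)\<^sup>2 + (g j)\<^sup>2)) = h / (2 * \<Delta>) * ((g i)\<^sup>2 + (g j)\<^sup>2)"
      using pos by (simp add: field_simps)
    finally have "\<bar>(g i)\<^sup>2 - (g j)\<^sup>2\<bar> \<le> \<Delta> / h * (g i - g j)\<^sup>2 + h / (2 * \<Delta>) * ((g i)\<^sup>2 + (g j)\<^sup>2)"
      by (simp add: u_def)
    then have "a i j * \<bar>(g i)\<^sup>2 - (g j)\<^sup>2\<bar>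
      \<le> a i j * (\<Delta> / h * (g i - g j)\<^sup>2 + h / (2 * \<Delta>) * ((g i)\<^sup>2 + (g j)\<^sup>2))"
      using a0[OF ij] by (rule mult_left_mono)
    then show "a i j * \<bar>(g i)\<^sup>2 - (g j)\<^sup>2\<bar>
      \<le> \<Delta> / h * (a i j * (g i - g j)\<^sup>2) + h / (2 * \<Delta>) * (a i j * (g i)\<^sup>2 + a i j * (g j)\<^sup>2)"
      by (simp add: algebra_simps)
  qed
  also have "\<dots> = \<Delta> / h * ?D + h / (2 * \<Delta>) * ((\<Sum>i\<in>C. \<Sum>j\<in>C. a i j * (g i)\<^sup>2) + (\<Sum>i\<in>C. \<Sum>j\<in>C. a i j * (g j)\<^sup>2))"
    by (simp only: sum.distrib sum_distrib_left distrib_left)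
  also have "\<dots> \<le> \<Delta> / h * ?D + h / (2 * \<Delta>) * (\<Delta> * ?G + \<Delta> * ?G)"
    using rows cols pos by (intro add_left_mono mult_left_mono add_mono) auto
  also have "\<dots> = \<Delta> / h * ?D + h * ?G" using pos by simp
  finally have "h * ?G \<le> \<Delta> / h * ?D" by simp
  then show ?thesis using pos by (simp add: field_simps power2_eq_square)
qed

lemma exists_median:
  fixes f :: "nat \<Rightarrow> real"
  assumes "finite C"
  shows "\<exists>c. 2 * card {i \<in> C. f i > c} \<le> card C \<and> 2 * card {i \<in> C. f i < c} \<le> card C"
proof -
  obtain e where e: "bij_betw e {..<card C} C" "\<And>i j. i \<le> j \<Longrightarrow> j < card C \<Longrightarrow> f (e i) \<le> f (e j)"
    using sorted_enumeration[OF assms] by metis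
  let ?k = "card C div 2"
  have ex: "\<exists>l<card C. i = e l" if "i \<in> C" for i using e(1) that by (auto simp: bij_betw_def)
  have "{i \<in> C. f i > f (e ?k)} \<subseteq> e ` {?k<..<card C}"
  proof
    fix i assume i: "i \<in> {i \<in> C. f i > f (e ?k)}"
    then obtain l where l: "l < card C" "i = e l" using ex by blast
    then have "\<not> l \<le> ?k" using e(2)[of l ?k] i by force
    then show "i \<in> e ` {?k<..<card C}" using l by auto
  qed
  then have "card {i \<in> C. f i > f (e ?k)} \<le> card {?k<..<card C}"
    by (meson card_image_le card_mono finite_imageI finite_greaterThanLessThan order_trans)
  moreover have "{i \<in> C. f i < f (e ?k)} \<subseteq> e ` {..<?k}"
  proof
    fix i assume i: "i \<in> {i \<in> C. f i < f (e ?k)}"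
    then obtain l where l: "l < card C" "i = e l" using ex by blast
    then have "\<not> ?k \<le> l" using e(2)[of ?k l] i by force
    then show "i \<in> e ` {..<?k}" using l by auto
  qed
  then have "card {i \<in> C. f i < f (e ?k)} \<le> card {..<?k}"
    by (meson card_image_le card_mono finite_imageI finite_lessThan order_trans)
  ultimately show ?thesis by (intro exI[of _ "f (e ?k)"]) auto
qed

text \<open>Cut f at a median. The parts above and below it have supports of at most half of C,
  where the cut condition applies. Along a pair the increments of the two parts never have the same
  sign as each other, so their Dirichlet forms add up to at most that of f.\<close>

lemma cheeger_inequality:
  fixes a :: "nat \<Rightarrow> nat \<Rightarrow> real"
  assumes fin: "finite C" "C \<noteq> {}" and a0: "\<And>i j. i \<in> C \<Longrightarrow> j \<in> C \<Longrightarrow> 0 \<le> a i j"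
    and sym: "\<And>i j. i \<in> C \<Longrightarrow> j \<in> C \<Longrightarrow> a i j = a j i"
    and row: "\<And>i. i \<in> C \<Longrightarrow> (\<Sum>j\<in>C. a i j) \<le> \<Delta>" and pos: "0 < \<Delta>" "0 < h"
    and cut: "\<And>S. S \<subseteq> C \<Longrightarrow> S \<noteq> {} \<Longrightarrow> 2 * card S \<le> card C \<Longrightarrow>
       h * real (card S) \<le> (\<Sum>i\<in>S. \<Sum>j\<in>C - S. a i j)"
  shows "h\<^sup>2 / \<Delta> * wvar (\<lambda>_. 1) C f \<le> (\<Sum>i\<in>C. \<Sum>j\<in>C. a i j * (f i - f j)\<^sup>2)"
proof -
  obtain c where c: "2 * card {i \<in> C. f i > c} \<le> card C" "2 * card {i \<in> C. f i < c} \<le> card C"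
    using exists_median[OF fin(1)] by blast
  define u where "u = (\<lambda>i. max (f i - c) 0)"
  define w where "w = (\<lambda>i. max (c - f i) 0)"
  have su: "2 * card {i \<in> C. u i > 0} \<le> card C"
    using c(1) by (simp add: u_def less_max_iff_disj)
  have sw: "2 * card {i \<in> C. w i > 0} \<le> card C"
    using c(2) by (simp add: w_def less_max_iff_disj)
  have "(\<Sum>i\<in>C. (1::real)) > 0" using fin by (simp add: card_gt_0_iff)
  then have "wvar (\<lambda>_. 1) C f \<le> (\<Sum>i\<in>C. 1 * (f i - c)\<^sup>2)" by (rule wvar_le)
  also have "\<dots> = (\<Sum>i\<in>C. (u i)\<^sup>2) + (\<Sum>i\<in>C. (w i)\<^sup>2)"
    unfolding sum.distrib[symmetric]
    by (intro sum.cong refl) (auto simp: u_def w_def max_def power2_commute)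
  finally have "h\<^sup>2 / \<Delta> * wvar (\<lambda>_. 1) C f \<le> h\<^sup>2 / \<Delta> * ((\<Sum>i\<in>C. (u i)\<^sup>2) + (\<Sum>i\<in>C. (w i)\<^sup>2))"
    using pos by (intro mult_left_mono) auto
  also have "\<dots> = h\<^sup>2 / \<Delta> * (\<Sum>i\<in>C. (u i)\<^sup>2) + h\<^sup>2 / \<Delta> * (\<Sum>i\<in>C. (w i)\<^sup>2)"
    by (simp add: distrib_left)
  also have "\<dots> \<le> (\<Sum>i\<in>C. \<Sum>j\<in>C. a i j * (u i - u j)\<^sup>2) + (\<Sum>i\<in>C. \<Sum>j\<in>C. a i j * (w i - w j)\<^sup>2)"
    by (intro add_mono cheeger_half[OF fin(1) a0 sym row pos cut _ su] cheeger_half[OF fin(1) a0 sym row pos cut _ sw])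
      (auto simp: u_def w_def)
  also have "\<dots> = (\<Sum>i\<in>C. \<Sum>j\<in>C. a i j * ((u i - u j)\<^sup>2 + (w i - w j)\<^sup>2))"
    by (simp add: sum.distrib distrib_left)
  also have "\<dots> \<le> (\<Sum>i\<in>C. \<Sum>j\<in>C. a i j * (f i - f j)\<^sup>2)"
  proof (intro sum_mono mult_left_mono a0)
    fix i j
    have "(u i - u j) * (w i - w j) \<le> 0"
      by (auto simp: u_def w_def max_def mult_nonneg_nonpos mult_nonpos_nonneg mult_le_0_iff)
    moreover have "f i - f j = (u i - u j) - (w i - w j)" by (auto simp: u_def w_def max_def)
    then have "(f i - f j)\<^sup>2 = ((u i - u j) - (w i - w j))\<^sup>2" by (simp only:)
    then have "(f i - f j)\<^sup>2 = (u i - u j)\<^sup>2 + (w i - w j)\<^sup>2 - 2 * ((u i - u j) * (w i - w j))"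
      by (simp only: power2_diff mult.assoc)
    ultimately show "(u i - u j)\<^sup>2 + (w i - w j)\<^sup>2 \<le> (f i - f j)\<^sup>2" by simp
  qed
  finally show ?thesis .
qed

section \<open>Drop of the variance along edges and under expansion\<close>

context reversible begin

text \<open>Among the pairs of neighbours of k, keep those that contain k: its self-loop has weight
  at least 1, and the two orders of a pair cancel the factor 1/2.\<close>

lemma edge_drop:
  assumes A: "closed_at A t"
  shows "(\<Sum>k\<in>A. 1 / q k * (\<Sum>j\<in>A. M t k j * (x t k - x t j)\<^sup>2)) \<le> wvar q A (x t) - wvar q A (x (Suc t))"
  unfolding step_drop[OF A]
proof (rule sum_mono)
  fix k assume k: "k \<in> A"
  have fin: "finite A" using closed_at_finite[OF A] .
  have lt: "i \<in> A \<Longrightarrow> i < n" for i using closed_at_subset[OF A] .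
  have nn: "i \<in> A \<Longrightarrow> j \<in> A \<Longrightarrow> 0 \<le> M t i j" for i j using M_nonneg lt by blast
  let ?F = "\<lambda>i j. M t k i * M t k j * (x t i - x t j)\<^sup>2" and ?s = "\<Sum>j\<in>A. M t k j * (x t k - x t j)\<^sup>2"
  have F0: "0 \<le> ?F i j" if "i \<in> A" "j \<in> A" for i j using nn k that by simp
  have kk: "1 \<le> M t k k" using M_ge P_diag lt k by blast
  have row: "?s \<le> (\<Sum>j\<in>A. ?F k j)"
  proof (rule sum_mono)
    fix j assume j: "j \<in> A"
    have "1 * (M t k j * (x t k - x t j)\<^sup>2) \<le> M t k k * (M t k j * (x t k - x t j)\<^sup>2)"
      using kk nn[OF k j] by (intro mult_right_mono) auto
    then show "M t k j * (x t k - x t j)\<^sup>2 \<le> ?F k j" by (simp add: mult_ac)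
  qed
  have "?s \<le> (\<Sum>i\<in>A - {k}. ?F i k)"
  proof -
    have "?s = (\<Sum>j\<in>A - {k}. M t k j * (x t k - x t j)\<^sup>2)"
      using fin k by (simp add: sum.remove)
    also have "\<dots> \<le> (\<Sum>i\<in>A - {k}. ?F i k)"
    proof (rule sum_mono)
      fix j assume j: "j \<in> A - {k}"
      have "1 * (M t k j * (x t k - x t j)\<^sup>2) \<le> M t k k * (M t k j * (x t k - x t j)\<^sup>2)"
        using kk nn[OF k, of j] j by (intro mult_right_mono) auto
      then show "M t k j * (x t k - x t j)\<^sup>2 \<le> ?F j k" by (simp add: mult_ac power2_commute)
    qed
    finally show ?thesis .
  qed
  also have "\<dots> \<le> (\<Sum>i\<in>A - {k}. \<Sum>j\<in>A. ?F i j)"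
    using fin F0 k by (intro sum_mono member_le_sum) auto
  finally have "2 * ?s \<le> (\<Sum>i\<in>A. \<Sum>j\<in>A. ?F i j)"
    using row sum.remove[OF fin k, of "\<lambda>i. \<Sum>j\<in>A. ?F i j"] by linarith
  then have "1 / (2 * q k) * (2 * ?s) \<le> 1 / (2 * q k) * (\<Sum>i\<in>A. \<Sum>j\<in>A. ?F i j)"
    using q_ge[OF lt[OF k]] by (intro mult_left_mono) auto
  then show "1 / q k * ?s \<le> 1 / (2 * q k) * (\<Sum>i\<in>A. \<Sum>j\<in>A. ?F i j)" by simp
qed

end

lemma wvar_const:
  assumes "\<And>i. i \<in> A \<Longrightarrow> q i = d" "d \<noteq> 0"
  shows "wvar q A f = d * wvar (\<lambda>_. 1) A f"
proof -
  have "wvar q A f = (\<Sum>i\<in>A. d * (f i)\<^sup>2) - (\<Sum>i\<in>A. d * f i)\<^sup>2 / (\<Sum>i\<in>A. d)"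
    unfolding wvar_def using assms(1) by simp
  also have "\<dots> = d * wvar (\<lambda>_. 1) A f"
    using assms(2) unfolding wvar_def
    by (simp add: sum_distrib_left[symmetric] power_mult_distrib right_diff_distrib power2_eq_square)
  finally show ?thesis .
qed

locale expander = reversible +
  fixes d :: nat and h :: real
  assumes exp: "exp_system n \<rho> d h P q M" and h_pos: "0 < h"
begin

lemma M01: "i < n \<Longrightarrow> j < n \<Longrightarrow> M t i j = (if (i, j) \<in> E t then 1 else 0)"
  using exp M_iff[of i j t] unfolding exp_system_def by (auto simp: edge_iff)

lemma q_d: "i < n \<Longrightarrow> q i = real d"
  using exp unfolding exp_system_def by blast

lemma cheeger: "C \<in> components n (E t) \<Longrightarrow> cheeger_ge (E t) C h"
  using exp unfolding exp_system_def by blast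

lemma comps_components:
  assumes "closed_at A t" "C \<in> comps A t"
  shows "C \<in> components n (E t)"
  using assms unfolding components_def closed_at_def by (auto elim!: quotientE intro!: quotientI)

lemma cut_card:
  assumes "S \<subseteq> {..<n}" "C \<subseteq> {..<n}"
  shows "real (card {(i, j) \<in> E t. i \<in> S \<and> j \<in> C - S}) = (\<Sum>i\<in>S. \<Sum>j\<in>C - S. M t i j)"
proof -
  have fin: "finite S" "finite C" using assms finite_subset by auto
  have "(\<Sum>i\<in>S. \<Sum>j\<in>C - S. M t i j) = (\<Sum>p\<in>S \<times> (C - S). if p \<in> E t then 1 else 0)"
    unfolding sum.cartesian_product using assms by (intro sum.cong) (auto simp: M01 subset_iff)
  also have "\<dots> = real (card (S \<times> (C - S) \<inter> E t))"
    using fin by (simp add: sum.inter_restrict[symmetric])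
  also have "S \<times> (C - S) \<inter> E t = {(i, j) \<in> E t. i \<in> S \<and> j \<in> C - S}" by auto
  finally show ?thesis by simp
qed

lemma comp_cheeger:
  assumes A: "closed_at A t" and C: "C \<in> comps A t"
  shows "h\<^sup>2 / real d * wvar (\<lambda>_. 1) C (x t) \<le> (\<Sum>i\<in>C. \<Sum>j\<in>C. M t i j * (x t i - x t j)\<^sup>2)"
proof (rule cheeger_inequality)
  have Cc: "closed_at C t" using comps_closed[OF C A] .
  have lt: "i \<in> C \<Longrightarrow> i < n" for i using closed_at_subset[OF Cc] .
  show "finite C" using closed_at_finite[OF Cc] .
  show ne: "C \<noteq> {}" using C by (auto elim!: quotientE)
  show "0 \<le> M t i j" if "i \<in> C" "j \<in> C" for i j using M_nonneg lt that by blast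
  show "M t i j = M t j i" if "i \<in> C" "j \<in> C" for i j using M_sym lt that by blast
  show "(\<Sum>j\<in>C. M t i j) \<le> real d" if "i \<in> C" for i
    using closed_M_sum[OF Cc that] q_d[OF lt[OF that]] by simp
  obtain i where "i \<in> C" using ne by blast
  then show "0 < real d" using q_ge[of i] q_d[of i] lt by fastforce
  show "0 < h" by (rule h_pos)
  fix S assume S: "S \<subseteq> C" "S \<noteq> {}" "2 * card S \<le> card C"
  have sub: "C \<subseteq> {..<n}" using lt by blast
  have "h * real (card S) \<le> real (card {(i, j) \<in> E t. i \<in> S \<and> j \<in> C - S})"
    using cheeger[OF comps_components[OF A C]] S unfolding cheeger_ge_def by blast
  also have "\<dots> = (\<Sum>i\<in>S. \<Sum>j\<in>C - S. M t i j)"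
    using cut_card[of S C t] S(1) sub by fastforce
  finally show "h * real (card S) \<le> (\<Sum>i\<in>S. \<Sum>j\<in>C - S. M t i j)" .
qed

text \<open>The components partition A, so their Dirichlet forms add up inside
  \<open>edge_drop\<close>. One factor d is the degree in Cheeger's inequality, the other is the
  weight q.\<close>

lemma comps_drop:
  assumes A: "closed_at A t"
  shows "h\<^sup>2 / (real d)\<^sup>2 * (\<Sum>C\<in>comps A t. wvar (\<lambda>_. 1) C (x t)) \<le> wvar q A (x t) - wvar q A (x (Suc t))"
proof -
  have lt: "i \<in> A \<Longrightarrow> i < n" for i using closed_at_subset[OF A] .
  have "h\<^sup>2 / (real d)\<^sup>2 * (\<Sum>C\<in>comps A t. wvar (\<lambda>_. 1) C (x t))
      = 1 / real d * (\<Sum>C\<in>comps A t. h\<^sup>2 / real d * wvar (\<lambda>_. 1) C (x t))"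
    by (simp add: sum_distrib_left power2_eq_square)
  also have "\<dots> \<le> 1 / real d * (\<Sum>C\<in>comps A t. \<Sum>i\<in>C. \<Sum>j\<in>C. M t i j * (x t i - x t j)\<^sup>2)"
    using comp_cheeger[OF A] by (intro mult_left_mono sum_mono) auto
  also have "\<dots> \<le> 1 / real d * (\<Sum>C\<in>comps A t. \<Sum>i\<in>C. \<Sum>j\<in>A. M t i j * (x t i - x t j)\<^sup>2)"
  proof (intro mult_left_mono sum_mono sum_mono2)
    fix C i j assume C: "C \<in> comps A t" "i \<in> C" "j \<in> A - C"
    then show "0 \<le> M t i j * (x t i - x t j)\<^sup>2"
      using M_nonneg lt comps_subset[OF C(1) A] by (intro mult_nonneg_nonneg) auto
  qed (use closed_at_finite[OF A] comps_subset[OF _ A] in auto)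
  also have "(\<Sum>C\<in>comps A t. \<Sum>i\<in>C. \<Sum>j\<in>A. M t i j * (x t i - x t j)\<^sup>2)
      = (\<Sum>i\<in>\<Union>(comps A t). \<Sum>j\<in>A. M t i j * (x t i - x t j)\<^sup>2)"
  proof (subst sum.Union_disjoint)
    show "\<forall>C\<in>comps A t. finite C" using comps_closed[OF _ A] closed_at_finite by blast
    show "\<forall>C\<in>comps A t. \<forall>C'\<in>comps A t. C \<noteq> C' \<longrightarrow> C \<inter> C' = {}" using comps_disjoint by blast
  qed simp
  also have "\<Union>(comps A t) = A" using comps_subset[OF _ A] comps_mem[of _ A t] by blast
  also have "1 / real d * (\<Sum>i\<in>A. \<Sum>j\<in>A. M t i j * (x t i - x t j)\<^sup>2)
      = (\<Sum>k\<in>A. 1 / q k * (\<Sum>j\<in>A. M t k j * (x t k - x t j)\<^sup>2))"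
    by (subst sum_distrib_left) (use q_d lt in \<open>auto intro!: sum.cong\<close>)
  also have "\<dots> \<le> wvar q A (x t) - wvar q A (x (Suc t))" by (rule edge_drop[OF A])
  finally show ?thesis .
qed

end

section \<open>Reversible and expander bounds\<close>

lemma qvar_eq_wvar:
  assumes "(\<Sum>i<n. q i) > 0"
  shows "qvar n q f = wvar q {..<n} f"
  unfolding qvar_def Let_def by (rule wvar_eq[OF assms, symmetric])

text \<open>With L = ln (1/\<epsilon>), the exponent s = m / (L + m) satisfies s * L \<le> m. So an
  initial potential polynomial in 1/\<epsilon> costs only a constant to the power m.\<close>

lemma powr_budget:
  assumes eps: "0 < \<epsilon>" and L: "1 \<le> ln (1 / \<epsilon>)" and m: "0 < m"
    and b: "0 \<le> B" "B \<le> 1 / \<epsilon> ^ k"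
  shows "B powr (real m / (ln (1 / \<epsilon>) + real m)) \<le> exp (real k) ^ m"
proof -
  define l where "l = ln (1 / \<epsilon>)"
  have e: "1 / \<epsilon> = exp l" using eps by (simp add: l_def)
  have "B powr (real m / (l + real m)) \<le> (exp (real k * l)) powr (real m / (l + real m))"
    using b e L m by (intro powr_mono2) (auto simp: exp_of_nat_mult power_one_over l_def[symmetric] simp flip: e)
  also have "\<dots> = exp (real k * (l * real m / (l + real m)))"
    by (simp add: powr_def)
  also have "\<dots> \<le> exp (real k * real m)"
  proof -
    have "l * real m / (l + real m) \<le> real m"
      using L m by (simp add: l_def[symmetric] field_simps)
    then have "real k * (l * real m / (l + real m)) \<le> real k * real m" by (intro mult_left_mono) auto
    then show ?thesis by (simp only: exp_le_cancel_iff)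
  qed
  also have "\<dots> = exp (real k) ^ m" by (simp add: exp_of_nat2_mult)
  finally show ?thesis by (simp add: l_def)
qed

context averaging begin

lemma n_components_eq: "n_components n (E t) = card (comps {..<n} t)"
  by (simp add: n_components_def components_def lessThan_atLeast0)

end

context reversible begin

lemma sum_q_pos: "0 < n \<Longrightarrow> (\<Sum>i<n. q i) > 0"
  using q_ge by (intro sum_pos) (auto intro: less_le_trans[of 0 1])

lemma wvar_budget:
  assumes "0 < n" "qvar n q x0 \<le> 1" and eps: "0 < \<epsilon>" "1 \<le> ln (1 / \<epsilon>)"
  shows "0 \<le> 2 * wvar q {..<n} (x 0) / \<epsilon>\<^sup>2" "2 * wvar q {..<n} (x 0) / \<epsilon>\<^sup>2 \<le> 1 / \<epsilon> ^ 3"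
proof -
  have w: "wvar q {..<n} (x 0) \<le> 1" using assms(2) qvar_eq_wvar[OF sum_q_pos[OF assms(1)]] by simp
  have "0 \<le> wvar q {..<n} (x 0)"
    using wvar_ge_pair[where q = q and f = "x 0" and i = 0 and j = 0 and B = "{..<n}"] q_ge assms(1) by simp
  then show "0 \<le> 2 * wvar q {..<n} (x 0) / \<epsilon>\<^sup>2" by simp
  have "exp 1 \<le> exp (ln (1 / \<epsilon>))" using eps(2) by (simp only: exp_le_cancel_iff)
  then have "2 \<le> 1 / \<epsilon>" using eps(1) exp_ge_add_one_self[of 1] by simp
  then have "2 * wvar q {..<n} (x 0) * (1 / \<epsilon>\<^sup>2) \<le> 1 / \<epsilon> * (1 / \<epsilon>\<^sup>2)"
    using w by (intro mult_right_mono) auto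
  then show "2 * wvar q {..<n} (x 0) / \<epsilon>\<^sup>2 \<le> 1 / \<epsilon> ^ 3"
    by (simp add: power2_eq_square power3_eq_cube)
qed

lemma cnt_le:
  assumes rho: "\<rho> \<le> 1" and comp: "\<And>t. n_components n (E t) \<le> m" and nm: "0 < n" "0 < m"
    and q: "qvar n q x0 \<le> 1" and eps: "0 < \<epsilon>" "1 \<le> ln (1 / \<epsilon>)"
  shows "real (cnt \<epsilon> {..<n} 0 b) \<le> (20 * exp 3 * ((real n)\<^sup>2 / \<rho>) * (1 + ln (1 / \<epsilon>) / real m)) ^ m"
proof -
  define l where "l = ln (1 / \<epsilon>)"
  define s where "s = real m / (l + real m)"
  have l1: "1 \<le> l" using eps by (simp only: l_def)
  have s: "0 < s" "s \<le> 1" using nm l1 by (auto simp: s_def)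
  have s1: "1 / s = 1 + l / real m" using nm l1 by (simp add: s_def field_simps)
  let ?r = "\<lambda>k::nat. \<rho> / (2 * (real k)\<^sup>2)"
  have "real (cnt \<epsilon> {..<n} 0 b)
      \<le> (2 * wvar q {..<n} (x 0) / \<epsilon>\<^sup>2) powr s * (2 / (s * ?r (card {..<n}))) ^ m"
  proof (rule cnt_bound[where ?m0.0 = m and r = ?r])
    show "0 < ?r k \<and> ?r k \<le> 1" if "0 < k" for k
    proof -
      have "1 \<le> (real k)\<^sup>2" using that by simp
      then have "\<rho> \<le> 2 * (real k)\<^sup>2" using rho by linarith
      then show ?thesis using rho_pos that by simp
    qed
    show "1 / ?r k + 1 / ?r l \<le> 1 / ?r (k + l)" for k l
      using rho_pos by (simp add: field_simps power2_eq_square)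
    show "wvar q A (x b) \<le> (1 - ?r (card A)) * wvar q A (x a)"
      if "A \<noteq> {}" "a < b" "\<And>t. t \<in> {a..<b} \<Longrightarrow> closed_at A t \<and> card (comps A t) \<le> m" "no_split A a b"
      for A a b using phase_contraction that by blast
    show "closed_at {..<n} t \<and> card (comps {..<n} t) \<le> m" for t
      using comp[of t] by (simp add: n_components_eq closed_at_UNIV)
  qed (use eps s nm in auto)
  also have "\<dots> \<le> exp 3 ^ m * (2 / (s * ?r (card {..<n}))) ^ m"
  proof (rule mult_right_mono)
    show "(2 * wvar q {..<n} (x 0) / \<epsilon>\<^sup>2) powr s \<le> exp 3 ^ m"
      using powr_budget[OF eps nm(2) wvar_budget[OF nm(1) q eps]] by (simp add: s_def l_def)
    show "0 \<le> (2 / (s * ?r (card {..<n}))) ^ m" using s rho_pos by (intro zero_le_power) simp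
  qed
  also have "\<dots> = (exp 3 * (2 / (s * ?r n))) ^ m" by (simp only: power_mult_distrib card_lessThan)
  also have "\<dots> \<le> (20 * exp 3 * ((real n)\<^sup>2 / \<rho>) * (1 + ln (1 / \<epsilon>) / real m)) ^ m"
  proof (rule power_mono)
    have "exp 3 * (2 / (s * ?r n)) = 4 * (exp 3 * ((real n)\<^sup>2 / \<rho>) * (1 / s))"
      using rho_pos nm s by (simp add: field_simps)
    \<comment> \<open>The factor is 4 here; it is raised to 20, the value in the general bound, so
      that \<open>power_absorb\<close> is instantiated once for all three classes.\<close>
    also have "\<dots> \<le> 20 * (exp 3 * ((real n)\<^sup>2 / \<rho>) * (1 / s))"
      using rho_pos s by (intro mult_right_mono) auto
    finally show "exp 3 * (2 / (s * ?r n)) \<le> 20 * exp 3 * ((real n)\<^sup>2 / \<rho>) * (1 + ln (1 / \<epsilon>) / real m)"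
      unfolding s1 l_def by (simp add: mult_ac)
    show "0 \<le> exp 3 * (2 / (s * ?r n))" using rho_pos s by simp
  qed
  finally show ?thesis .
qed

end

context expander begin

text \<open>A long edge joins two different vertices of one component, so a single vertex is an
  admissible set for the Cheeger constant, and its degree bounds h. For h > d there is thus nothing
  to count.\<close>

lemma long_at_h_le:
  assumes A: "closed_at A t" and l: "long_at \<epsilon> A t" and eps: "0 < \<epsilon>"
  shows "h \<le> real d"
proof -
  obtain i j where ij: "i \<in> A" "j \<in> A" "P t i j > 0" "\<epsilon> \<le> \<bar>x t i - x t j\<bar>"
    using l by (auto simp: long_at_def)
  have ne: "i \<noteq> j" using ij eps by auto
  have lt: "i < n" "j < n" using closed_at_subset[OF A] ij by auto
  define C where "C = (E t)\<^sup>* `` {i}"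
  have C: "C \<in> comps A t" unfolding C_def using ij(1) by (rule quotientI)
  have Cc: "closed_at C t" by (rule comps_closed[OF C A])
  have iC: "i \<in> C" "j \<in> C" unfolding C_def using ij lt by (auto simp: edge_iff)
  have fin: "finite C" using closed_at_finite[OF Cc] .
  have sub: "C \<subseteq> {..<n}" using closed_at_subset[OF Cc] by blast
  have "card {i, j} \<le> card C" using iC fin by (intro card_mono) auto
  then have "{i} \<subseteq> C \<and> {i} \<noteq> {} \<and> 2 * card {i} \<le> card C" using ne iC by simp
  then have "h * real (card {i}) \<le> real (card {(k, j) \<in> E t. k \<in> {i} \<and> j \<in> C - {i}})"
    by (rule cheeger[OF comps_components[OF A C], unfolded cheeger_ge_def, rule_format])
  also have "\<dots> = (\<Sum>k\<in>{i}. \<Sum>j\<in>C - {i}. M t k j)"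
    using lt sub by (intro cut_card) auto
  also have "\<dots> \<le> (\<Sum>j\<in>C. M t i j)"
    using fin M_nonneg lt sub by (simp) (intro sum_mono2, auto)
  also have "\<dots> = real d" using closed_M_sum[OF Cc iC(1)] q_d lt by simp
  finally show ?thesis by simp
qed

text \<open>Expansion is used in the first step of the phase only. A cut crossed then is attributed
  to a component that straddles it, and the gaps given to one component add up to at most its
  diameter; the other cuts, fewer than m, are crossed later in the phase. So Cauchy-Schwarz runs
  over at most 2 * m terms, and one factor card A of the reversible rate becomes m.\<close>

lemma expander_phase_contraction:
  assumes A: "A \<noteq> {}" "a < b" and cl: "\<And>t. t \<in> {a..<b} \<Longrightarrow> closed_at A t \<and> card (comps A t) \<le> m"
    and ns: "no_split A a b" and hd: "h \<le> real d"
  shows "wvar q A (x b) \<le> (1 - h\<^sup>2 / (4 * (real d)^3 * real m * real (card A))) * wvar q A (x a)"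
proof -
  have Aa: "closed_at A a" and Am: "card (comps A a) \<le> m" using A cl by auto
  have clA: "closed_at A t" if "t \<in> {a..<b}" for t using cl[OF that] by blast
  have fin: "finite A" using closed_at_finite[OF Aa] .
  then have pos: "card A > 0" using A(1) by (simp add: card_gt_0_iff)
  have m1: "1 \<le> m" using comps_nonempty[OF Aa A(1)] Am by simp
  have d0: "0 < real d" using hd h_pos by linarith
  obtain e where e: "senum e (x a) A" using senum_exists[OF fin] by blast
  define X where "X = (\<lambda>c. x a (e c))"
  define g where "g = (\<lambda>c. X (Suc c) - X c)"
  have Xmono: "X i \<le> X j" if "i \<le> j" "j < card A" for i j
    unfolding X_def using senum_mono[OF e] that by blast
  define K where "K = {c \<in> {..<card A - 1}. \<not> closed_at (e ` {..c}) a}"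
  define U where "U = {..<card A - 1} - K"
  have fK: "finite K" "finite U" by (auto simp: K_def U_def)
  have Ksub: "K \<subseteq> {..<card A - 1}" by (auto simp: K_def)
  have Usub: "U \<subseteq> {..<card A - 1}" by (auto simp: U_def)
  have Ucl: "closed_at (e ` {..c}) a" if "c \<in> U" for c using that by (auto simp: U_def K_def)
  have cU: "card U \<le> m" using uncrossed_cuts[OF e Aa A(1) Usub Ucl] Am by simp
  let ?CC = "comps A a"
  have fC: "finite ?CC" using finite_comps[OF Aa] .
  have "\<exists>C. C \<in> ?CC \<and> C \<inter> e ` {..c} \<noteq> {} \<and> C - e ` {..c} \<noteq> {}" if c: "c \<in> K" for c
  proof -
    have "c < card A" using c by (auto simp: K_def)
    then have sub: "e ` {..c} \<subseteq> A" by (rule initial_subset[OF e])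
    obtain i j where ij: "i \<in> e ` {..c}" "j \<in> A - e ` {..c}" "P a i j > 0"
      using crossing_edge[OF Aa sub] c by (auto simp: K_def)
    obtain C where C: "C \<in> ?CC" "i \<in> C" using comps_mem[of i A a] ij sub by blast
    have "j < n" using ij closed_at_subset[OF Aa] by blast
    then have "j \<in> C" using comps_closed[OF C(1) Aa] C(2) ij(3) unfolding closed_at_def by blast
    then show ?thesis using C ij by blast
  qed
  then obtain f where f: "\<And>c. c \<in> K \<Longrightarrow> f c \<in> ?CC \<and> f c \<inter> e ` {..c} \<noteq> {} \<and> f c - e ` {..c} \<noteq> {}"
    by metis
  define G where "G = (\<lambda>C. \<Sum>c\<in>{c \<in> K. f c = C}. g c)"
  have G: "(G C)\<^sup>2 / 2 \<le> wvar (\<lambda>_. 1) C (x a)" if C: "C \<in> ?CC" for C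
  proof -
    define I where "I = {l. l < card A \<and> e l \<in> C}"
    have Csub: "C \<subseteq> A" using comps_subset[OF C Aa] .
    have fI: "finite I" by (simp add: I_def)
    obtain i0 where "i0 \<in> C" using C by (auto elim!: quotientE)
    then have I0: "I \<noteq> {}" using senum_obtain[OF e, of i0] Csub unfolding I_def by blast
    have mm: "Min I \<in> I" "Max I \<in> I" "Min I \<le> Max I" using fI I0 by auto
    have "G C \<le> X (Max I) - X (Min I)"
      unfolding G_def g_def
    proof (rule sum_gaps[where N = "card A"])
      fix c assume "c \<in> {c \<in> K. f c = C}"
      then have c: "c \<in> K" "f c = C" by auto
      have cN: "Suc c < card A" using c(1) by (auto simp: K_def)
      obtain i where i: "i \<in> C" "i \<in> e ` {..c}" using f[OF c(1)] c(2) by blast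
      then obtain l where l: "l \<le> c" "i = e l" by auto
      then have "l \<in> I" using i cN by (auto simp: I_def)
      then have "Min I \<le> c" using Min_le[OF fI] l(1) by fastforce
      then show "X (Min I) \<le> X c" using Xmono cN by simp
      obtain j where j: "j \<in> C" "j \<notin> e ` {..c}" using f[OF c(1)] c(2) by blast
      then obtain l' where l': "l' < card A" "j = e l'" using senum_obtain[OF e] Csub by blast
      then have "Suc c \<le> l'" using j(2) by (auto simp: not_less_eq_eq[symmetric])
      moreover have "l' \<in> I" using l' j by (auto simp: I_def)
      ultimately have "Suc c \<le> Max I" using Max_ge[OF fI] by fastforce
      then show "X (Suc c) \<le> X (Max I)" using Xmono mm by (simp add: I_def)
    qed (use Xmono mm in \<open>auto simp: K_def I_def\<close>)
    moreover have "0 \<le> G C" unfolding G_def g_def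
      using Xmono by (intro sum_nonneg) (auto simp: K_def)
    ultimately have "(G C)\<^sup>2 \<le> (X (Max I) - X (Min I))\<^sup>2" by (intro power_mono)
    moreover have "(x a (e (Max I)) - x a (e (Min I)))\<^sup>2 / 2 \<le> wvar (\<lambda>_. 1) C (x a)"
      using mm Csub finite_subset[OF Csub fin] by (intro wvar_ge_pair) (auto simp: I_def)
    ultimately show ?thesis by (simp add: X_def)
  qed
  have g0: "0 \<le> g c" if "c < card A - 1" for c unfolding g_def using Xmono[of c "Suc c"] that by simp
  let ?SG = "\<Sum>C\<in>?CC. (G C)\<^sup>2" and ?SU = "\<Sum>c\<in>U. (g c)\<^sup>2" and ?R = "x a (e (card A - 1)) - x a (e 0)"
  have nn: "0 \<le> ?SG" "0 \<le> ?SU" by (auto intro: sum_nonneg)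
  have "?R = (\<Sum>c\<in>K. g c) + (\<Sum>c\<in>U. g c)"
  proof -
    have "?R = (\<Sum>c<card A - 1. g c)" unfolding g_def X_def by (rule range_eq_sum_gaps[OF pos])
    also have "\<dots> = (\<Sum>c\<in>K. g c) + (\<Sum>c\<in>U. g c)"
      using sum.subset_diff[OF Ksub, of g] unfolding U_def by simp
    finally show ?thesis .
  qed
  also have "(\<Sum>c\<in>K. g c) = (\<Sum>C\<in>?CC. G C)"
  proof -
    have "f ` K \<subseteq> ?CC" using f by blast
    then show ?thesis unfolding G_def by (rule sum.group[OF fK(1) fC, symmetric])
  qed
  finally have R: "?R = (\<Sum>C\<in>?CC. G C) + (\<Sum>c\<in>U. g c)" .
  have R2: "?R\<^sup>2 \<le> 2 * real m * (?SG + ?SU)"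
  proof -
    have 1: "(\<Sum>C\<in>?CC. G C)\<^sup>2 \<le> ?SG * real m"
      using sum_squared_le_sum_of_squares[of G ?CC] mult_left_mono[of "real (card ?CC)" "real m" ?SG] Am nn
      by simp
    have 2: "(\<Sum>c\<in>U. g c)\<^sup>2 \<le> ?SU * real m"
      using sum_squared_le_sum_of_squares[of g U] mult_left_mono[of "real (card U)" "real m" ?SU] cU nn
      by simp
    have "?R\<^sup>2 \<le> 2 * (\<Sum>C\<in>?CC. G C)\<^sup>2 + 2 * (\<Sum>c\<in>U. g c)\<^sup>2"
      unfolding R using sum_squares_bound[of "\<Sum>C\<in>?CC. G C" "\<Sum>c\<in>U. g c"] by (simp add: power2_sum)
    then show ?thesis using 1 2 by (simp add: algebra_simps)
  qed
  have drop1: "h\<^sup>2 / (real d)\<^sup>2 * (?SG / 2) \<le> wvar q A (x a) - wvar q A (x (Suc a))"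
  proof -
    have "h\<^sup>2 / (real d)\<^sup>2 * (?SG / 2) \<le> h\<^sup>2 / (real d)\<^sup>2 * (\<Sum>C\<in>?CC. wvar (\<lambda>_. 1) C (x a))"
      using G unfolding sum_divide_distrib by (intro mult_left_mono sum_mono) auto
    then show ?thesis using comps_drop[OF Aa] by linarith
  qed
  \<comment> \<open>The cuts of U are uncrossed at time a, so their gaps are still empty at Suc a
    and can be charged from then on.\<close>
  have drop2: "?SU / 2 \<le> wvar q A (x (Suc a)) - wvar q A (x b)"
    unfolding g_def X_def
  proof (rule cuts_drop_window[OF e])
    show "\<exists>t\<in>{Suc a..<b}. \<not> closed_at (e ` {..c}) t" if c: "c \<in> U" for c
    proof -
      have "Suc c < card A" using c by (auto simp: U_def)
      then obtain t where t: "t \<in> {a..<b}" "\<not> closed_at (e ` {..c}) t"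
        using ns initial_subset[OF e, of c] initial_proper[OF e, of c] unfolding no_split_def by (meson Suc_lessD)
      then have "t \<noteq> a" using Ucl[OF c] by auto
      then show ?thesis using t by auto
    qed
    show "closed_at (e ` {..c}) t" if "c \<in> U" "t \<in> {a..<Suc a}" for c t
      using that Ucl[of c] by (auto simp: less_Suc_eq)
  qed (use A Usub clA in auto)
  \<comment> \<open>Since h \<le> d, the drop of the later steps may be scaled down to the factor of
    the first one.\<close>
  have k1: "h\<^sup>2 / (real d)\<^sup>2 \<le> 1" using hd h_pos by (simp add: divide_le_eq power_mono)
  have "h\<^sup>2 / (real d)\<^sup>2 * (?SU / 2) \<le> 1 * (?SU / 2)" using k1 nn by (intro mult_right_mono) auto
  then have drop: "h\<^sup>2 / (real d)\<^sup>2 * ((?SG + ?SU) / 2) \<le> wvar q A (x a) - wvar q A (x b)"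
    using drop1 drop2 by (simp add: algebra_simps add_divide_distrib)
  have "wvar q A (x a) \<le> real d * real (card A) * ?R\<^sup>2"
    using wvar_le_range[OF e Aa A(1), of "real d"] q_d closed_at_subset[OF Aa] by simp
  also have "\<dots> \<le> real d * real (card A) * (2 * real m * (?SG + ?SU))"
    using R2 by (intro mult_left_mono) auto
  finally have V: "wvar q A (x a) \<le> real d * real (card A) * (2 * real m * (?SG + ?SU))" .
  let ?r = "h\<^sup>2 / (4 * (real d)^3 * real m * real (card A))"
  have "?r * wvar q A (x a) \<le> ?r * (real d * real (card A) * (2 * real m * (?SG + ?SU)))"
    using V by (intro mult_left_mono) auto
  also have "\<dots> = h\<^sup>2 / (real d)\<^sup>2 * ((?SG + ?SU) / 2)"
    using d0 m1 pos by (simp add: field_simps power2_eq_square power3_eq_cube)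
  finally have "?r * wvar q A (x a) \<le> wvar q A (x a) - wvar q A (x b)" using drop by linarith
  then show ?thesis by (simp only: left_diff_distrib mult_1)
qed

lemma cnt_le_expander:
  assumes hd: "h \<le> real d" and comp: "\<And>t. n_components n (E t) \<le> m" and nm: "0 < n" "0 < m"
    and q: "qvar n q x0 \<le> 1" and eps: "0 < \<epsilon>" "1 \<le> ln (1 / \<epsilon>)"
  shows "real (cnt \<epsilon> {..<n} 0 b)
    \<le> (20 * exp 3 * ((real d)^3 * real m * real n / h\<^sup>2) * (1 + ln (1 / \<epsilon>) / real m)) ^ m"
proof -
  define l where "l = ln (1 / \<epsilon>)"
  define s where "s = real m / (l + real m)"
  have l1: "1 \<le> l" using eps by (simp only: l_def)
  have s: "0 < s" "s \<le> 1" using nm l1 by (auto simp: s_def)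
  have s1: "1 / s = 1 + l / real m" using nm l1 by (simp add: s_def field_simps)
  have d0: "1 \<le> real d" using hd h_pos by (cases d) auto
  let ?r = "\<lambda>k::nat. h\<^sup>2 / (4 * (real d)^3 * real m * real k)"
  have "real (cnt \<epsilon> {..<n} 0 b)
      \<le> (2 * wvar q {..<n} (x 0) / \<epsilon>\<^sup>2) powr s * (2 / (s * ?r (card {..<n}))) ^ m"
  proof (rule cnt_bound[where ?m0.0 = m and r = ?r])
    show "0 < ?r k \<and> ?r k \<le> 1" if "0 < k" for k
    proof
      show "0 < ?r k" using h_pos d0 nm that by simp
      have "h\<^sup>2 \<le> (real d)\<^sup>2" using hd h_pos by (simp add: power_mono)
      also have "\<dots> \<le> (real d)^3" using d0 by (intro power_increasing) auto
      also have "\<dots> \<le> 4 * (real d)^3 * real m * real k"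
      proof -
        have "1 \<le> 4 * real m * real k" using nm that
          by (metis (no_types) Suc_leI mult_pos_pos of_nat_1 of_nat_le_iff of_nat_mult of_nat_numeral One_nat_def zero_less_numeral)
        then have "(real d)^3 * 1 \<le> (real d)^3 * (4 * real m * real k)" by (intro mult_left_mono) auto
        then show ?thesis by (simp add: mult_ac)
      qed
      finally show "?r k \<le> 1" using d0 nm that by (simp add: divide_le_eq)
    qed
    show "1 / ?r k + 1 / ?r l \<le> 1 / ?r (k + l)" for k l
      by (simp add: field_simps flip: add_divide_distrib)
    show "wvar q A (x b) \<le> (1 - ?r (card A)) * wvar q A (x a)"
      if "A \<noteq> {}" "a < b" "\<And>t. t \<in> {a..<b} \<Longrightarrow> closed_at A t \<and> card (comps A t) \<le> m" "no_split A a b"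
      for A a b using expander_phase_contraction[OF that hd] .
    show "closed_at {..<n} t \<and> card (comps {..<n} t) \<le> m" for t
      using comp[of t] by (simp add: n_components_eq closed_at_UNIV)
  qed (use eps s nm in auto)
  also have "\<dots> \<le> exp 3 ^ m * (2 / (s * ?r (card {..<n}))) ^ m"
  proof (rule mult_right_mono)
    show "(2 * wvar q {..<n} (x 0) / \<epsilon>\<^sup>2) powr s \<le> exp 3 ^ m"
      using powr_budget[OF eps nm(2) wvar_budget[OF nm(1) q eps]] by (simp add: s_def l_def)
    show "0 \<le> (2 / (s * ?r (card {..<n}))) ^ m" using s by (intro zero_le_power) simp
  qed
  also have "\<dots> = (exp 3 * (2 / (s * ?r n))) ^ m" by (simp only: power_mult_distrib card_lessThan)
  also have "\<dots> \<le> (20 * exp 3 * ((real d)^3 * real m * real n / h\<^sup>2) * (1 + ln (1 / \<epsilon>) / real m)) ^ m"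
  proof (rule power_mono)
    have "exp 3 * (2 / (s * ?r n)) = 8 * (exp 3 * ((real d)^3 * real m * real n / h\<^sup>2) * (1 / s))"
      using h_pos nm s d0 by (simp add: field_simps)
    also have "\<dots> \<le> 20 * (exp 3 * ((real d)^3 * real m * real n / h\<^sup>2) * (1 / s))"
      using s by (intro mult_right_mono) auto
    finally show "exp 3 * (2 / (s * ?r n))
      \<le> 20 * exp 3 * ((real d)^3 * real m * real n / h\<^sup>2) * (1 + ln (1 / \<epsilon>) / real m)"
      unfolding s1 l_def by (simp add: mult_ac)
    show "0 \<le> exp 3 * (2 / (s * ?r n))" using s by simp
  qed
  finally show ?thesis .
qed

text \<open>In a connected graph Cheeger's inequality applies to the whole vertex set, so every
  single step contracts the variance by 1 - h^2/d^3, without the detour through the range that costs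
  a factor n. With r = h^2/d^3, a long edge at time t forces t \<le> 3 * L / r.\<close>

lemma cnt_le_connected:
  assumes hd: "h \<le> real d" and comp: "\<And>t. n_components n (E t) \<le> 1" and n0: "0 < n"
    and q: "qvar n q x0 \<le> 1" and eps: "0 < \<epsilon>" "1 \<le> ln (1 / \<epsilon>)"
  shows "real (cnt \<epsilon> {..<n} 0 b) \<le> 4 * (real d)^3 / h\<^sup>2 * ln (1 / \<epsilon>)"
proof -
  define r where "r = h\<^sup>2 / (real d)^3"
  define V where "V = (\<lambda>t. wvar q {..<n} (x t))"
  have d0: "1 \<le> real d" using hd h_pos by (cases d) auto
  have r0: "0 < r" unfolding r_def using h_pos d0 by simp
  have "h\<^sup>2 \<le> (real d)\<^sup>2" using hd h_pos by (simp add: power_mono)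
  also have "\<dots> \<le> (real d)^3" using d0 by (intro power_increasing) auto
  finally have r1: "r \<le> 1" unfolding r_def using d0 by (simp add: divide_le_eq)
  have step: "V (Suc t) \<le> (1 - r) * V t" for t
  proof -
    have cl: "closed_at {..<n} t" by (rule closed_at_UNIV)
    have "card (comps {..<n} t) = 1"
      using comp[of t] comps_nonempty[OF cl] n0 unfolding n_components_eq by fastforce
    then obtain C where C: "comps {..<n} t = {C}" by (auto simp: card_1_singleton_iff)
    have "\<Union>(comps {..<n} t) = {..<n}" using comps_subset[OF _ cl] comps_mem[of _ "{..<n}" t] by blast
    then have "comps {..<n} t = {{..<n}}" using C by simp
    then have "h\<^sup>2 / (real d)\<^sup>2 * wvar (\<lambda>_. 1) {..<n} (x t) \<le> V t - V (Suc t)"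
      using comps_drop[OF cl] unfolding V_def by simp
    moreover have "V t = real d * wvar (\<lambda>_. 1) {..<n} (x t)"
      unfolding V_def using q_d d0 by (intro wvar_const) auto
    then have "r * V t = h\<^sup>2 / (real d)\<^sup>2 * wvar (\<lambda>_. 1) {..<n} (x t)"
      unfolding r_def using d0 by (simp add: field_simps power2_eq_square power3_eq_cube)
    ultimately show ?thesis by (simp add: algebra_simps)
  qed
  have V0: "0 \<le> V t" for t
    unfolding V_def using wvar_ge_pair[where q = q and f = "x t" and i = 0 and j = 0 and B = "{..<n}"] q_ge n0 by simp
  have Vt: "V t \<le> exp (- r * real t)" for t
  proof (induction t)
    case 0
    then show ?case using q qvar_eq_wvar[OF sum_q_pos[OF n0]] by (simp add: V_def)
  next
    case (Suc t)
    have "V (Suc t) \<le> (1 - r) * V t" by (rule step)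
    also have "\<dots> \<le> exp (- r) * exp (- r * real t)"
      using Suc V0 r1 exp_ge_add_one_self[of "- r"] by (intro mult_mono) auto
    finally show ?case by (simp add: algebra_simps flip: exp_add)
  qed
  define l where "l = ln (1 / \<epsilon>)"
  have e: "\<epsilon> = exp (- l)" using eps(1) by (simp add: l_def ln_div exp_minus)
  have "real t * r \<le> 3 * l" if lg: "long_at \<epsilon> {..<n} t" for t
  proof -
    obtain i j where ij: "i < n" "j < n" "\<epsilon> \<le> \<bar>x t i - x t j\<bar>" using lg by (auto simp: long_at_def)
    have "\<epsilon>\<^sup>2 \<le> (x t i - x t j)\<^sup>2" using ij(3) eps by (metis abs_le_square_iff abs_of_pos)
    also have "\<dots> \<le> 2 * V t"
      unfolding V_def using wvar_ge_pair[where q = q and f = "x t" and i = i and j = j and B = "{..<n}"] q_ge ij by simp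
    also have "\<dots> \<le> exp l * exp (- r * real t)"
    proof (intro mult_mono Vt V0)
      have "1 \<le> l" using eps(2) by (simp only: l_def)
      then show "2 \<le> exp l" using exp_ge_add_one_self[of l] by linarith
    qed auto
    finally have "exp (- l) * exp (- l) \<le> exp l * exp (- r * real t)" by (simp add: e power2_eq_square)
    then have "- l + - l \<le> l + - r * real t" by (simp only: flip: exp_add) simp
    then show ?thesis by (simp add: algebra_simps)
  qed
  then have "real t \<le> 3 * l / r" if "long_at \<epsilon> {..<n} t" for t
    using that r0 by (simp add: pos_le_divide_eq)
  then have "{t \<in> {0..<b}. long_at \<epsilon> {..<n} t} \<subseteq> {..nat \<lfloor>3 * l / r\<rfloor>}"
    by (auto simp: le_nat_floor)
  then have "cnt \<epsilon> {..<n} 0 b \<le> card {..nat \<lfloor>3 * l / r\<rfloor>}" unfolding cnt_def by (intro card_mono) auto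
  then have "real (cnt \<epsilon> {..<n} 0 b) \<le> real (nat \<lfloor>3 * l / r\<rfloor>) + 1" by simp
  also have "\<dots> \<le> 3 * l / r + l / r"
  proof (rule add_mono)
    have l1: "1 \<le> l" using eps(2) by (simp add: l_def)
    show "real (nat \<lfloor>3 * l / r\<rfloor>) \<le> 3 * l / r"
      using l1 r0 by (intro of_nat_floor) simp
    show "1 \<le> l / r" using l1 r0 r1 by (simp add: pos_le_divide_eq)
  qed
  also have "\<dots> = 4 * (real d)^3 / h\<^sup>2 * ln (1 / \<epsilon>)" by (simp add: r_def l_def)
  finally show ?thesis .
qed

end

section \<open>A rank potential for general systems\<close>

lemma senum_range: "senum e f A \<Longrightarrow> e ` {..<card A} = A"
  unfolding senum_def bij_betw_def by blast

text \<open>Counting: if the value at rank i were below c, the ranks 0 to i would all avoid S, which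
  leaves too few places for S.\<close>

lemma senum_ge:
  assumes e: "senum e f A" and i: "i < card A" and S: "S \<subseteq> A" "card A \<le> card S + i"
    and c: "\<And>v. v \<in> S \<Longrightarrow> c \<le> f v"
  shows "c \<le> f (e i)"
proof (rule ccontr)
  assume less: "\<not> c \<le> f (e i)"
  have fin: "finite A" using i card.infinite by fastforce
  have "S \<inter> e ` {..i} = {}"
  proof -
    have "e l \<notin> S" if "l \<le> i" for l
      using senum_mono[OF e that i] less c[of "e l"] by linarith
    then show ?thesis by blast
  qed
  moreover have "e ` {..i} \<subseteq> A" using senum_mem[OF e] i by auto
  ultimately have "card S + card (e ` {..i}) \<le> card A"
    using S(1) fin card_mono[OF fin, of "S \<union> e ` {..i}"] card_Un_disjoint[of S "e ` {..i}"] finite_subset[OF S(1) fin]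
    by simp
  moreover have "card (e ` {..i}) = Suc i"
    using senum_card_image[OF e, of "{..i}"] i by (simp add: subset_iff)
  ultimately show False using S(2) by simp
qed

lemma senum_unique:
  assumes "senum e f A" "senum e' f A" "i < card A"
  shows "f (e i) = f (e' i)"
proof -
  have "f (e i) \<le> f (e' i)" if e: "senum e f A" and e': "senum e' f A" for e e'
  proof (rule senum_ge[OF e' assms(3)])
    show "e ` {i..<card A} \<subseteq> A" using senum_mem[OF e] by auto
    have "card (e ` {i..<card A}) = card A - i"
      using senum_card_image[OF e, of "{i..<card A}"] by (simp add: subset_iff)
    then show "card A \<le> card (e ` {i..<card A}) + i" using assms(3) by simp
    show "f (e i) \<le> f v" if "v \<in> e ` {i..<card A}" for v using that senum_mono[OF e] by auto
  qed
  then show ?thesis using assms by (intro antisym) auto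
qed

lemma senum_uminus:
  assumes "senum e f A"
  shows "senum (\<lambda>i. e (card A - 1 - i)) (\<lambda>v. - f v) A"
proof -
  have "bij_betw (\<lambda>i. card A - 1 - i) {..<card A} {..<card A}"
    by (rule bij_betwI[of _ _ _ "\<lambda>i. card A - 1 - i"]) auto
  then have "bij_betw (e \<circ> (\<lambda>i. card A - 1 - i)) {..<card A} A"
    using assms unfolding senum_def by (intro bij_betw_trans) auto
  then show ?thesis using senum_mono[OF assms] unfolding senum_def comp_def by auto
qed

text \<open>Whatever is ranked below a member of B lies in B, because the separation is strict and
  no tie can interleave the two sides.\<close>

lemma senum_initial:
  assumes e: "senum e f A" and B: "B \<subseteq> A" "finite A" "B \<noteq> {}"
    and sep: "\<And>i j. i \<in> B \<Longrightarrow> j \<in> A - B \<Longrightarrow> f i < f j"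
  shows "e ` {..card B - 1} = B"
proof -
  have fB: "finite B" using B finite_subset by blast
  have cB: "0 < card B" "card B \<le> card A" using B fB by (auto simp: card_gt_0_iff card_mono)
  have "B \<subseteq> e ` {..card B - 1}"
  proof
    fix v assume v: "v \<in> B"
    then obtain l where l: "l < card A" "v = e l" using senum_obtain[OF e] B(1) by blast
    have "e ` {..l} \<subseteq> B"
    proof
      fix w assume "w \<in> e ` {..l}"
      then obtain l' where l': "l' \<le> l" "w = e l'" by auto
      then have "f w \<le> f v" "w \<in> A" using senum_mono[OF e] senum_mem[OF e] l by auto
      then show "w \<in> B" using sep[OF v, of w] by force
    qed
    then have "card (e ` {..l}) \<le> card B" using fB by (rule card_mono[rotated])
    moreover have "card (e ` {..l}) = Suc l"
      using senum_card_image[OF e, of "{..l}"] l(1) by (simp add: subset_iff)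
    ultimately show "v \<in> e ` {..card B - 1}" using l by auto
  qed
  moreover have "card (e ` {..card B - 1}) = card B"
  proof -
    have "{..card B - 1} \<subseteq> {..<card A}" using cB by auto
    then show ?thesis using senum_card_image[OF e] cB by simp
  qed
  ultimately show ?thesis using card_subset_eq[of "e ` {..card B - 1}" B] by auto
qed

text \<open>The smallest opinion carries the largest weight (for \<theta> > 1), so raising low
  opinions outweighs lowering high ones. The choice of the enumeration does not affect the
  value.\<close>

definition rank_sum :: "real \<Rightarrow> (nat \<Rightarrow> real) \<Rightarrow> nat set \<Rightarrow> real" where
  "rank_sum \<theta> f A = (\<Sum>i<card A. \<theta> ^ (card A - 1 - i) * f ((SOME e. senum e f A) i))"

lemma rank_sum_eq:
  assumes "senum e f A"
  shows "rank_sum \<theta> f A = (\<Sum>i<card A. \<theta> ^ (card A - 1 - i) * f (e i))"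
proof -
  have "senum (SOME e. senum e f A) f A" by (rule someI[where P = "\<lambda>e. senum e f A", OF assms])
  then show ?thesis unfolding rank_sum_def using senum_unique[OF _ assms] by (intro sum.cong) auto
qed

text \<open>The potential of the overview, with ranks from 0. It combines the rank sums of f and of
  - f, so that gaps are weighed from both ends. The coefficients in \<open>Psi_eq\<close> sum to
  zero, which makes it translation invariant.\<close>

definition Psi :: "real \<Rightarrow> (nat \<Rightarrow> real) \<Rightarrow> nat set \<Rightarrow> real" where
  "Psi \<theta> f A = - rank_sum \<theta> f A - rank_sum \<theta> (\<lambda>v. - f v) A"

lemma Psi_eq:
  assumes e: "senum e f A"
  shows "Psi \<theta> f A = (\<Sum>i<card A. (\<theta> ^ i - \<theta> ^ (card A - 1 - i)) * f (e i))"
proof -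
  have "rank_sum \<theta> (\<lambda>v. - f v) A = (\<Sum>i<card A. \<theta> ^ (card A - 1 - i) * - f (e (card A - 1 - i)))"
    using rank_sum_eq[OF senum_uminus[OF e]] by simp
  also have "\<dots> = (\<Sum>i<card A. \<theta> ^ i * - f (e i))"
    by (rule sum.reindex_bij_witness[of _ "\<lambda>i. card A - 1 - i" "\<lambda>i. card A - 1 - i"]) auto
  finally show ?thesis
    unfolding Psi_def rank_sum_eq[OF e]
    by (simp add: sum_negf left_diff_distrib sum_subtractf)
qed

lemma geometric_le:
  fixes \<theta> :: real
  assumes "2 \<le> \<theta>"
  shows "(\<Sum>i<N. \<theta> ^ i) \<le> 2 * \<theta> ^ (N - 1)"
proof (induction N)
  case (Suc N)
  show ?case
  proof (cases N)
    case (Suc k)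
    have "2 * \<theta> ^ k \<le> \<theta> * \<theta> ^ k" using assms by (intro mult_right_mono) auto
    then show ?thesis using Suc.IH Suc by simp
  qed simp
qed simp

text \<open>The coefficients sum to zero, so the smallest opinion can be subtracted throughout; then
  the negative powers may be dropped.\<close>

lemma Psi_upper:
  assumes e: "senum e f A" and N: "0 < card A" and th: "2 \<le> \<theta>"
  shows "Psi \<theta> f A \<le> 2 * \<theta> ^ (card A - 1) * (f (e (card A - 1)) - f (e 0))"
proof -
  let ?N = "card A" and ?D = "f (e (card A - 1)) - f (e 0)"
  have refl: "(\<Sum>i<?N. \<theta> ^ (?N - 1 - i)) = (\<Sum>i<?N. \<theta> ^ i)"
    by (rule sum.reindex_bij_witness[of _ "\<lambda>i. ?N - 1 - i" "\<lambda>i. ?N - 1 - i"]) auto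
  have zero: "(\<Sum>i<?N. (\<theta> ^ i - \<theta> ^ (?N - 1 - i)) * f (e 0)) = 0"
    using refl by (simp add: sum_subtractf flip: sum_distrib_right)
  have "Psi \<theta> f A = (\<Sum>i<?N. (\<theta> ^ i - \<theta> ^ (?N - 1 - i)) * (f (e i) - f (e 0)))"
    unfolding Psi_eq[OF e] right_diff_distrib sum_subtractf zero by simp
  also have "\<dots> \<le> (\<Sum>i<?N. \<theta> ^ i * ?D)"
  proof (rule sum_mono)
    fix i assume "i \<in> {..<?N}"
    then have "0 \<le> f (e i) - f (e 0)" "f (e i) - f (e 0) \<le> ?D"
      using senum_mono[OF e] N by auto
    then show "(\<theta> ^ i - \<theta> ^ (?N - 1 - i)) * (f (e i) - f (e 0)) \<le> \<theta> ^ i * ?D"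
      using th by (intro mult_mono) auto
  qed
  also have "\<dots> \<le> 2 * \<theta> ^ (?N - 1) * ?D"
    unfolding sum_distrib_right[symmetric]
    using geometric_le[OF th, of ?N] senum_mono[OF e, of 0 "?N - 1"] N by (intro mult_right_mono) auto
  finally show ?thesis .
qed

text \<open>The coefficients are antisymmetric under reversal of the ranks. Pairing each rank with
  its mirror image makes all terms nonnegative, and the outermost pair alone gives the bound, as
  \<theta> \<ge> 2.\<close>

lemma Psi_lower:
  assumes e: "senum e f A" and N: "0 < card A" and th: "2 \<le> \<theta>"
  shows "\<theta> ^ (card A - 1) * (f (e (card A - 1)) - f (e 0)) \<le> 2 * Psi \<theta> f A"
proof -
  let ?N = "card A" and ?D = "f (e (card A - 1)) - f (e 0)"
  let ?c = "\<lambda>i. \<theta> ^ i - \<theta> ^ (card A - 1 - i)"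
  have r: "(\<Sum>i<?N. ?c i * f (e (?N - 1 - i))) = (\<Sum>i<?N. ?c (?N - 1 - i) * f (e i))"
    by (rule sum.reindex_bij_witness[of _ "\<lambda>i. ?N - 1 - i" "\<lambda>i. ?N - 1 - i"]) auto
  also have "\<dots> = (\<Sum>i<?N. - (?c i * f (e i)))"
    by (intro sum.cong) (auto simp: algebra_simps)
  also have "\<dots> = - Psi \<theta> f A" unfolding Psi_eq[OF e] by (simp add: sum_negf)
  finally have "2 * Psi \<theta> f A = (\<Sum>i<?N. ?c i * (f (e i) - f (e (?N - 1 - i))))"
    unfolding right_diff_distrib sum_subtractf using Psi_eq[OF e, of \<theta>] by simp
  moreover have t0: "0 \<le> ?c i * (f (e i) - f (e (?N - 1 - i)))" if "i < ?N" for i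
  proof (cases "i \<le> ?N - 1 - i")
    case True
    then have "?c i \<le> 0" "f (e i) - f (e (?N - 1 - i)) \<le> 0"
      using th senum_mono[OF e, of i "?N - 1 - i"] N by (auto intro: power_increasing)
    then show ?thesis by (rule mult_nonpos_nonpos)
  next
    case False
    then have "0 \<le> ?c i" "0 \<le> f (e i) - f (e (?N - 1 - i))"
      using th senum_mono[OF e, of "?N - 1 - i" i] that by (auto intro: power_increasing)
    then show ?thesis by simp
  qed
  ultimately have sum: "2 * Psi \<theta> f A = (\<Sum>i<?N. ?c i * (f (e i) - f (e (?N - 1 - i))))"
    and t0: "\<And>i. i < ?N \<Longrightarrow> 0 \<le> ?c i * (f (e i) - f (e (?N - 1 - i)))" by auto
  have D0: "0 \<le> ?D" using senum_mono[OF e, of 0 "?N - 1"] N by simp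
  show ?thesis
  proof (cases "?N = 1")
    case True
    then show ?thesis using sum by simp
  next
    case False
    then have N2: "2 \<le> ?N" using N by simp
    have "(\<Sum>i\<in>{0, ?N - 1}. ?c i * (f (e i) - f (e (?N - 1 - i)))) \<le> 2 * Psi \<theta> f A"
      unfolding sum using t0 N by (intro sum_mono2) auto
    moreover have "(\<Sum>i\<in>{0, ?N - 1}. ?c i * (f (e i) - f (e (?N - 1 - i)))) = 2 * ((\<theta> ^ (?N - 1) - 1) * ?D)"
      using N2 by (simp add: algebra_simps)
    moreover have "\<theta> ^ (?N - 1) * ?D \<le> 2 * ((\<theta> ^ (?N - 1) - 1) * ?D)"
    proof -
      have "\<theta> ^ 1 \<le> \<theta> ^ (?N - 1)" using th N2 by (intro power_increasing) auto
      then have "\<theta> ^ (?N - 1) \<le> 2 * (\<theta> ^ (?N - 1) - 1)" using th by simp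
      then have "\<theta> ^ (?N - 1) * ?D \<le> 2 * (\<theta> ^ (?N - 1) - 1) * ?D" using D0 by (rule mult_right_mono)
      then show ?thesis by (simp only: mult.assoc)
    qed
    ultimately show ?thesis by linarith
  qed
qed

section \<open>One step of the rank potential\<close>

context averaging begin

text \<open>If the cuts \<open>u, \<dots>, i - 1\<close> are crossed at time \<open>t\<close> and \<open>u - 1\<close> is not, then
  \<open>acc e f t i\<close> is the distance of the opinion of rank \<open>i\<close> from the one of rank \<open>u\<close>. After one step the opinion
  of rank \<open>i\<close> is at least \<open>f (e i) - acc i + \<rho> acc (i + 1)\<close>: the members of higher rank and
  at least one endpoint of an edge crossing cut \<open>i\<close> all see an opinion of rank above \<open>i\<close>.\<close>

fun acc :: "(nat \<Rightarrow> nat) \<Rightarrow> (nat \<Rightarrow> real) \<Rightarrow> nat \<Rightarrow> nat \<Rightarrow> real" where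
  "acc e f t 0 = 0"
| "acc e f t (Suc c) = (if closed_at (e ` {..c}) t then 0 else acc e f t c + f (e (Suc c)) - f (e c))"

lemma acc_nonneg: "senum e f A \<Longrightarrow> i < card A \<Longrightarrow> 0 \<le> acc e f t i"
proof (induction i)
  case (Suc i)
  then show ?case using senum_mono[OF Suc.prems(1), of i "Suc i"] by auto
qed simp

lemma senum_diff_image:
  assumes "senum e f A" "c < card A"
  shows "A - e ` {..c} = e ` {Suc c..<card A}"
proof -
  have "A = e ` {..<card A}" using senum_range[OF assms(1)] by simp
  moreover have "e ` {..<card A} - e ` {..c} = e ` ({..<card A} - {..c})"
    using senum_inj_on[OF assms(1) order_refl] assms(2) by (intro inj_on_image_set_diff[symmetric]) auto
  moreover have "{..<card A} - {..c} = {Suc c..<card A}" by auto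
  ultimately show ?thesis by simp
qed

text \<open>u is the first rank of the block of crossed cuts that ends at i: either u = 0 or cut u -
  1 is uncrossed, and then the ranks from u on are the complement of a closed set in A.\<close>

lemma acc_block:
  assumes A: "closed_at A t" and e: "senum e f A" and "i < card A"
  shows "\<exists>u\<le>i. f (e i) - acc e f t i = f (e u) \<and> closed_at (e ` {u..<card A}) t"
  using assms(3)
proof (induction i)
  case 0
  have "closed_at (e ` {0..<card A}) t" using A senum_range[OF e] by (simp add: lessThan_atLeast0)
  then show ?case by simp
next
  case (Suc i)
  show ?case
  proof (cases "closed_at (e ` {..i}) t")
    case True
    then have "closed_at (e ` {Suc i..<card A}) t"
      using closed_at_Diff[OF A True] senum_diff_image[OF e] Suc.prems by simp
    then show ?thesis using True by auto
  next
    case False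
    then show ?thesis using Suc by (auto intro: le_SucI)
  qed
qed

lemma rank_step:
  assumes A: "closed_at A t" and e: "senum e f A" and f': "\<And>i. i \<in> A \<Longrightarrow> f' i = (\<Sum>j\<in>A. P t i j * f j)"
    and th: "0 \<le> \<theta>"
  shows "rank_sum \<theta> f A + (\<rho> * \<theta> - 1) * (\<Sum>i<card A. \<theta> ^ (card A - 1 - i) * acc e f t i) \<le> rank_sum \<theta> f' A"
proof -
  let ?N = "card A" and ?a = "acc e f t"
  let ?w = "\<lambda>i. \<theta> ^ (card A - 1 - i)"
  have fin: "finite A" using closed_at_finite[OF A] .
  have lt: "i \<in> A \<Longrightarrow> i < n" for i using closed_at_subset[OF A] .
  obtain e' where e': "senum e' f' A" using senum_exists[OF fin] by blast
  have key: "f (e i) - ?a i + (if Suc i < ?N then \<rho> * ?a (Suc i) else 0) \<le> f' (e' i)" if i: "i < ?N" for i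
  proof -
    obtain u where u: "u \<le> i" "f (e i) - ?a i = f (e u)" "closed_at (e ` {u..<?N}) t"
      using acc_block[OF A e i] by blast
    let ?D = "e ` {u..<?N}"
    have DA: "?D \<subseteq> A" using senum_mem[OF e] by auto
    have fD: "f (e u) \<le> f j" if "j \<in> ?D" for j using that senum_mono[OF e] by auto
    have f'D: "f' w = f (e u) + (\<Sum>j\<in>?D. P t w j * (f j - f (e u)))" if w: "w \<in> ?D" for w
    proof -
      have "f' w = (\<Sum>j\<in>?D. P t w j * f j)"
        using f' w DA closed_sum[OF A, of w f] closed_sum[OF u(3) w, of f] by auto
      then show ?thesis
        using closed_sum_P[OF u(3) w] by (simp add: right_diff_distrib sum_subtractf flip: sum_distrib_right)
    qed
    have nn: "0 \<le> P t w j * (f j - f (e u))" if "w \<in> ?D" "j \<in> ?D" for w j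
    proof (intro mult_nonneg_nonneg)
      have "w < n" "j < n" using that DA lt by blast+
      then show "0 \<le> P t w j" by (rule P_nonneg)
      show "0 \<le> f j - f (e u)" using fD[OF that(2)] by simp
    qed
    have low: "f (e u) \<le> f' w" if "w \<in> ?D" for w
      using f'D[OF that] nn[OF that] by (simp add: sum_nonneg)
    have cD: "card (e ` {l..<?N}) = ?N - l" for l
      using senum_card_image[OF e, of "{l..<?N}"] by (simp add: subset_iff)
    show ?thesis
    proof (cases "Suc i < ?N \<and> \<not> closed_at (e ` {..i}) t")
      case False
      have "f (e u) \<le> f' (e' i)"
        by (rule senum_ge[OF e' i DA]) (use cD[of u] u(1) low in auto)
      moreover have "Suc i < ?N \<Longrightarrow> ?a (Suc i) = 0" using False by simp
      ultimately show ?thesis using u(2) by auto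
    next
      case True
      then have a: "?a (Suc i) = f (e (Suc i)) - f (e u)" using u(2) by auto
      have sub: "e ` {..i} \<subseteq> A" using senum_mem[OF e] i by auto
      obtain k l where kl: "k \<in> e ` {..i}" "l \<in> A - e ` {..i}" "P t k l > 0"
        using crossing_edge[OF A sub] True by blast
      have l: "l \<in> e ` {Suc i..<?N}" using kl(2) senum_diff_image[OF e i] by simp
      have lD: "l \<in> ?D" using l u(1) by auto
      have kA: "k \<in> A" using kl(1) sub by blast
      have "P t l k > 0" using kl P_sym[of k l t] lt kA by auto
      then have kD: "k \<in> ?D" using u(3) lD lt[OF kA] unfolding closed_at_def by blast
      \<comment> \<open>The ranks above i are N - i - 1 vertices; with the lower endpoint k of the
        crossing edge they are N - i, just enough for \<open>senum_ge\<close> at rank i.\<close>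
      let ?S = "insert k (e ` {Suc i..<?N})"
      have "f (e u) + \<rho> * ?a (Suc i) \<le> f' (e' i)"
      proof (rule senum_ge[OF e' i])
        show SA: "?S \<subseteq> A" using kA senum_mem[OF e] by auto
        have "k \<notin> e ` {Suc i..<?N}" using kl(1) senum_diff_image[OF e i] by blast
        then show "?N \<le> card ?S + i" using cD[of "Suc i"] by simp
        have via: "f (e u) + \<rho> * ?a (Suc i) \<le> f' w"
          if w: "w \<in> ?D" and j: "j \<in> e ` {Suc i..<?N}" "P t w j > 0" for w j
        proof -
          have jD: "j \<in> ?D" using j(1) u(1) by auto
          have fj: "f (e (Suc i)) \<le> f j" using j(1) senum_mono[OF e] by auto
          have wj: "w < n" "j < n" using w jD DA lt by auto
          have "\<rho> * ?a (Suc i) \<le> P t w j * (f j - f (e u))"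
            unfolding a using P_ge[OF wj j(2)] fj senum_mono[OF e, of u "Suc i"] u(1) True rho_pos
            by (intro mult_mono) auto
          also have "\<dots> \<le> (\<Sum>j\<in>?D. P t w j * (f j - f (e u)))"
            using nn[OF w] jD by (intro member_le_sum) auto
          finally show ?thesis using f'D[OF w] by simp
        qed
        fix w assume "w \<in> ?S"
        then consider "w = k" | "w \<in> e ` {Suc i..<?N}" by blast
        then show "f (e u) + \<rho> * ?a (Suc i) \<le> f' w"
        proof cases
          case 1
          then show ?thesis using via[OF kD l] kl(3) by simp
        next
          case 2
          then have "w \<in> ?D" using u(1) by auto
          then show ?thesis using via[OF _ 2] P_diag lt DA by blast
        qed
      qed
      then show ?thesis using u(2) True by simp
    qed
  qed
  have w0: "0 \<le> ?w i" for i using th by simp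
  \<comment> \<open>The gain at rank i is \<rho> times the loss at rank i + 1, whose weight is
    smaller by the factor \<theta>. So the gains reindex to \<open>\<rho> * \<theta>\<close> times
    the losses; nothing is missing at rank 0, where acc vanishes.\<close>
  have shift: "(\<Sum>i<?N. ?w i * (if Suc i < ?N then \<rho> * ?a (Suc i) else 0)) = \<rho> * \<theta> * (\<Sum>i<?N. ?w i * ?a i)"
  proof (cases ?N)
    case (Suc M)
    have "(\<Sum>i<Suc M. \<theta> ^ (M - i) * (if Suc i < Suc M then \<rho> * ?a (Suc i) else 0))
        = (\<Sum>i<M. \<theta> ^ (M - i) * (\<rho> * ?a (Suc i)))" by simp
    also have "\<dots> = (\<Sum>i<M. \<rho> * \<theta> * (\<theta> ^ (M - Suc i) * ?a (Suc i)))"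
    proof (intro sum.cong refl)
      fix i assume "i \<in> {..<M}"
      then have "M - i = Suc (M - Suc i)" by auto
      then show "\<theta> ^ (M - i) * (\<rho> * ?a (Suc i)) = \<rho> * \<theta> * (\<theta> ^ (M - Suc i) * ?a (Suc i))"
        by (simp only: power_Suc mult_ac)
    qed
    also have "\<dots> = \<rho> * \<theta> * (\<Sum>i<Suc M. \<theta> ^ (M - i) * ?a i)"
      unfolding sum.lessThan_Suc_shift by (simp add: sum_distrib_left)
    finally show ?thesis using Suc by simp
  qed simp
  have "rank_sum \<theta> f A + (\<rho> * \<theta> - 1) * (\<Sum>i<?N. ?w i * ?a i)
     = (\<Sum>i<?N. ?w i * (f (e i) - ?a i + (if Suc i < ?N then \<rho> * ?a (Suc i) else 0)))"
    unfolding rank_sum_eq[OF e] distrib_left right_diff_distrib sum.distrib sum_subtractf shift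
    by (simp add: algebra_simps)
  also have "\<dots> \<le> (\<Sum>i<?N. ?w i * f' (e' i))"
    using key w0 by (intro sum_mono mult_left_mono) auto
  also have "\<dots> = rank_sum \<theta> f' A" using rank_sum_eq[OF e'] by simp
  finally show ?thesis .
qed

lemma Psi_step:
  assumes A: "closed_at A t" and e: "senum e (x t) A" and th: "0 \<le> \<theta>"
  shows "Psi \<theta> (x (Suc t)) A \<le> Psi \<theta> (x t) A
    - (\<rho> * \<theta> - 1) * (\<Sum>i<card A. \<theta> ^ (card A - 1 - i) * acc e (x t) t i)
    - (\<rho> * \<theta> - 1) * (\<Sum>i<card A. \<theta> ^ (card A - 1 - i) * acc (\<lambda>i. e (card A - 1 - i)) (\<lambda>v. - x t v) t i)"
proof -
  have 1: "x (Suc t) i = (\<Sum>j\<in>A. P t i j * x t j)" if "i \<in> A" for i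
    using closed_sum[OF A that] by simp
  then have 2: "- x (Suc t) i = (\<Sum>j\<in>A. P t i j * - x t j)" if "i \<in> A" for i
    using that by (simp add: sum_negf)
  show ?thesis
    using rank_step[OF A e 1 th] rank_step[OF A senum_uminus[OF e] 2 th] unfolding Psi_def by linarith
qed

lemma acc_term_le:
  assumes e: "senum e f A" and i: "i < card A" and th: "0 \<le> \<theta>"
  shows "\<theta> ^ (card A - 1 - i) * acc e f t i \<le> (\<Sum>i<card A. \<theta> ^ (card A - 1 - i) * acc e f t i)"
  using i th acc_nonneg[OF e] by (intro member_le_sum) auto

lemma acc_sum_nonneg:
  assumes e: "senum e f A" and th: "0 \<le> \<theta>"
  shows "0 \<le> (\<Sum>i<card A. \<theta> ^ (card A - 1 - i) * acc e f t i)"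
  using th acc_nonneg[OF e] by (intro sum_nonneg) auto

lemma Psi_Suc_le:
  assumes A: "closed_at A t" and th: "0 \<le> \<theta>" "1 \<le> \<rho> * \<theta>"
  shows "Psi \<theta> (x (Suc t)) A \<le> Psi \<theta> (x t) A"
proof -
  obtain e where e: "senum e (x t) A" using senum_exists closed_at_finite[OF A] by blast
  show ?thesis
    using Psi_step[OF A e th(1)] th
      mult_nonneg_nonneg[OF _ acc_sum_nonneg[OF e th(1), of t], of "\<rho> * \<theta> - 1"]
      mult_nonneg_nonneg[OF _ acc_sum_nonneg[OF senum_uminus[OF e] th(1), of t], of "\<rho> * \<theta> - 1"]
    by linarith
qed

lemma Psi_window:
  assumes "a \<le> b" "\<And>t. t \<in> {a..<b} \<Longrightarrow> closed_at A t" and th: "0 \<le> \<theta>" "1 \<le> \<rho> * \<theta>"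
  shows "Psi \<theta> (x b) A \<le> Psi \<theta> (x a) A"
  using assms(1,2)
proof (induction b rule: dec_induct)
  case (step b)
  then have "Psi \<theta> (x b) A \<le> Psi \<theta> (x a) A" "closed_at A b" by auto
  then show ?case using Psi_Suc_le[of A b \<theta>] th by linarith
qed simp

text \<open>One term of the sum, with its weight replaced by 1. This crude drop suffices for blocks,
  where no time is spent waiting for a crossing.\<close>

lemma Psi_block:
  assumes A: "closed_at A t" and e: "senum e (x t) A" and i: "i < card A" and th: "1 \<le> \<theta>" "1 \<le> \<rho> * \<theta>"
  shows "Psi \<theta> (x (Suc t)) A \<le> Psi \<theta> (x t) A - (\<rho> * \<theta> - 1) * acc e (x t) t i"
proof -
  have th0: "0 \<le> \<theta>" using th by simp
  have "1 * acc e (x t) t i \<le> \<theta> ^ (card A - 1 - i) * acc e (x t) t i"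
    using th acc_nonneg[OF e i] by (intro mult_right_mono one_le_power) auto
  also have "\<dots> \<le> (\<Sum>i<card A. \<theta> ^ (card A - 1 - i) * acc e (x t) t i)" by (rule acc_term_le[OF e i th0])
  finally have "(\<rho> * \<theta> - 1) * acc e (x t) t i
    \<le> (\<rho> * \<theta> - 1) * (\<Sum>i<card A. \<theta> ^ (card A - 1 - i) * acc e (x t) t i)"
    using th by (intro mult_left_mono) auto
  then show ?thesis
    using Psi_step[OF A e th0] th
      mult_nonneg_nonneg[OF _ acc_sum_nonneg[OF senum_uminus[OF e] th0, of t], of "\<rho> * \<theta> - 1"]
    by linarith
qed

lemma acc_cut_ge:
  assumes e: "senum e f A" and c: "Suc c < card A" and nc: "\<not> closed_at (e ` {..c}) t" and th: "0 \<le> \<theta>"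
  shows "\<theta> ^ (card A - 2 - c) * (f (e (Suc c)) - f (e c)) \<le> (\<Sum>i<card A. \<theta> ^ (card A - 1 - i) * acc e f t i)"
proof -
  have "f (e (Suc c)) - f (e c) \<le> acc e f t (Suc c)" using nc acc_nonneg[OF e, of c] c by simp
  then have "\<theta> ^ (card A - 2 - c) * (f (e (Suc c)) - f (e c)) \<le> \<theta> ^ (card A - 1 - Suc c) * acc e f t (Suc c)"
    using th by (simp add: mult_left_mono numeral_2_eq_2)
  also have "\<dots> \<le> (\<Sum>i<card A. \<theta> ^ (card A - 1 - i) * acc e f t i)" by (rule acc_term_le[OF e c th])
  finally show ?thesis .
qed

text \<open>The separation at time t makes B an initial segment of the current order, whatever
  happened inside the two sides. The crossed cut enters the rank sum of x with weight \<theta>^(card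
  (A - B) - 1) and that of - x with weight \<theta>^(card B - 1), the prefactors in the bounds for
  the two subsystems.\<close>

lemma Psi_cut:
  assumes A: "closed_at A t" and B: "B \<subseteq> A" "B \<noteq> {}" "B \<noteq> A" "\<not> closed_at B t"
    and uw: "\<And>i. i \<in> B \<Longrightarrow> x t i \<le> u" "\<And>j. j \<in> A - B \<Longrightarrow> w \<le> x t j" "u < w"
    and th: "0 \<le> \<theta>" "1 \<le> \<rho> * \<theta>"
  shows "Psi \<theta> (x (Suc t)) A \<le> Psi \<theta> (x t) A
    - (\<rho> * \<theta> - 1) * ((\<theta> ^ (card (A - B) - 1) + \<theta> ^ (card B - 1)) * (w - u))"
proof -
  have fin: "finite A" "finite B" using closed_at_finite[OF A] B(1) finite_subset by auto
  obtain e where e: "senum e (x t) A" using senum_exists[OF fin(1)] by blast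
  define N where "N = card A"
  define c where "c = card B - 1"
  define e2 where "e2 = (\<lambda>i. e (N - 1 - i))"
  have e2: "senum e2 (\<lambda>v. - x t v) A" unfolding e2_def N_def by (rule senum_uminus[OF e])
  have cB: "card B = Suc c" unfolding c_def using B(2) fin by (simp add: card_gt_0_iff)
  have "card B < N" unfolding N_def using B fin by (simp add: psubset_card_mono)
  then have cN: "Suc c < N" using cB by simp
  have cAB: "card (A - B) - 1 = N - 2 - c"
    using card_Diff_subset[OF fin(2) B(1)] cB unfolding N_def by simp
  have init: "e ` {..c} = B"
    unfolding c_def by (rule senum_initial[OF e B(1) fin(1) B(2)]) (use uw in force)
  have rest: "A - B = e ` {Suc c..<N}"
    using senum_diff_image[OF e, of c] init cN unfolding N_def by simp
  have gap: "w - u \<le> x t (e (Suc c)) - x t (e c)"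
  proof -
    have "e c \<in> B" using init by blast
    moreover have "e (Suc c) \<in> A - B" using rest cN by auto
    ultimately show ?thesis using uw(1)[of "e c"] uw(2)[of "e (Suc c)"] by linarith
  qed
  have g1: "\<theta> ^ (N - 2 - c) * (w - u) \<le> (\<Sum>i<N. \<theta> ^ (N - 1 - i) * acc e (x t) t i)"
  proof -
    have "\<theta> ^ (N - 2 - c) * (w - u) \<le> \<theta> ^ (N - 2 - c) * (x t (e (Suc c)) - x t (e c))"
      using gap th by (intro mult_left_mono) auto
    also have "\<dots> \<le> (\<Sum>i<N. \<theta> ^ (N - 1 - i) * acc e (x t) t i)"
      using acc_cut_ge[OF e _ _ th(1), of c t] cN init B(4) unfolding N_def by simp
    finally show ?thesis .
  qed
  have g2: "\<theta> ^ c * (w - u) \<le> (\<Sum>i<N. \<theta> ^ (N - 1 - i) * acc e2 (\<lambda>v. - x t v) t i)"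
  proof -
    define c2 where "c2 = N - 2 - c"
    have c2: "Suc c2 < N" "N - 2 - c2 = c" "e2 (Suc c2) = e c" "e2 c2 = e (Suc c)"
      using cN by (auto simp: c2_def e2_def intro!: arg_cong[of _ _ e])
    have "e2 ` {..c2} = A - B"
    proof -
      have "(\<lambda>i. N - 1 - i) ` {..c2} = {Suc c..<N}"
      proof (rule set_eqI)
        fix l show "l \<in> (\<lambda>i. N - 1 - i) ` {..c2} \<longleftrightarrow> l \<in> {Suc c..<N}"
          using cN by (auto simp: c2_def image_iff intro!: bexI[of _ "N - 1 - l"])
      qed
      then have "e ` ((\<lambda>i. N - 1 - i) ` {..c2}) = A - B" using rest by simp
      then show ?thesis by (simp add: e2_def image_image)
    qed
    moreover have "\<not> closed_at (A - B) t"
      using closed_at_Diff[OF A, of "A - B"] B(1,4) by (metis double_diff order_refl)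
    ultimately have "\<theta> ^ (N - 2 - c2) * (- x t (e2 (Suc c2)) - - x t (e2 c2))
        \<le> (\<Sum>i<N. \<theta> ^ (N - 1 - i) * acc e2 (\<lambda>v. - x t v) t i)"
      using acc_cut_ge[OF e2 _ _ th(1), of c2 t] c2(1) unfolding N_def by simp
    moreover have "\<theta> ^ c * (w - u) \<le> \<theta> ^ c * (x t (e (Suc c)) - x t (e c))"
      using gap th by (intro mult_left_mono) auto
    ultimately show ?thesis unfolding c2 by simp
  qed
  have "(\<rho> * \<theta> - 1) * ((\<theta> ^ (N - 2 - c) + \<theta> ^ c) * (w - u))
    \<le> (\<rho> * \<theta> - 1) * ((\<Sum>i<N. \<theta> ^ (N - 1 - i) * acc e (x t) t i)
        + (\<Sum>i<N. \<theta> ^ (N - 1 - i) * acc e2 (\<lambda>v. - x t v) t i))"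
    using g1 g2 th by (intro mult_left_mono) (auto simp: distrib_right)
  then show ?thesis
    using Psi_step[OF A e th(1)] unfolding cAB c_def[symmetric] e2_def N_def by (simp add: distrib_left)
qed

text \<open>Otherwise the range D would be too short. It consists of the last accumulation and of
  the contributions of the uncrossed cuts, fewer than m; each of these resets an accumulation and
  adds its own gap, together less than 2 * \<beta>.\<close>

lemma block_or_gap:
  assumes A: "closed_at A t" "A \<noteq> {}" and e: "senum e (x t) A" and m: "card (comps A t) \<le> m"
    and D: "D = x t (e (card A - 1)) - x t (e 0)"
  shows "(\<exists>i<card A. D / (2 * real m) \<le> acc e (x t) t i) \<or>
    (\<exists>c. Suc c < card A \<and> closed_at (e ` {..c}) t \<and> D / (2 * real m) \<le> x t (e (Suc c)) - x t (e c))"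
proof (rule ccontr)
  define \<beta> where "\<beta> = D / (2 * real m)"
  assume neg: "\<not> ?thesis"
  then have a: "acc e (x t) t i < \<beta>" if "i < card A" for i using that unfolding \<beta>_def by force
  have g: "x t (e (Suc c)) - x t (e c) < \<beta>" if "Suc c < card A" "closed_at (e ` {..c}) t" for c
    using that neg unfolding \<beta>_def by force
  have N: "0 < card A" using A closed_at_finite by (auto simp: card_gt_0_iff)
  have "0 < \<beta>" using a[OF N] by simp
  define U where "U = {c \<in> {..<card A - 1}. closed_at (e ` {..c}) t}"
  have "x t (e i) - x t (e 0) \<le> acc e (x t) t i + 2 * \<beta> * real (card {c \<in> {..<i}. closed_at (e ` {..c}) t})"
    if "i < card A" for i
    using that
  proof (induction i)
    case (Suc i)
    have IH: "x t (e i) - x t (e 0) \<le> acc e (x t) t i + 2 * \<beta> * real (card {c \<in> {..<i}. closed_at (e ` {..c}) t})"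
      using Suc by simp
    show ?case
    proof (cases "closed_at (e ` {..i}) t")
      case True
      then have "{c \<in> {..<Suc i}. closed_at (e ` {..c}) t} = insert i {c \<in> {..<i}. closed_at (e ` {..c}) t}"
        by (auto simp: less_Suc_eq)
      then have "card {c \<in> {..<Suc i}. closed_at (e ` {..c}) t} = Suc (card {c \<in> {..<i}. closed_at (e ` {..c}) t})"
        by simp
      then show ?thesis using IH True a[of i] g[of i] Suc.prems by (simp add: algebra_simps)
    next
      case False
      then have "{c \<in> {..<Suc i}. closed_at (e ` {..c}) t} = {c \<in> {..<i}. closed_at (e ` {..c}) t}"
        by (auto simp: less_Suc_eq)
      then show ?thesis using IH False by simp
    qed
  qed simp
  from this[of "card A - 1"] have "D \<le> acc e (x t) t (card A - 1) + 2 * \<beta> * real (card U)"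
    using N unfolding D U_def by simp
  moreover have "card U + 1 \<le> card (comps A t)"
    using e A by (intro uncrossed_cuts[of e t A t]) (auto simp: U_def)
  then have Um: "real (card U) + 1 \<le> real m" using m by linarith
  then have "2 * \<beta> * real (card U) \<le> 2 * \<beta> * (real m - 1)" using \<open>0 < \<beta>\<close> by (intro mult_left_mono) auto
  moreover have "acc e (x t) t (card A - 1) < \<beta>" using a N by simp
  ultimately have "D < 2 * \<beta> * real m" using \<open>0 < \<beta>\<close> by (simp add: algebra_simps)
  moreover have "2 * \<beta> * real m = D" unfolding \<beta>_def using Um by (simp add: field_simps)
  ultimately show False by simp
qed

end

section \<open>The general bound\<close>

context averaging begin

text \<open>Unlike in \<open>cnt_bound\<close>, only one cut B with a large gap is awaited. With T =
  \<theta>^(card B - 1) + \<theta>^(card (A - B) - 1), waiting costs 4 * W * T * Y^m, and the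
  crossing removes at least the fraction T / (\<Lambda> * \<theta>^(N-1)) of the potential. T
  cancels, so the prefactor \<theta>^(N-1) is not multiplied up from level to level.\<close>

lemma cnt_bound_general:
  assumes eps: "0 < \<epsilon>" and s: "0 < s" "s \<le> 1" and th: "2 \<le> \<theta>" "\<rho> * \<theta> = 1 + 1 / real n"
    and nm: "0 < n" "0 < m0"
  shows "m \<le> m0 \<Longrightarrow> A \<noteq> {} \<Longrightarrow> A \<subseteq> {..<n} \<Longrightarrow>
      (\<And>t. t \<in> {a..<b} \<Longrightarrow> closed_at A t \<and> card (comps A t) \<le> m) \<Longrightarrow>
      real (cnt \<epsilon> A a b) \<le> (2 * Psi \<theta> (x a) A / (\<theta> ^ (card A - 1) * \<epsilon>)) powr s * \<theta> ^ (card A - 1)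
        * (20 * real n * real m0 / s) ^ m"
proof (induction m arbitrary: A a b)
  case 0
  then show ?case
  proof (cases "a < b")
    case True
    then show ?thesis using 0(4)[of a] comps_nonempty[of A a] 0(2) by auto
  next
    case False
    then have "cnt \<epsilon> A a b = 0" by (simp add: cnt_def)
    moreover have "0 \<le> \<theta> ^ (card A - 1)" using th by simp
    ultimately show ?thesis by simp
  qed
next
  case (Suc m)
  note IH_m = Suc.IH
  define Y where "Y = 20 * real n * real m0 / s"
  \<comment> \<open>\<Lambda> collects the losses in the drop: n from \<rho> * \<theta> - 1 = 1/n, 2
    * m0 from \<open>block_or_gap\<close>, and 2 from \<open>Psi_upper\<close>. Then s * Y = 5 *
    \<Lambda> pays 4 for the subsystems and 1 for the crossing step.\<close>
  define \<Lambda> where "\<Lambda> = 4 * real n * real m0"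
  define N where "N = card A"
  define W where "W B a = (2 * Psi \<theta> (x a) B / (\<theta> ^ (card B - 1) * \<epsilon>)) powr s" for B a
  have Y5: "s * Y = 5 * \<Lambda>" using s by (simp add: Y_def \<Lambda>_def)
  have nm1: "1 \<le> real n * real m0"
    using nm by (metis Suc_leI One_nat_def mult_pos_pos of_nat_1 of_nat_le_iff of_nat_mult)
  have L4: "4 \<le> \<Lambda>" using nm1 by (simp add: \<Lambda>_def)
  have Yge: "5 \<le> Y"
  proof -
    have "s * 5 \<le> 1 * 20" using s by simp
    also have "\<dots> \<le> s * Y" using Y5 L4 by simp
    finally show ?thesis using s by simp
  qed
  have th0: "0 \<le> \<theta>" "1 \<le> \<theta>" "1 \<le> \<rho> * \<theta>" "\<rho> * \<theta> - 1 = 1 / real n" using th nm by auto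
  have th_ne: "\<theta> \<noteq> 0" using th by simp
  have thp: "0 < \<theta> ^ k" "1 \<le> \<theta> ^ k" for k using th by auto
  have finA: "finite A" using Suc.prems(3) finite_subset by blast
  have N0: "0 < N" unfolding N_def using Suc.prems(2) finA by (simp add: card_gt_0_iff)
  have PsiD: "\<exists>D. (\<forall>i\<in>B. \<forall>j\<in>B. x t i - x t j \<le> D) \<and> 0 \<le> D
      \<and> \<theta> ^ (card B - 1) * D \<le> 2 * Psi \<theta> (x t) B \<and> Psi \<theta> (x t) B \<le> 2 * \<theta> ^ (card B - 1) * D
      \<and> (\<exists>i\<in>B. \<exists>j\<in>B. D = x t i - x t j)"
    if B: "finite B" "B \<noteq> {}" for B t
  proof -
    obtain e where e: "senum e (x t) B" using senum_exists[OF B(1)] by blast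
    have c0: "0 < card B" using B by (simp add: card_gt_0_iff)
    define D where "D = x t (e (card B - 1)) - x t (e 0)"
    have "x t i - x t j \<le> D" if ij: "i \<in> B" "j \<in> B" for i j
    proof -
      obtain k l where kl: "k < card B" "i = e k" "l < card B" "j = e l"
        using senum_obtain[OF e ij(1)] senum_obtain[OF e ij(2)] by metis
      have "k \<le> card B - 1" "card B - 1 < card B" using kl(1) by auto
      then show ?thesis
        using senum_mono[OF e, of k "card B - 1"] senum_mono[OF e, of 0 l] kl unfolding D_def by simp
    qed
    moreover have "0 \<le> D" using senum_mono[OF e, of 0 "card B - 1"] c0 by (simp add: D_def)
    moreover have "e (card B - 1) \<in> B" "e 0 \<in> B" using senum_mem[OF e] c0 by auto
    ultimately show ?thesis
      using Psi_lower[OF e c0 th(1)] Psi_upper[OF e c0 th(1)] unfolding D_def by blast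
  qed
  have Psi0: "0 \<le> Psi \<theta> (x t) B" if B: "finite B" "B \<noteq> {}" for B t
  proof -
    obtain D where D: "0 \<le> D" "\<theta> ^ (card B - 1) * D \<le> 2 * Psi \<theta> (x t) B" using PsiD[OF B] by blast
    have "0 \<le> \<theta> ^ (card B - 1) * D" using D(1) thp(1)[of "card B - 1"] by simp
    then show ?thesis using D(2) by linarith
  qed
  have arg0: "0 \<le> 2 * Psi \<theta> (x t) B / (\<theta> ^ (card B - 1) * \<epsilon>)" if "finite B" "B \<noteq> {}" for B t
    using Psi0[OF that, of t] thp(1)[of "card B - 1"] eps
    by (intro divide_nonneg_pos mult_pos_pos mult_nonneg_nonneg) simp_all
  \<comment> \<open>Divided by \<theta>^(card B - 1), Psi lies between half and twice the diameter,
    and diameters are monotone in the set; hence the factor 4.\<close>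
  have W_sub: "W B a \<le> 4 * W A a" if B: "B \<subseteq> A" "B \<noteq> {}" for B a
  proof -
    have fB: "finite B" using B(1) finA finite_subset by blast
    obtain DB where DB: "\<exists>i\<in>B. \<exists>j\<in>B. DB = x a i - x a j" "Psi \<theta> (x a) B \<le> 2 * \<theta> ^ (card B - 1) * DB"
      using PsiD[OF fB B(2)] by blast
    obtain D where D: "\<forall>i\<in>A. \<forall>j\<in>A. x a i - x a j \<le> D" "\<theta> ^ (N - 1) * D \<le> 2 * Psi \<theta> (x a) A"
      using PsiD[OF finA Suc.prems(2)] unfolding N_def by blast
    have "DB \<le> D" using DB(1) D(1) B(1) by blast
    have "2 * Psi \<theta> (x a) B / (\<theta> ^ (card B - 1) * \<epsilon>) \<le> 4 * DB / \<epsilon>"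
      using DB(2) thp[of "card B - 1"] eps by (simp add: field_simps)
    also have "\<dots> \<le> 4 * D / \<epsilon>" using \<open>DB \<le> D\<close> eps by (simp add: divide_right_mono)
    also have "\<dots> \<le> 4 * (2 * Psi \<theta> (x a) A / (\<theta> ^ (N - 1) * \<epsilon>))"
      using D(2) thp[of "N - 1"] eps by (simp add: field_simps)
    finally have "W B a \<le> (4 * (2 * Psi \<theta> (x a) A / (\<theta> ^ (N - 1) * \<epsilon>))) powr s"
      unfolding W_def using s arg0[OF fB B(2), of a] by (intro powr_mono2) simp_all
    also have "\<dots> = 4 powr s * W A a"
      unfolding W_def N_def by (intro powr_mult)
    also have "\<dots> \<le> 4 powr 1 * W A a"
      using s by (intro mult_right_mono powr_mono) (auto simp: W_def)
    finally show ?thesis by simp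
  qed
  have rhs0: "0 \<le> W A a * \<theta> ^ (N - 1) * Y ^ k" for a k
    using th0(1) Yge by (intro mult_nonneg_nonneg zero_le_power) (auto simp: W_def)
  have Wdrop: "W A c \<le> (1 - s * (T / (\<Lambda> * \<theta> ^ (N - 1)))) * W A a"
    if T: "0 \<le> T" "T \<le> \<theta> ^ (N - 1)" and D: "Psi \<theta> (x a) A \<le> 2 * \<theta> ^ (N - 1) * D"
      and drop: "Psi \<theta> (x c) A \<le> Psi \<theta> (x a) A - 1 / real n * (T * (D / (2 * real m0)))" for a c T D
  proof -
    define \<delta> where "\<delta> = T / (\<Lambda> * \<theta> ^ (N - 1))"
    have d1: "0 \<le> \<delta>" "\<delta> \<le> 1"
    proof -
      show "0 \<le> \<delta>" unfolding \<delta>_def using T(1) L4 thp[of "N - 1"] by simp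
      have "1 * \<theta> ^ (N - 1) \<le> \<Lambda> * \<theta> ^ (N - 1)" using L4 thp[of "N - 1"] by (intro mult_right_mono) auto
      then have "T \<le> \<Lambda> * \<theta> ^ (N - 1)" using T(2) by linarith
      moreover have "0 < \<Lambda> * \<theta> ^ (N - 1)" using L4 thp(1)[of "N - 1"] by simp
      ultimately show "\<delta> \<le> 1" unfolding \<delta>_def by (simp only: divide_le_eq_1_pos)
    qed
    have "\<delta> * Psi \<theta> (x a) A \<le> \<delta> * (2 * \<theta> ^ (N - 1) * D)" using D d1 by (intro mult_left_mono)
    also have "\<dots> = 1 / real n * (T * (D / (2 * real m0)))"
      using th_ne nm by (simp add: \<delta>_def \<Lambda>_def field_simps)
    finally have "Psi \<theta> (x c) A \<le> (1 - \<delta>) * Psi \<theta> (x a) A" using drop by (simp add: left_diff_distrib)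
    then have "2 / (\<theta> ^ (N - 1) * \<epsilon>) * Psi \<theta> (x c) A \<le> 2 / (\<theta> ^ (N - 1) * \<epsilon>) * ((1 - \<delta>) * Psi \<theta> (x a) A)"
      using eps thp[of "N - 1"] by (intro mult_left_mono) auto
    then have "2 * Psi \<theta> (x c) A / (\<theta> ^ (N - 1) * \<epsilon>) \<le> (1 - \<delta>) * (2 * Psi \<theta> (x a) A / (\<theta> ^ (N - 1) * \<epsilon>))"
      by (simp add: mult_ac)
    then have "W A c \<le> ((1 - \<delta>) * (2 * Psi \<theta> (x a) A / (\<theta> ^ (N - 1) * \<epsilon>))) powr s"
      unfolding W_def N_def[symmetric] using s arg0[OF finA Suc.prems(2), of c] N_def by (intro powr_mono2) simp_all
    also have "\<dots> = (1 - \<delta>) powr s * W A a"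
      unfolding W_def N_def[symmetric] by (intro powr_mult)
    also have "\<dots> \<le> (1 - s * \<delta>) * W A a"
      using powr_one_minus_le[OF d1 s] by (intro mult_right_mono) (auto simp: W_def)
    finally show ?thesis unfolding \<delta>_def .
  qed
  have combine: "real (cnt \<epsilon> A a b) \<le> W A a * \<theta> ^ (N - 1) * Y ^ Suc m"
    if c: "a \<le> c" "c < b" and T: "1 \<le> T" "T \<le> \<theta> ^ (N - 1)" and D: "Psi \<theta> (x a) A \<le> 2 * \<theta> ^ (N - 1) * D"
      and drop: "Psi \<theta> (x (Suc c)) A \<le> Psi \<theta> (x a) A - 1 / real n * (T * (D / (2 * real m0)))"
      and first: "real (cnt \<epsilon> A a c) \<le> 4 * W A a * T * Y ^ m"
      and last: "real (cnt \<epsilon> A (Suc c) b) \<le> W A (Suc c) * \<theta> ^ (N - 1) * Y ^ Suc m"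
      and W1: "1 \<le> W A a" for a c T D
  proof -
    have Ym: "1 \<le> Y ^ m" using Yge by simp
    have WT: "1 \<le> W A a * T" using mult_mono[OF W1 T(1)] W1 by simp
    have WTY: "1 \<le> W A a * T * Y ^ m" using mult_mono[OF WT Ym] WT by simp
    have "W A (Suc c) * \<theta> ^ (N - 1) * Y ^ Suc m
        \<le> (1 - s * (T / (\<Lambda> * \<theta> ^ (N - 1)))) * W A a * \<theta> ^ (N - 1) * Y ^ Suc m"
      using Wdrop[OF _ T(2) D drop] T th0(1) Yge by (intro mult_right_mono zero_le_power) auto
    also have "\<dots> = W A a * \<theta> ^ (N - 1) * Y ^ Suc m - (s * Y) * (W A a * T * Y ^ m) / \<Lambda>"
      using th_ne L4 by (simp add: field_simps)
    also have "\<dots> = W A a * \<theta> ^ (N - 1) * Y ^ Suc m - 5 * (W A a * T * Y ^ m)"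
      unfolding Y5 using L4 by simp
    finally have "real (cnt \<epsilon> A (Suc c) b) \<le> W A a * \<theta> ^ (N - 1) * Y ^ Suc m - 5 * (W A a * T * Y ^ m)"
      using last by linarith
    moreover have "real (cnt \<epsilon> A a b) = real (cnt \<epsilon> A a c) + real (cnt \<epsilon> A c (Suc c)) + real (cnt \<epsilon> A (Suc c) b)"
      using cnt_append[of a c b \<epsilon> A] cnt_append[of c "Suc c" b \<epsilon> A] c by simp
    moreover have "real (cnt \<epsilon> A c (Suc c)) \<le> 1" using cnt_single[of \<epsilon> A c] by simp
    ultimately show ?thesis using first WTY by (simp add: algebra_simps)
  qed
  have "real (cnt \<epsilon> A a b) \<le> W A a * \<theta> ^ (N - 1) * Y ^ Suc m" using Suc.prems(4)
  proof (induction "b - a" arbitrary: a rule: less_induct)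
    case less
    show ?case
    proof (cases "\<exists>t\<in>{a..<b}. long_at \<epsilon> A t")
      case False
      then have "cnt \<epsilon> A a b = 0" by (intro cnt_zero) auto
      then show ?thesis using rhs0[of a "Suc m"] by simp
    next
      case True
      then obtain t where t: "t \<in> {a..<b}" "long_at \<epsilon> A t" by blast
      then have ab: "a < b" by auto
      have clA: "closed_at A t" if "t \<in> {a..<b}" for t using less.prems that by blast
      have Aa: "closed_at A a" "card (comps A a) \<le> m0" using less.prems[of a] ab Suc.prems(1) by auto
      have big: "\<theta> ^ (N - 1) * \<epsilon> \<le> 2 * Psi \<theta> (x a) A"
      proof -
        obtain i j where ij: "i \<in> A" "j \<in> A" "\<epsilon> \<le> \<bar>x t i - x t j\<bar>" using t(2) by (auto simp: long_at_def)
        obtain D where D: "\<forall>i\<in>A. \<forall>j\<in>A. x t i - x t j \<le> D" "\<theta> ^ (N - 1) * D \<le> 2 * Psi \<theta> (x t) A"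
          using PsiD[OF finA Suc.prems(2)] unfolding N_def by blast
        have "\<epsilon> \<le> D" using D(1) ij by (smt (verit))
        then have "\<theta> ^ (N - 1) * \<epsilon> \<le> \<theta> ^ (N - 1) * D" using thp[of "N - 1"] by (intro mult_left_mono) auto
        also have "\<dots> \<le> 2 * Psi \<theta> (x t) A" by (rule D(2))
        also have "Psi \<theta> (x t) A \<le> Psi \<theta> (x a) A"
          using t(1) clA by (intro Psi_window th0) auto
        finally show ?thesis by simp
      qed
      have W1: "1 \<le> W A a"
        unfolding W_def N_def[symmetric] using big eps s thp[of "N - 1"] by (intro ge_one_powr_ge_zero) auto
      obtain e where e: "senum e (x a) A" using senum_exists[OF finA] by blast
      define D where "D = x a (e (N - 1)) - x a (e 0)"
      have PD: "Psi \<theta> (x a) A \<le> 2 * \<theta> ^ (N - 1) * D"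
        using Psi_upper[OF e _ th(1)] N0 unfolding D_def N_def by simp
      have D0: "0 < D"
      proof -
        have "0 < \<theta> ^ (N - 1) * \<epsilon>" using thp[of "N - 1"] eps by simp
        then have "0 < 2 * \<theta> ^ (N - 1) * D" using big PD by linarith
        then show ?thesis by (rule zero_less_mult_pos) (use thp(1)[of "N - 1"] in simp)
      qed
      have last: "real (cnt \<epsilon> A (Suc c) b) \<le> W A (Suc c) * \<theta> ^ (N - 1) * Y ^ Suc m" if "a \<le> c" "c < b" for c
        using that by (intro less.hyps less.prems) auto
      consider (block) i where "i < N" "D / (2 * real m0) \<le> acc e (x a) a i"
        | (gap) c where "Suc c < N" "closed_at (e ` {..c}) a" "D / (2 * real m0) \<le> x a (e (Suc c)) - x a (e c)"
        using block_or_gap[OF Aa(1) Suc.prems(2) e Aa(2)] D_def unfolding N_def by blast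
      then show ?thesis
      proof cases
        case block
        \<comment> \<open>Here T = 1: the drop comes in the very first step, and there is no waiting
          time to pay for.\<close>
        have "1 / real n * (1 * (D / (2 * real m0))) \<le> 1 / real n * acc e (x a) a i"
          using block(2) by (intro mult_left_mono) auto
        then have drop: "Psi \<theta> (x (Suc a)) A \<le> Psi \<theta> (x a) A - 1 / real n * (1 * (D / (2 * real m0)))"
          using Psi_block[OF Aa(1) e _ th0(2,3), of i] block(1) unfolding th0(4) N_def by linarith
        show ?thesis
        proof (rule combine[OF order_refl ab _ thp(2) PD drop _ last[OF order_refl ab] W1])
          show "real (cnt \<epsilon> A a a) \<le> 4 * W A a * 1 * Y ^ m" using W1 Yge by (simp add: cnt_def)
        qed simp
      next
        case gap
        define B where "B = e ` {..c}"
        define T where "T = \<theta> ^ (card (A - B) - 1) + \<theta> ^ (card B - 1)"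
        have BA: "B \<subseteq> A" unfolding B_def using senum_mem[OF e] gap(1) by (auto simp: N_def)
        have fB: "finite B" using BA finA finite_subset by blast
        have se: "senum e (x a) A" using e .
        have Bne: "B \<noteq> {}" "B \<noteq> A" unfolding B_def using initial_proper[OF se] gap(1) by (auto simp: N_def)
        have ABne: "A - B \<noteq> {}" using BA Bne by blast
        have cards: "card B + card (A - B) = N" "0 < card B" "0 < card (A - B)"
          unfolding N_def using card_Diff_subset[OF fB BA] card_mono[OF finA BA] Bne(1) ABne fB finA
          by (auto simp: card_gt_0_iff)
        have T1: "1 \<le> T" unfolding T_def using thp(2)[of "card (A - B) - 1"] thp(1)[of "card B - 1"] by linarith
        have T2: "T \<le> \<theta> ^ (N - 1)"
        proof -
          have "\<theta> ^ (card (A - B) - 1) \<le> \<theta> ^ (N - 2)" "\<theta> ^ (card B - 1) \<le> \<theta> ^ (N - 2)"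
            using cards th0 by (auto intro!: power_increasing)
          then have "T \<le> 2 * \<theta> ^ (N - 2)" unfolding T_def by linarith
          also have "\<dots> \<le> \<theta> * \<theta> ^ (N - 2)" using th thp(1)[of "N - 2"] by (intro mult_right_mono) auto
          also have "\<dots> = \<theta> ^ (N - 1)" using cards by (simp flip: power_Suc add: Suc_diff_Suc numeral_2_eq_2)
          finally show ?thesis .
        qed
        have part: "real (cnt \<epsilon> A a c') \<le> 4 * W A a * T * Y ^ m"
          if c': "c' \<le> b" and clB: "\<And>t. t \<in> {a..<c'} \<Longrightarrow> closed_at B t" for c'
        proof -
          have cl2: "closed_at B t \<and> card (comps B t) \<le> m \<and> closed_at (A - B) t \<and> card (comps (A - B) t) \<le> m"
            if t: "t \<in> {a..<c'}" for t
          proof -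
            have tb: "t \<in> {a..<b}" using t c' by auto
            have cl: "closed_at A t" "closed_at B t" "closed_at (A - B) t"
              using clA[OF tb] clB[OF t] closed_at_Diff by auto
            then show ?thesis
              using card_comps_split[OF cl(1,2) BA] less.prems[OF tb] comps_nonempty[OF cl(2) Bne(1)]
                comps_nonempty[OF cl(3) ABne] by linarith
          qed
          have one: "real (cnt \<epsilon> C a c') \<le> 4 * W A a * \<theta> ^ (card C - 1) * Y ^ m"
            if C: "C \<subseteq> A" "C \<noteq> {}" "\<And>t. t \<in> {a..<c'} \<Longrightarrow> closed_at C t \<and> card (comps C t) \<le> m" for C
          proof -
            have "real (cnt \<epsilon> C a c') \<le> W C a * \<theta> ^ (card C - 1) * Y ^ m"
              unfolding W_def Y_def using C Suc.prems(1,3) by (intro IH_m) auto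
            also have "\<dots> \<le> 4 * W A a * \<theta> ^ (card C - 1) * Y ^ m"
              using W_sub[OF C(1,2)] th0(1) Yge by (intro mult_right_mono zero_le_power) auto
            finally show ?thesis .
          qed
          have "real (cnt \<epsilon> A a c') \<le> real (cnt \<epsilon> B a c') + real (cnt \<epsilon> (A - B) a c')"
            using cnt_split[of a c' A B \<epsilon>] clA clB c' BA
            by (smt (verit) atLeastLessThan_iff less_le_trans of_nat_add of_nat_le_iff)
          also have "\<dots> \<le> 4 * W A a * \<theta> ^ (card B - 1) * Y ^ m + 4 * W A a * \<theta> ^ (card (A - B) - 1) * Y ^ m"
            using cl2 BA Bne ABne by (intro add_mono one) auto
          also have "\<dots> = 4 * W A a * T * Y ^ m" by (simp add: T_def algebra_simps)
          finally show ?thesis .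
        qed
        show ?thesis
        proof (cases "\<exists>t. a \<le> t \<and> t < b \<and> \<not> closed_at B t")
          case False
          \<comment> \<open>The cut is never crossed in the window, so only the two subsystems
            count.\<close>
          then have "real (cnt \<epsilon> A a b) \<le> 4 * W A a * T * Y ^ m" by (intro part) auto
          also have "\<dots> = (4 * T) * (W A a * Y ^ m)" by simp
          also have "\<dots> \<le> (Y * \<theta> ^ (N - 1)) * (W A a * Y ^ m)"
            using T1 T2 Yge W1 by (intro mult_right_mono mult_mono) auto
          also have "\<dots> = W A a * \<theta> ^ (N - 1) * Y ^ Suc m" by simp
          finally show ?thesis .
        next
          case True
          define Q where "Q = (\<lambda>t. a \<le> t \<and> t < b \<and> \<not> closed_at B t)"
          define c' where "c' = (LEAST t. Q t)"
          have "\<exists>t. Q t" using True by (simp add: Q_def)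
          then have "Q c'" unfolding c'_def by (rule LeastI_ex)
          then have c': "a \<le> c'" "c' < b" "\<not> closed_at B c'" by (auto simp: Q_def)
          have clB: "closed_at B t" if "t \<in> {a..<c'}" for t
          proof (rule ccontr)
            assume "\<not> closed_at B t"
            then have "Q t" using that c'(2) by (simp add: Q_def)
            then have "c' \<le> t" unfolding c'_def by (rule Least_le)
            then show False using that by simp
          qed
          \<comment> \<open>The gap measured at time a is still open when the cut is first crossed,
            at time c'.\<close>
          have "Psi \<theta> (x (Suc c')) A \<le> Psi \<theta> (x c') A - (\<rho> * \<theta> - 1) * (T * (x a (e (Suc c)) - x a (e c)))"
            unfolding T_def
          proof (rule Psi_cut)
            show "closed_at A c'" using clA c' by simp
            have cl': "closed_at A t" if "t \<in> {a..<c'}" for t using clA that c'(2) by simp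
            have "Suc c < card A" using gap(1) by (simp add: N_def)
            note cb = cut_bounds[OF se this c'(1) cl' clB[unfolded B_def]]
            show "x c' i \<le> x a (e c)" if "i \<in> B" for i using cb(1) that unfolding B_def by blast
            show "x a (e (Suc c)) \<le> x c' j" if "j \<in> A - B" for j using cb(2) that unfolding B_def by blast
            have "0 < D / (2 * real m0)" using D0 nm by simp
            then show "x a (e c) < x a (e (Suc c))" using gap(3) by linarith
          qed (use BA Bne c' th0 in auto)
          moreover have "Psi \<theta> (x c') A \<le> Psi \<theta> (x a) A" using c' clA by (intro Psi_window th0) auto
          moreover have "(\<rho> * \<theta> - 1) * (T * (x a (e (Suc c)) - x a (e c))) \<ge> 1 / real n * (T * (D / (2 * real m0)))"
            unfolding th0(4) using gap(3) T1 by (intro mult_left_mono) auto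
          ultimately have drop: "Psi \<theta> (x (Suc c')) A \<le> Psi \<theta> (x a) A - 1 / real n * (T * (D / (2 * real m0)))"
            by linarith
          show ?thesis
            using combine[OF c'(1,2) T1 T2 PD drop part[OF _ clB] last[OF c'(1,2)] W1] c'(2) by simp
        qed
      qed
    qed
  qed
  then show ?case by (simp only: W_def Y_def N_def)
qed

lemma cnt_le_general:
  assumes rho: "\<rho> \<le> 1/2" and comp: "\<And>t. n_components n (E t) \<le> m" and nm: "0 < n" "0 < m"
    and x01: "\<And>i. i < n \<Longrightarrow> 0 \<le> x0 i \<and> x0 i \<le> 1" and eps: "0 < \<epsilon>" "1 \<le> ln (1 / \<epsilon>)"
  shows "real (cnt \<epsilon> {..<n} 0 b)
    \<le> exp 1 * (1 / \<rho>) ^ (n - 1) * (20 * exp 3 * (real m * real n) * (1 + ln (1 / \<epsilon>) / real m)) ^ m"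
proof -
  define l where "l = ln (1 / \<epsilon>)"
  define s where "s = real m / (l + real m)"
  define \<theta> where "\<theta> = (1 + 1 / real n) / \<rho>"
  have l1: "1 \<le> l" using eps by (simp only: l_def)
  have s: "0 < s" "s \<le> 1" using nm l1 by (auto simp: s_def)
  have s1: "1 / s = 1 + l / real m" using nm l1 by (simp add: s_def field_simps)
  have th: "2 \<le> \<theta>" "\<rho> * \<theta> = 1 + 1 / real n"
  proof -
    show "\<rho> * \<theta> = 1 + 1 / real n" unfolding \<theta>_def using rho_pos by simp
    have "2 * \<rho> \<le> 1 + 1 / real n" using rho by (simp add: add_increasing2)
    then show "2 \<le> \<theta>" unfolding \<theta>_def using rho_pos by (simp add: pos_le_divide_eq)
  qed
  have fin: "finite {..<n}" "{..<n} \<noteq> {}" using nm by auto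
  obtain e where e: "senum e (x 0) {..<n}" using senum_exists[OF fin(1)] by blast
  let ?B = "2 * Psi \<theta> (x 0) {..<n} / (\<theta> ^ (n - 1) * \<epsilon>)"
  have mem: "e (n - 1) < n" "e 0 < n" using senum_mem[OF e, of "n - 1"] senum_mem[OF e, of 0] nm by auto
  have D: "0 \<le> x 0 (e (n - 1)) - x 0 (e 0)" "x 0 (e (n - 1)) - x 0 (e 0) \<le> 1"
    using x01[OF mem(1)] x01[OF mem(2)] senum_mono[OF e, of 0 "n - 1"] nm by auto
  have up: "Psi \<theta> (x 0) {..<n} \<le> 2 * \<theta> ^ (n - 1)"
  proof -
    have "Psi \<theta> (x 0) {..<n} \<le> 2 * \<theta> ^ (n - 1) * (x 0 (e (n - 1)) - x 0 (e 0))"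
      using Psi_upper[OF e _ th(1)] nm by simp
    also have "\<dots> \<le> 2 * \<theta> ^ (n - 1) * 1" using D th by (intro mult_left_mono) auto
    finally show ?thesis by simp
  qed
  have low: "0 \<le> Psi \<theta> (x 0) {..<n}"
  proof -
    have "\<theta> ^ (n - 1) * (x 0 (e (n - 1)) - x 0 (e 0)) \<le> 2 * Psi \<theta> (x 0) {..<n}"
      using Psi_lower[OF e _ th(1)] nm by simp
    moreover have "0 \<le> \<theta> ^ (n - 1) * (x 0 (e (n - 1)) - x 0 (e 0))" using D th by simp
    ultimately show ?thesis by linarith
  qed
  have B: "0 \<le> ?B" "?B \<le> 1 / \<epsilon> ^ 3"
  proof -
    show "0 \<le> ?B" using low th eps by simp
    have "exp 1 \<le> exp (ln (1 / \<epsilon>))" using eps(2) by (simp only: exp_le_cancel_iff)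
    then have e2: "2 \<le> 1 / \<epsilon>" using eps(1) exp_ge_add_one_self[of 1] by simp
    have "?B \<le> 2 * (2 * \<theta> ^ (n - 1)) / (\<theta> ^ (n - 1) * \<epsilon>)"
      using up th eps by (intro divide_right_mono) auto
    also have "\<dots> = 2 * 2 * (1 / \<epsilon>)" using th eps by simp
    also have "\<dots> \<le> 1 / \<epsilon> * (1 / \<epsilon>) * (1 / \<epsilon>)" using e2 eps by (intro mult_mono) auto
    finally show "?B \<le> 1 / \<epsilon> ^ 3" by (simp add: power3_eq_cube)
  qed
  have "real (cnt \<epsilon> {..<n} 0 b) \<le> (2 * Psi \<theta> (x 0) {..<n} / (\<theta> ^ (card {..<n} - 1) * \<epsilon>)) powr s
      * \<theta> ^ (card {..<n} - 1) * (20 * real n * real m / s) ^ m"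
  proof (rule cnt_bound_general[OF eps(1) s th nm])
    show "closed_at {..<n} t \<and> card (comps {..<n} t) \<le> m" for t
      using comp[of t] by (simp add: n_components_eq closed_at_UNIV)
  qed (use nm in auto)
  also have "\<dots> = ?B powr s * \<theta> ^ (n - 1) * (20 * real n * real m / s) ^ m" by simp
  also have "\<dots> \<le> exp 3 ^ m * \<theta> ^ (n - 1) * (20 * real n * real m / s) ^ m"
  proof (intro mult_right_mono)
    show "?B powr s \<le> exp 3 ^ m"
      using powr_budget[OF eps nm(2) B] by (simp add: s_def l_def)
    show "0 \<le> (20 * real n * real m / s) ^ m" using s by (intro zero_le_power) simp
  qed (use th in simp)
  also have "\<dots> = \<theta> ^ (n - 1) * (20 * exp 3 * (real m * real n) * (1 / s)) ^ m"
    by (simp add: power_mult_distrib power_divide mult_ac)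
  also have "\<dots> \<le> (exp 1 * (1 / \<rho>) ^ (n - 1)) * (20 * exp 3 * (real m * real n) * (1 / s)) ^ m"
  proof (rule mult_right_mono)
    \<comment> \<open>The price for taking \<theta> above 1/\<rho> is a factor of at most e.\<close>
    have "(1 + 1 / real n) ^ (n - 1) \<le> exp (1 / real n) ^ (n - 1)"
      by (intro power_mono) (use exp_ge_add_one_self[of "1 / real n"] in auto)
    also have "\<dots> = exp (real (n - 1) * (1 / real n))" by (rule exp_of_nat_mult[symmetric])
    also have "\<dots> \<le> exp 1" using nm by (simp add: divide_le_eq)
    finally have "(1 + 1 / real n) ^ (n - 1) * (1 / \<rho>) ^ (n - 1) \<le> exp 1 * (1 / \<rho>) ^ (n - 1)"
      using rho_pos by (intro mult_right_mono) auto
    then show "\<theta> ^ (n - 1) \<le> exp 1 * (1 / \<rho>) ^ (n - 1)"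
      unfolding \<theta>_def by (simp add: power_mult_distrib[symmetric])
    show "0 \<le> (20 * exp 3 * (real m * real n) * (1 / s)) ^ m" using s by (intro zero_le_power) simp
  qed
  finally show ?thesis unfolding s1 l_def .
qed

end

section \<open>Random regular graphs\<close>

lemma finite_reg_graphs: "finite (reg_graphs n k)"
proof -
  have "reg_graphs n k \<subseteq> Pow ({0..<n} \<times> {0..<n})" by (auto simp: reg_graphs_def)
  then show ?thesis by (rule finite_subset) simp
qed

text \<open>A circulant graph: i and j are adjacent if their difference modulo n lies in a symmetric
  set D of size k. For odd k, n is even, and n/2, its own negative, supplies the odd
  element.\<close>

lemma reg_graphs_nonempty:
  assumes "k < n" "even (n * k)"
  shows "reg_graphs n k \<noteq> {}"
proof -
  define h where "h = k div 2"
  define D where "D = {1..h} \<union> {n - h..<n} \<union> (if odd k then {n div 2} else {})"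
  \<comment> \<open>\<open>j + (n - i)\<close> represents j - i modulo n without truncated
    subtraction.\<close>
  define E where "E = {(i, j). i < n \<and> j < n \<and> (j + (n - i)) mod n \<in> D}"
  have hn: "2 * h < n" using assms(1) by (simp add: h_def)
  have odd_k: "even n \<and> 2 * h + 2 \<le> n" if "odd k"
  proof -
    have "even n" using assms(2) that by simp
    moreover have "k = 2 * h + 1" using that by (simp add: h_def odd_two_times_div_two_succ)
    ultimately show ?thesis using assms(1) by presburger
  qed
  have cardD: "card D = k"
  proof (cases "odd k")
    case True
    have e: "even n" "2 * h + 2 \<le> n" using odd_k[OF True] by auto
    have "card ({1..h} \<union> {n - h..<n}) = h + h"
      using hn by (subst card_Un_disjoint) auto
    moreover have "n div 2 \<notin> {1..h} \<union> {n - h..<n}" using e by auto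
    ultimately have "card D = Suc (h + h)" unfolding D_def using True by simp
    then show ?thesis using True unfolding h_def by presburger
  next
    case False
    have "card ({1..h} \<union> {n - h..<n}) = h + h"
      using hn by (subst card_Un_disjoint) auto
    then have "card D = h + h" unfolding D_def using False by simp
    then show ?thesis using False unfolding h_def by presburger
  qed
  have D_range: "0 < \<delta> \<and> \<delta> < n" if "\<delta> \<in> D" for \<delta>
    using that hn odd_k unfolding D_def by (auto split: if_splits)
  have D_neg: "n - \<delta> \<in> D" if \<delta>: "\<delta> \<in> D" for \<delta>
  proof -
    consider "\<delta> \<in> {1..h}" | "\<delta> \<in> {n - h..<n}" | "odd k" "\<delta> = n div 2"
      using \<delta> unfolding D_def by (auto split: if_splits)
    then show ?thesis
    proof cases
      case 3
      then have "n - \<delta> = n div 2" using odd_k by auto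
      then show ?thesis using 3 unfolding D_def by auto
    qed (use hn in \<open>auto simp: D_def\<close>)
  qed
  have diff: "(j + (n - i)) mod n = (if i \<le> j then j - i else n - (i - j))" if "i < n" "j < n" for i j
  proof (cases "i \<le> j")
    case True
    have "j + (n - i) = n + (j - i)" using that True by simp
    then have "(j + (n - i)) mod n = (j - i) mod n" by (simp only: mod_add_self1)
    then show ?thesis using that True by simp
  next
    case False
    then have "j + (n - i) = n - (i - j)" "n - (i - j) < n" using that by auto
    then show ?thesis using False by simp
  qed
  have "E \<in> reg_graphs n k"
    unfolding reg_graphs_def
  proof (intro CollectI conjI allI impI)
    show "E \<subseteq> {0..<n} \<times> {0..<n}" by (auto simp: E_def)
    show "sym E"
    proof (rule symI)
      fix i j assume "(i, j) \<in> E"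
      then have ij: "i < n" "j < n" "(j + (n - i)) mod n \<in> D" by (auto simp: E_def)
      have "(i + (n - j)) mod n = n - (j + (n - i)) mod n"
      proof (cases "i = j")
        case True
        then show ?thesis using D_range[OF ij(3)] ij by auto
      next
        case False
        then show ?thesis unfolding diff[OF ij(1,2)] diff[OF ij(2,1)] using ij(1,2) by auto
      qed
      then show "(j, i) \<in> E" using D_neg[OF ij(3)] ij by (simp add: E_def)
    qed
    show "(i, i) \<notin> E" for i using D_range by (fastforce simp: E_def)
    fix i assume i: "i < n"
    have "bij_betw (\<lambda>j. (j + (n - i)) mod n) {j. (i, j) \<in> E} D"
    proof (rule bij_betwI[of _ _ _ "\<lambda>\<delta>. (i + \<delta>) mod n"])
      show "(\<lambda>j. (j + (n - i)) mod n) \<in> {j. (i, j) \<in> E} \<rightarrow> D" by (auto simp: E_def)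
      have inv: "((i + \<delta>) mod n + (n - i)) mod n = \<delta>" if "\<delta> < n" for \<delta>
      proof -
        have "((i + \<delta>) mod n + (n - i)) mod n = (i + \<delta> + (n - i)) mod n" by (simp add: mod_add_left_eq)
        also have "i + \<delta> + (n - i) = n + \<delta>" using i by simp
        finally show ?thesis using that by simp
      qed
      then show "(\<lambda>\<delta>. (i + \<delta>) mod n) \<in> D \<rightarrow> {j. (i, j) \<in> E}"
        using D_range i by (auto simp: E_def)
      show "((i + \<delta>) mod n + (n - i)) mod n = \<delta>" if "\<delta> \<in> D" for \<delta> using inv D_range[OF that] by simp
      show "(i + (j + (n - i)) mod n) mod n = j" if "j \<in> {j. (i, j) \<in> E}" for j
      proof -
        have "(i + (j + (n - i)) mod n) mod n = (i + (j + (n - i))) mod n" by (simp add: mod_add_right_eq)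
        also have "i + (j + (n - i)) = n + j" using i by simp
        finally show ?thesis using that by (simp add: E_def)
      qed
    qed
    then show "card {j. (i, j) \<in> E} = k" using bij_betw_same_card cardD by metis
  qed
  then show ?thesis by blast
qed

section \<open>Switchings that enlarge a cut\<close>

definition crossing :: "nat set \<Rightarrow> (nat \<times> nat) set \<Rightarrow> (nat \<times> nat) set" where
  "crossing S E = {(i, j) \<in> E. i \<in> S \<and> j \<notin> S}"

definition cut_graphs :: "nat \<Rightarrow> nat \<Rightarrow> nat set \<Rightarrow> nat \<Rightarrow> (nat \<times> nat) set set" where
  "cut_graphs n k S j = {E \<in> reg_graphs n k. card (crossing S E) = j}"

text \<open>Edges are taken with orientation. An edge a b inside S and an edge c d outside are to be
  replaced by the crossing edges a c and b d, which must be new.\<close>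

definition moves :: "nat set \<Rightarrow> (nat \<times> nat) set \<Rightarrow> ((nat \<times> nat) \<times> (nat \<times> nat)) set" where
  "moves S E = {((a, b), (c, d)). (a, b) \<in> E \<and> a \<in> S \<and> b \<in> S \<and> (c, d) \<in> E \<and> c \<notin> S \<and> d \<notin> S
     \<and> (a, c) \<notin> E \<and> (b, d) \<notin> E}"

definition old_edges :: "(nat \<times> nat) \<times> (nat \<times> nat) \<Rightarrow> (nat \<times> nat) set" where
  "old_edges p = (case p of ((a, b), (c, d)) \<Rightarrow> {(a, b), (b, a), (c, d), (d, c)})"

definition new_edges :: "(nat \<times> nat) \<times> (nat \<times> nat) \<Rightarrow> (nat \<times> nat) set" where
  "new_edges p = (case p of ((a, b), (c, d)) \<Rightarrow> {(a, c), (c, a), (b, d), (d, b)})"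

definition switch :: "(nat \<times> nat) \<times> (nat \<times> nat) \<Rightarrow> (nat \<times> nat) set \<Rightarrow> (nat \<times> nat) set" where
  "switch p E = (E - old_edges p) \<union> new_edges p"

lemma reg_graphD:
  assumes "E \<in> reg_graphs n k"
  shows "E \<subseteq> {0..<n} \<times> {0..<n}" "(i, j) \<in> E \<Longrightarrow> (j, i) \<in> E" "(i, i) \<notin> E"
    "i < n \<Longrightarrow> card {j. (i, j) \<in> E} = k" "finite E" "finite {j. (i, j) \<in> E}"
    "(i, j) \<in> E \<Longrightarrow> i < n \<and> j < n"
proof -
  show sub: "E \<subseteq> {0..<n} \<times> {0..<n}" using assms by (auto simp: reg_graphs_def)
  show "(i, j) \<in> E \<Longrightarrow> (j, i) \<in> E" using assms by (auto simp: reg_graphs_def dest: symD)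
  show "(i, i) \<notin> E" "i < n \<Longrightarrow> card {j. (i, j) \<in> E} = k" using assms by (auto simp: reg_graphs_def)
  show "finite E" using finite_subset[OF sub] by simp
  have "{j. (i, j) \<in> E} \<subseteq> {0..<n}" using sub by auto
  then show "finite {j. (i, j) \<in> E}" by (rule finite_subset) simp
  show "(i, j) \<in> E \<Longrightarrow> i < n \<and> j < n" using sub by auto
qed

text \<open>Each of the four vertices trades one neighbour for another, so the degrees survive, and
  both new edges cross.\<close>

lemma switch_reg:
  assumes E: "E \<in> reg_graphs n k" and p: "p \<in> moves S E"
  shows "switch p E \<in> reg_graphs n k" "card (crossing S (switch p E)) = card (crossing S E) + 2"
    "old_edges p \<subseteq> E" "new_edges p \<inter> E = {}"
proof -
  obtain a b c d where pp: "p = ((a, b), (c, d))" by (metis surj_pair)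
  have m: "(a, b) \<in> E" "a \<in> S" "b \<in> S" "(c, d) \<in> E" "c \<notin> S" "d \<notin> S" "(a, c) \<notin> E" "(b, d) \<notin> E"
    using p by (auto simp: moves_def pp)
  note R = reg_graphD[OF E]
  have rev: "(b, a) \<in> E" "(d, c) \<in> E" "(c, a) \<notin> E" "(d, b) \<notin> E" using m R(2) by blast+
  have ne: "a \<noteq> b" "c \<noteq> d" "a \<noteq> c" "a \<noteq> d" "b \<noteq> c" "b \<noteq> d" using m R(3) by auto
  have lt: "a < n" "b < n" "c < n" "d < n" using m R(7) by blast+
  show old: "old_edges p \<subseteq> E" using m rev by (auto simp: old_edges_def pp)
  show new: "new_edges p \<inter> E = {}" using m rev by (auto simp: new_edges_def pp)
  let ?E = "switch p E"
  have mem: "(i, j) \<in> ?E \<longleftrightarrow> ((i, j) \<in> E \<and> (i, j) \<notin> {(a, b), (b, a), (c, d), (d, c)}) \<or> (i, j) \<in> {(a, c), (c, a), (b, d), (d, b)}" for i j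
    by (auto simp: switch_def old_edges_def new_edges_def pp)
  have swap: "card (insert u (N - {v})) = k" if "card N = k" "v \<in> N" "u \<notin> N" "finite N" for u v :: nat and N
    using that by (simp add: card_Diff_singleton) (metis Suc_pred card_gt_0_iff empty_iff)
  show "?E \<in> reg_graphs n k"
    unfolding reg_graphs_def
  proof (intro CollectI conjI allI impI)
    show "?E \<subseteq> {0..<n} \<times> {0..<n}"
      using R(1) lt by (auto simp: switch_def new_edges_def pp)
    show "sym ?E"
    proof (rule symI)
      fix i j assume "(i, j) \<in> ?E"
      then show "(j, i) \<in> ?E" unfolding mem using R(2)[of i j] by auto
    qed
    show "(i, i) \<notin> ?E" for i unfolding mem using R(3) ne by auto
    fix i assume i: "i < n"
    consider "i = a" | "i = b" | "i = c" | "i = d" | "i \<notin> {a, b, c, d}" by blast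
    then show "card {j. (i, j) \<in> ?E} = k"
    proof cases
      case 1
      have "{j. (a, j) \<in> ?E} = insert c ({j. (a, j) \<in> E} - {b})" unfolding mem using ne by auto
      then show ?thesis using swap[of "{j. (a, j) \<in> E}" b c] R(4,6) lt m 1 by simp
    next
      case 2
      have "{j. (b, j) \<in> ?E} = insert d ({j. (b, j) \<in> E} - {a})" unfolding mem using ne by auto
      then show ?thesis using swap[of "{j. (b, j) \<in> E}" a d] R(4,6) lt m rev 2 by simp
    next
      case 3
      have "{j. (c, j) \<in> ?E} = insert a ({j. (c, j) \<in> E} - {d})" unfolding mem using ne by auto
      then show ?thesis using swap[of "{j. (c, j) \<in> E}" d a] R(4,6) lt m rev 3 by simp
    next
      case 4
      have "{j. (d, j) \<in> ?E} = insert b ({j. (d, j) \<in> E} - {c})" unfolding mem using ne by auto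
      then show ?thesis using swap[of "{j. (d, j) \<in> E}" c b] R(4,6) lt m rev 4 by simp
    next
      case 5
      have "{j. (i, j) \<in> ?E} = {j. (i, j) \<in> E}" unfolding mem using 5 by auto
      then show ?thesis using R(4) i by simp
    qed
  qed
  have "crossing S ?E = insert (a, c) (insert (b, d) (crossing S E))"
    unfolding crossing_def using mem m by auto
  moreover have "(b, d) \<notin> crossing S E" "(a, c) \<notin> insert (b, d) (crossing S E)"
    using m ne by (auto simp: crossing_def)
  moreover have "finite (crossing S E)"
    using R(5) by (rule rev_finite_subset) (auto simp: crossing_def)
  ultimately show "card (crossing S ?E) = card (crossing S E) + 2" by simp
qed

text \<open>Double counting. A switch can be undone from its result and the four vertices, and these
  form an ordered pair of crossing edges of the result, for which there are
  \<open>(j + 2)\<^sup>2\<close> possibilities.\<close>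

lemma switching_inequality:
  assumes F: "\<And>E. E \<in> cut_graphs n k S j \<Longrightarrow> F \<le> card (moves S E)"
  shows "card (cut_graphs n k S j) * F \<le> card (cut_graphs n k S (j + 2)) * (j + 2)\<^sup>2"
proof -
  let ?A = "cut_graphs n k S j" and ?B = "cut_graphs n k S (j + 2)"
  let ?T = "\<lambda>E. {((a, b), (c, d)). (a, c) \<in> crossing S E \<and> (b, d) \<in> crossing S E}"
  have finA: "finite ?A" "finite ?B" unfolding cut_graphs_def using finite_reg_graphs by auto
  have finc: "finite (crossing S E)" if "E \<in> reg_graphs n k" for E
    using reg_graphD(5)[OF that] by (rule rev_finite_subset) (auto simp: crossing_def)
  have T: "?T E = (\<lambda>((a, c), (b, d)). ((a, b), (c, d))) ` (crossing S E \<times> crossing S E)" for E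
    by (force simp: image_iff)
  have finT: "finite (?T E)" if "E \<in> ?B" for E
    unfolding T using finc that by (simp add: cut_graphs_def)
  have cardT: "card (?T E) \<le> (j + 2)\<^sup>2" if E: "E \<in> ?B" for E
  proof -
    have "card (?T E) \<le> card (crossing S E \<times> crossing S E)"
      unfolding T using finc E by (intro card_image_le) (simp add: cut_graphs_def)
    also have "\<dots> = (j + 2)\<^sup>2" using E by (simp add: cut_graphs_def card_cartesian_product power2_eq_square)
    finally show ?thesis .
  qed
  have finM: "finite (moves S E)" if "E \<in> ?A" for E
  proof (rule finite_subset)
    show "moves S E \<subseteq> E \<times> E" by (auto simp: moves_def)
    show "finite (E \<times> E)" using reg_graphD(5)[of E n k] that by (simp add: cut_graphs_def)
  qed
  have "card ?A * F = (\<Sum>E\<in>?A. F)" by simp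
  also have "\<dots> \<le> (\<Sum>E\<in>?A. card (moves S E))" using F by (rule sum_mono)
  also have "\<dots> = card (Sigma ?A (moves S))" using finA finM by simp
  also have "\<dots> \<le> card (Sigma ?B ?T)"
  proof (rule card_inj_on_le)
    let ?f = "\<lambda>(E, p). (switch p E, p)"
    show "inj_on ?f (Sigma ?A (moves S))"
    proof (rule inj_onI, clarsimp)
      fix E E' a b c d
      assume E: "E \<in> ?A" "((a, b), c, d) \<in> moves S E" and E': "E' \<in> ?A" "((a, b), c, d) \<in> moves S E'"
        and eq: "switch ((a, b), c, d) E = switch ((a, b), c, d) E'"
      have r: "E = (switch p E - new_edges p) \<union> old_edges p" if "E \<in> ?A" "p \<in> moves S E" for E p
        using switch_reg(3,4)[of E n k p S] that unfolding cut_graphs_def switch_def by blast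
      show "E = E'" using r[OF E] r[OF E'] eq by simp
    qed
    show "?f ` Sigma ?A (moves S) \<subseteq> Sigma ?B ?T"
    proof (rule image_subsetI)
      fix z assume z: "z \<in> Sigma ?A (moves S)"
      obtain E a b c d where zz: "z = (E, ((a, b), (c, d)))" by (metis surj_pair)
      have E: "E \<in> ?A" "((a, b), (c, d)) \<in> moves S E" using z zz by auto
      have "switch ((a, b), (c, d)) E \<in> ?B"
        using switch_reg(1,2)[of E n k _ S] E by (simp add: cut_graphs_def)
      moreover have "(a, c) \<in> crossing S (switch ((a, b), (c, d)) E)" "(b, d) \<in> crossing S (switch ((a, b), (c, d)) E)"
        using E(2) by (auto simp: crossing_def switch_def new_edges_def moves_def)
      ultimately show "?f z \<in> Sigma ?B ?T" by (simp add: zz)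
    qed
    show "finite (Sigma ?B ?T)" using finA finT by auto
  qed
  also have "\<dots> = (\<Sum>E\<in>?B. card (?T E))" using finA finT by simp
  also have "\<dots> \<le> (\<Sum>E\<in>?B. (j + 2)\<^sup>2)" using cardT by (rule sum_mono)
  also have "\<dots> = card ?B * (j + 2)\<^sup>2" by simp
  finally show ?thesis .
qed

lemma card_out_edges:
  assumes "E \<in> reg_graphs n k" "S \<subseteq> {0..<n}"
  shows "card {(i, j) \<in> E. i \<in> S} = k * card S"
proof -
  note R = reg_graphD[OF assms(1)]
  have fin: "finite S" using assms(2) finite_subset by blast
  have "{(i, j) \<in> E. i \<in> S} = Sigma S (\<lambda>i. {j. (i, j) \<in> E})" by auto
  then have "card {(i, j) \<in> E. i \<in> S} = (\<Sum>i\<in>S. card {j. (i, j) \<in> E})"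
    using fin R(6) by simp
  also have "\<dots> = (\<Sum>i\<in>S. k)" using R(4) assms(2) by (intro sum.cong) auto
  finally show ?thesis by simp
qed

text \<open>Inside S there are k * card S - j oriented edges, outside k * (n - card S) - j. A pair
  of them fails if a c or b d is already an edge; that edge crosses, and the other two vertices are
  neighbours of its ends, so each kind of failure occurs at most \<open>j * k\<^sup>2\<close>
  times.\<close>

lemma card_moves_ge:
  assumes E: "E \<in> reg_graphs n k" and S: "S \<subseteq> {0..<n}" and j: "card (crossing S E) = j"
  shows "(real k * real (card S) - real j) * (real k * (real n - real (card S)) - real j) - 2 * real j * (real k)\<^sup>2
    \<le> real (card (moves S E))"
proof -
  note R = reg_graphD[OF E]
  define I where "I = {(a, b) \<in> E. a \<in> S \<and> b \<in> S}"
  define O' where "O' = {(c, d) \<in> E. c \<notin> S \<and> d \<notin> S}"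
  define C where "C = crossing S E"
  have fin: "finite I" "finite O'" "finite C" "finite S"
    using finite_subset[OF _ R(5), of I] finite_subset[OF _ R(5), of O'] finite_subset[OF _ R(5), of C] finite_subset[OF S]
    by (auto simp: I_def O'_def C_def crossing_def)
  have cI: "card I + j = k * card S"
  proof -
    have "{(i, j) \<in> E. i \<in> S} = I \<union> C" by (auto simp: I_def C_def crossing_def)
    moreover have "I \<inter> C = {}" by (auto simp: I_def C_def crossing_def)
    ultimately show ?thesis using card_out_edges[OF E S] card_Un_disjoint[OF fin(1,3)] j by (simp add: C_def)
  qed
  have cO: "card O' + j = k * (n - card S)"
  proof -
    let ?T = "{0..<n} - S"
    have "{(i, j) \<in> E. i \<in> ?T} = O' \<union> C\<inverse>"
      using R(2,7) by (auto simp: O'_def C_def crossing_def)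
    moreover have "O' \<inter> C\<inverse> = {}" by (auto simp: O'_def C_def crossing_def)
    moreover have "card (C\<inverse>) = j" using j by (simp add: C_def card_inverse)
    ultimately have "card O' + j = k * card ?T"
      using card_out_edges[OF E, of ?T] card_Un_disjoint[of O' "C\<inverse>"] fin by simp
    then show ?thesis using card_Diff_subset[OF fin(4) S] by simp
  qed
  define B1 where "B1 = {((a, b), (c, d)). (a, b) \<in> I \<and> (c, d) \<in> O' \<and> (a, c) \<in> C}"
  define B2 where "B2 = {((a, b), (c, d)). (a, b) \<in> I \<and> (c, d) \<in> O' \<and> (b, d) \<in> C}"
  let ?N = "\<lambda>i. {j. (i, j) \<in> E}"
  have sig: "card (Sigma C (\<lambda>(a, c). ?N a \<times> ?N c)) = j * k\<^sup>2" "finite (Sigma C (\<lambda>(a, c). ?N a \<times> ?N c))"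
  proof -
    show "finite (Sigma C (\<lambda>(a, c). ?N a \<times> ?N c))" using fin R(6) by auto
    have "card (Sigma C (\<lambda>(a, c). ?N a \<times> ?N c)) = (\<Sum>p\<in>C. card ((\<lambda>(a, c). ?N a \<times> ?N c) p))"
      using fin R(6) by (intro card_SigmaI) auto
    also have "\<dots> = (\<Sum>p\<in>C. k\<^sup>2)"
    proof (rule sum.cong[OF refl])
      fix p assume "p \<in> C"
      then obtain a c where "p = (a, c)" "(a, c) \<in> E" by (auto simp: C_def crossing_def)
      then show "card ((\<lambda>(a, c). ?N a \<times> ?N c) p) = k\<^sup>2"
        using R(4,7) by (simp add: card_cartesian_product power2_eq_square)
    qed
    finally show "card (Sigma C (\<lambda>(a, c). ?N a \<times> ?N c)) = j * k\<^sup>2" using j by (simp add: C_def)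
  qed
  have b1: "card B1 \<le> j * k\<^sup>2"
  proof -
    have "B1 \<subseteq> (\<lambda>((a, c), (b, d)). ((a, b), (c, d))) ` Sigma C (\<lambda>(a, c). ?N a \<times> ?N c)"
    proof
      fix p assume p: "p \<in> B1"
      obtain a b c d where pp: "p = ((a, b), (c, d))" by (metis surj_pair)
      have "((a, c), (b, d)) \<in> Sigma C (\<lambda>(a, c). ?N a \<times> ?N c)"
        using p by (auto simp: pp B1_def I_def O'_def)
      then show "p \<in> (\<lambda>((a, c), (b, d)). ((a, b), (c, d))) ` Sigma C (\<lambda>(a, c). ?N a \<times> ?N c)"
        by (rule rev_image_eqI) (simp add: pp)
    qed
    then have "card B1 \<le> card ((\<lambda>((a, c), (b, d)). ((a, b), (c, d))) ` Sigma C (\<lambda>(a, c). ?N a \<times> ?N c))"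
      using sig(2) by (intro card_mono finite_imageI)
    also have "\<dots> \<le> j * k\<^sup>2" using card_image_le[OF sig(2)] sig(1) by simp
    finally show ?thesis .
  qed
  have b2: "card B2 \<le> j * k\<^sup>2"
  proof -
    have "B2 \<subseteq> (\<lambda>((b, d), (a, c)). ((a, b), (c, d))) ` Sigma C (\<lambda>(a, c). ?N a \<times> ?N c)"
    proof
      fix p assume p: "p \<in> B2"
      obtain a b c d where pp: "p = ((a, b), (c, d))" by (metis surj_pair)
      have "((b, d), (a, c)) \<in> Sigma C (\<lambda>(a, c). ?N a \<times> ?N c)"
        using p R(2)[of a b] R(2)[of c d] by (auto simp: pp B2_def I_def O'_def)
      then show "p \<in> (\<lambda>((b, d), (a, c)). ((a, b), (c, d))) ` Sigma C (\<lambda>(a, c). ?N a \<times> ?N c)"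
        by (rule rev_image_eqI) (simp add: pp)
    qed
    then have "card B2 \<le> card ((\<lambda>((b, d), (a, c)). ((a, b), (c, d))) ` Sigma C (\<lambda>(a, c). ?N a \<times> ?N c))"
      using sig(2) by (intro card_mono finite_imageI)
    also have "\<dots> \<le> j * k\<^sup>2" using card_image_le[OF sig(2)] sig(1) by simp
    finally show ?thesis .
  qed
  have finM: "finite (moves S E)"
    by (rule finite_subset[of _ "E \<times> E"]) (use R(5) in \<open>auto simp: moves_def\<close>)
  have finB: "finite B1" "finite B2"
    using finite_subset[of B1 "I \<times> O'"] finite_subset[of B2 "I \<times> O'"] fin by (auto simp: B1_def B2_def)
  have "I \<times> O' \<subseteq> moves S E \<union> B1 \<union> B2"
    by (auto simp: I_def O'_def moves_def B1_def B2_def C_def crossing_def)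
  then have "card (I \<times> O') \<le> card (moves S E \<union> B1 \<union> B2)" using finM finB by (intro card_mono) auto
  also have "\<dots> \<le> card (moves S E) + card B1 + card B2"
    using card_Un_le[of "moves S E \<union> B1" B2] card_Un_le[of "moves S E" B1] by linarith
  also have "\<dots> \<le> card (moves S E) + 2 * (j * k\<^sup>2)" using b1 b2 by linarith
  finally have le: "card I * card O' \<le> card (moves S E) + 2 * (j * k\<^sup>2)" by (simp add: card_cartesian_product)
  have "real (card I) = real k * real (card S) - real j"
    using arg_cong[OF cI, of real] by simp
  moreover have "card S \<le> n" using card_mono[OF _ S] by simp
  then have "real (card O') = real k * (real n - real (card S)) - real j"
    using arg_cong[OF cO, of real] by (simp add: of_nat_diff)
  moreover have "real (card I) * real (card O') \<le> real (card (moves S E)) + 2 * (real j * (real k)\<^sup>2)"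
    using le by (metis (no_types, lifting) of_nat_add of_nat_le_iff of_nat_mult of_nat_numeral of_nat_power)
  ultimately show ?thesis by simp
qed


text \<open>At least 3 * card S * n switches lead out of a graph, while j + 2 \<le> 3/4 * card S
  bounds the ways back. Degree at least 3 leaves enough switches after the blocked ones are
  subtracted.\<close>

lemma cut_graphs_ratio:
  assumes S: "S \<subseteq> {0..<n}" "4 \<le> card S" "2 * card S \<le> n" and k: "3 \<le> k" and j: "4 * j \<le> card S"
  shows "real (card (cut_graphs n k S j)) \<le> real (card S) / (4 * real n) * real (card (cut_graphs n k S (j + 2)))"
proof -
  define s where "s = real (card S)"
  define N where "N = real n - s"
  define \<kappa> where "\<kappa> = real k"
  define J where "J = real j"
  have s4: "4 \<le> s" and sN: "s \<le> N" and k3: "3 \<le> \<kappa>" and J: "0 \<le> J" "4 * J \<le> s"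
    using S k j by (auto simp: s_def N_def \<kappa>_def J_def)
  have ks: "3 * s \<le> \<kappa> * s" "3 * N \<le> \<kappa> * N" using k3 s4 sN by (auto intro: mult_right_mono)
  \<comment> \<open>J \<le> s/4 \<le> \<kappa> * s / 12, and likewise with N for s, hence the
    factors 11/12.\<close>
  have "11 / 12 * (\<kappa> * s) * (11 / 12 * (\<kappa> * N)) \<le> (\<kappa> * s - J) * (\<kappa> * N - J)"
  proof (rule mult_mono)
    show "11 / 12 * (\<kappa> * s) \<le> \<kappa> * s - J" "11 / 12 * (\<kappa> * N) \<le> \<kappa> * N - J" "0 \<le> \<kappa> * s - J"
      using ks J s4 sN by linarith+
    show "0 \<le> 11 / 12 * (\<kappa> * N)" using k3 s4 sN by simp
  qed
  moreover have "2 * J * \<kappa>\<^sup>2 \<le> \<kappa>\<^sup>2 * (s * N) / 8"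
  proof -
    have "2 * J \<le> s * N / 8" using J s4 sN mult_left_mono[of 4 N s] by linarith
    then have "2 * J * \<kappa>\<^sup>2 \<le> s * N / 8 * \<kappa>\<^sup>2" by (rule mult_right_mono) simp
    then show ?thesis by (simp add: mult_ac)
  qed
  moreover have "11 / 12 * (\<kappa> * s) * (11 / 12 * (\<kappa> * N)) = 121 / 144 * (\<kappa>\<^sup>2 * (s * N))"
    by (simp add: power2_eq_square)
  ultimately have "103 / 144 * (\<kappa>\<^sup>2 * (s * N)) \<le> (\<kappa> * s - J) * (\<kappa> * N - J) - 2 * J * \<kappa>\<^sup>2" by linarith
  moreover have "9 * (s * N) \<le> \<kappa>\<^sup>2 * (s * N)"
    using power_mono[OF k3, of 2] s4 sN by (intro mult_right_mono) auto
  moreover have "s * s \<le> s * N" using s4 sN by (intro mult_left_mono) auto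
  moreover have "0 \<le> s * N" using s4 sN by simp
  ultimately have main: "3 * s * (N + s) \<le> (\<kappa> * s - J) * (\<kappa> * N - J) - 2 * J * \<kappa>\<^sup>2"
    by (simp add: distrib_left)
  have "3 * card S * n \<le> card (moves S E)" if "E \<in> cut_graphs n k S j" for E
  proof -
    have "3 * s * (N + s) \<le> real (card (moves S E))"
      using card_moves_ge[OF _ S(1), of E k j] that main
      unfolding cut_graphs_def s_def N_def \<kappa>_def J_def by simp
    then have "real (3 * card S * n) \<le> real (card (moves S E))" by (simp add: s_def N_def)
    then show ?thesis by (simp only: of_nat_le_iff)
  qed
  then have "card (cut_graphs n k S j) * (3 * card S * n) \<le> card (cut_graphs n k S (j + 2)) * (j + 2)\<^sup>2"
    by (rule switching_inequality)
  then have "real (card (cut_graphs n k S j)) * (3 * s * real n) \<le> real (card (cut_graphs n k S (j + 2))) * (J + 2)\<^sup>2"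
    unfolding s_def J_def
    by (metis (mono_tags, lifting) of_nat_add of_nat_le_iff of_nat_mult of_nat_numeral of_nat_power)
  also have "\<dots> \<le> real (card (cut_graphs n k S (j + 2))) * (3 / 4 * s\<^sup>2)"
  proof (rule mult_left_mono)
    have "(J + 2)\<^sup>2 \<le> (3 / 4 * s)\<^sup>2" using J s4 by (intro power_mono) auto
    also have "\<dots> = 9 / 16 * s\<^sup>2" by (simp add: power2_eq_square)
    also have "\<dots> \<le> 3 / 4 * s\<^sup>2" by (intro mult_right_mono) auto
    finally show "(J + 2)\<^sup>2 \<le> 3 / 4 * s\<^sup>2" .
  qed simp
  finally have "3 * s * (real (card (cut_graphs n k S j)) * (4 * real n)) \<le> 3 * s * (s * real (card (cut_graphs n k S (j + 2))))"
    by (simp add: power2_eq_square mult_ac)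
  then have "real (card (cut_graphs n k S j)) * (4 * real n) \<le> s * real (card (cut_graphs n k S (j + 2)))"
    using s4 by (simp add: mult_ac)
  moreover have "0 < real n" using S by simp
  ultimately show ?thesis by (simp add: s_def field_simps)
qed

lemma cut_graphs_chain:
  assumes S: "S \<subseteq> {0..<n}" "4 \<le> card S" "2 * card S \<le> n" and k: "3 \<le> k"
    and j: "\<And>i. i < q \<Longrightarrow> 4 * (j + 2 * i) \<le> card S"
  shows "real (card (cut_graphs n k S j)) \<le> (real (card S) / (4 * real n)) ^ q * real (card (cut_graphs n k S (j + 2 * q)))"
  using j
proof (induction q)
  case (Suc q)
  let ?r = "real (card S) / (4 * real n)"
  have "real (card (cut_graphs n k S j)) \<le> ?r ^ q * real (card (cut_graphs n k S (j + 2 * q)))"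
    using Suc by simp
  also have "\<dots> \<le> ?r ^ q * (?r * real (card (cut_graphs n k S (j + 2 * q + 2))))"
    using cut_graphs_ratio[OF S k, of "j + 2 * q"] Suc.prems[of q] by (intro mult_left_mono) auto
  finally show ?case by (simp add: mult_ac)
qed simp

definition bad_graphs :: "nat \<Rightarrow> nat \<Rightarrow> nat set \<Rightarrow> (nat \<times> nat) set set" where
  "bad_graphs n k S = {E \<in> reg_graphs n k. 8 * card (crossing S E) < card S}"

text \<open>Starting from j < card S / 8, the ratio bound applies card S div 16 + 1 times while the
  cut size stays at most card S / 4. Different j end in disjoint classes of graphs, so all of them
  together still fit into \<open>reg_graphs\<close>.\<close>

lemma card_bad_graphs:
  assumes S: "S \<subseteq> {0..<n}" "4 \<le> card S" "2 * card S \<le> n" and k: "3 \<le> k"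
  shows "real (card (bad_graphs n k S))
    \<le> (real (card S) / (4 * real n)) ^ (card S div 16 + 1) * real (card (reg_graphs n k))"
proof -
  define q where "q = card S div 16 + 1"
  define J where "J = {j. 8 * j < card S}"
  let ?r = "real (card S) / (4 * real n)" and ?A = "cut_graphs n k S"
  have finJ: "finite J" by (rule finite_subset[of _ "{..card S}"]) (auto simp: J_def)
  have finA: "finite (?A j)" for j unfolding cut_graphs_def using finite_reg_graphs by auto
  have disj: "?A i \<inter> ?A j = {}" if "i \<noteq> j" for i j using that by (auto simp: cut_graphs_def)
  have "bad_graphs n k S = (\<Union>j\<in>J. ?A j)" by (auto simp: bad_graphs_def cut_graphs_def J_def)
  then have "card (bad_graphs n k S) = (\<Sum>j\<in>J. card (?A j))"
    using finJ finA disj by (simp add: card_UN_disjoint)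
  then have "real (card (bad_graphs n k S)) = (\<Sum>j\<in>J. real (card (?A j)))" by simp
  also have "\<dots> \<le> (\<Sum>j\<in>J. ?r ^ q * real (card (?A (j + 2 * q))))"
  proof (rule sum_mono)
    fix j assume j: "j \<in> J"
    show "real (card (?A j)) \<le> ?r ^ q * real (card (?A (j + 2 * q)))"
    proof (rule cut_graphs_chain[OF S k])
      fix i assume "i < q"
      then have "i \<le> card S div 16" by (simp add: q_def)
      then show "4 * (j + 2 * i) \<le> card S" using j by (simp add: J_def)
    qed
  qed
  also have "\<dots> = ?r ^ q * real (\<Sum>j\<in>J. card (?A (j + 2 * q)))" by (simp add: sum_distrib_left)
  also have "\<dots> \<le> ?r ^ q * real (card (reg_graphs n k))"
  proof (intro mult_left_mono, unfold of_nat_le_iff)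
    have "(\<Sum>j\<in>J. card (?A (j + 2 * q))) = card (\<Union>j\<in>J. ?A (j + 2 * q))"
      using finJ finA disj by (subst card_UN_disjoint) auto
    also have "\<dots> \<le> card (reg_graphs n k)"
      by (rule card_mono[OF finite_reg_graphs]) (auto simp: cut_graphs_def)
    finally show "(\<Sum>j\<in>J. card (?A (j + 2 * q))) \<le> card (reg_graphs n k)" .
  qed simp
  finally show ?thesis by (simp add: q_def)
qed

text \<open>A vertex of a set of size at most 3 has at most two neighbours inside but degree at
  least 3, so it has a crossing edge.\<close>

lemma bad_graphs_small:
  assumes S: "S \<subseteq> {0..<n}" "S \<noteq> {}" "card S \<le> 3" and k: "3 \<le> k"
  shows "bad_graphs n k S = {}"
proof -
  have fin: "finite S" using S(1) finite_subset by blast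
  have False if E: "E \<in> bad_graphs n k S" for E
  proof -
    have G: "E \<in> reg_graphs n k" and c: "8 * card (crossing S E) < card S" using E by (auto simp: bad_graphs_def)
    define I where "I = {(a, b) \<in> E. a \<in> S \<and> b \<in> S}"
    have "I \<subseteq> Sigma S (\<lambda>a. S - {a})" using reg_graphD(3)[OF G] by (auto simp: I_def)
    then have "card I \<le> card (Sigma S (\<lambda>a. S - {a}))" using fin by (intro card_mono) auto
    also have "\<dots> = (\<Sum>a\<in>S. card (S - {a}))" using fin by simp
    also have "\<dots> = card S * (card S - 1)" using fin by simp
    also have "\<dots> \<le> card S * 2" using S(3) by (intro mult_left_mono) auto
    finally have "card I \<le> card S * 2" .
    moreover have "{(i, j) \<in> E. i \<in> S} = I \<union> crossing S E" by (auto simp: I_def crossing_def)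
    then have "k * card S \<le> card I + card (crossing S E)"
      using card_out_edges[OF G S(1)] card_Un_le[of I "crossing S E"] by simp
    moreover have "3 * card S \<le> k * card S" using k by (rule mult_right_mono) simp
    moreover have "0 < card S" using fin S(2) by (simp add: card_gt_0_iff)
    ultimately show False using c by linarith
  qed
  then show ?thesis by blast
qed

section \<open>Union bound over all vertex sets\<close>

lemma power_self_le: "real s ^ s \<le> 3 ^ s * fact s"
proof -
  have "(\<Sum>k\<in>{s}. real s ^ k /\<^sub>R fact k) \<le> (\<Sum>k. real s ^ k /\<^sub>R fact k)"
    by (rule sum_le_suminf[OF summable_exp_generic]) auto
  then have "real s ^ s / fact s \<le> exp (real s)" by (simp add: exp_def divide_inverse mult.commute)
  also have "\<dots> = exp 1 ^ s" by (simp flip: exp_of_nat_mult)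
  also have "\<dots> \<le> 3 ^ s" using exp_le by (intro power_mono) auto
  finally show ?thesis by (simp add: field_simps)
qed

text \<open>By \<open>power_self_le\<close>, one factor (s/n)^s turns the binomial coefficient into
  at most 3^s; the other is at most 2^(-s), and the 4 contributes 16^(-s). Altogether
  (3/32)^s.\<close>

lemma binomial_decay:
  assumes "0 < s" "2 * s \<le> n"
  shows "real (n choose s) * (real s / (4 * real n)) ^ (2 * s) \<le> (1 / 8) ^ s"
proof -
  have n0: "0 < real n" using assms by simp
  have "real (n choose s) * real s ^ s \<le> 3 ^ s * (real (n choose s) * fact s)"
    using mult_left_mono[OF power_self_le[of s], of "real (n choose s)"] by (simp add: mult_ac)
  also have "\<dots> \<le> 3 ^ s * real n ^ s"
  proof (rule mult_left_mono)
    have "real ((n choose s) * fact s) \<le> real (n ^ s)"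
      using binomial_fact_pow[of n s] by (simp only: of_nat_le_iff)
    then show "real (n choose s) * fact s \<le> real n ^ s" by simp
  qed simp
  finally have 1: "real (n choose s) * (real s / real n) ^ s \<le> 3 ^ s"
    using n0 by (simp add: power_divide field_simps)
  have "real s / real n \<le> 1 / 2" using assms n0 by (simp add: field_simps)
  then have 2: "(real s / real n) ^ s \<le> (1 / 2) ^ s" by (intro power_mono) auto
  have "real (n choose s) * (real s / (4 * real n)) ^ (2 * s)
      = (real (n choose s) * (real s / real n) ^ s) * (real s / real n) ^ s * (1 / 16) ^ s"
  proof -
    have "real s / (4 * real n) = real s / real n * (1 / 4)" by simp
    then have "(real s / (4 * real n)) ^ (2 * s) = (real s / real n) ^ (2 * s) * (1 / 4) ^ (2 * s)"
      by (simp only: power_mult_distrib)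
    also have "(1 / 4 :: real) ^ (2 * s) = (1 / 16) ^ s" by (simp add: power_mult power2_eq_square)
    also have "(real s / real n) ^ (2 * s) = (real s / real n) ^ s * (real s / real n) ^ s"
      by (simp only: power_add[symmetric] mult_2)
    finally show ?thesis by simp
  qed
  also have "\<dots> \<le> 3 ^ s * (1 / 2) ^ s * (1 / 16) ^ s"
    using 1 2 by (intro mult_right_mono mult_mono) auto
  also have "\<dots> = (3 / 32) ^ s" by (simp flip: power_mult_distrib)
  also have "\<dots> \<le> (1 / 8) ^ s" by (intro power_mono) auto
  finally show ?thesis .
qed

text \<open>The power 32 is 2 * 16: it lifts the exponent card S div 16 + 1 of a single graph to at
  least 2 * card S, as \<open>binomial_decay\<close> requires. Sets of size at most 3 contribute
  nothing.\<close>

lemma bad_graphs_union_bound: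
  assumes k: "3 \<le> k"
  shows "(\<Sum>S\<in>{S. S \<subseteq> {0..<n} \<and> S \<noteq> {} \<and> 2 * card S \<le> n}.
      (real (card (bad_graphs n k S)) / real (card (reg_graphs n k))) ^ 32) \<le> 1 / 2"
proof -
  let ?F = "{S. S \<subseteq> {0..<n} \<and> S \<noteq> {} \<and> 2 * card S \<le> n}"
  let ?p = "\<lambda>S. real (card (bad_graphs n k S)) / real (card (reg_graphs n k))"
  let ?g = "\<lambda>s. (real s / (4 * real n)) ^ (2 * s)"
  have finF: "finite ?F" by (rule finite_subset[of _ "Pow {0..<n}"]) auto
  have cpos: "0 < card S" if "S \<in> ?F" for S
    using that finite_subset[of S "{0..<n}"] by (simp add: card_gt_0_iff)
  have "?p S ^ 32 \<le> ?g (card S)" if S: "S \<in> ?F" for S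
  proof (cases "card S \<le> 3")
    case True
    then have "bad_graphs n k S = {}" using bad_graphs_small[of S n k] S k by blast
    then show ?thesis by simp
  next
    case False
    let ?r = "real (card S) / (4 * real n)"
    have n0: "0 < real n" using S cpos[OF S] by auto
    have r1: "0 \<le> ?r" "?r \<le> 1" using S n0 by (auto simp: divide_le_eq)
    have "?p S \<le> ?r ^ (card S div 16 + 1)"
    proof (cases "card (reg_graphs n k) = 0")
      case False
      then show ?thesis using card_bad_graphs[of S n k] S k \<open>\<not> card S \<le> 3\<close> by (simp add: divide_le_eq)
    next
      case True
      then show ?thesis using r1 by simp
    qed
    then have "?p S ^ 32 \<le> (?r ^ (card S div 16 + 1)) ^ 32" by (intro power_mono) auto
    also have "\<dots> = ?r ^ ((card S div 16 + 1) * 32)" by (rule power_mult[symmetric])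
    also have "\<dots> \<le> ?r ^ (2 * card S)" using r1 by (intro power_decreasing) auto
    finally show ?thesis .
  qed
  then have "(\<Sum>S\<in>?F. ?p S ^ 32) \<le> (\<Sum>S\<in>?F. ?g (card S))" by (rule sum_mono)
  also have "\<dots> = (\<Sum>s\<in>{1..n div 2}. \<Sum>S\<in>{S \<in> ?F. card S = s}. ?g (card S))"
  proof (rule sum.group[symmetric])
    show "card ` ?F \<subseteq> {1..n div 2}"
    proof (rule image_subsetI)
      fix S assume S: "S \<in> ?F"
      then show "card S \<in> {1..n div 2}" using cpos[OF S] by auto
    qed
  qed (use finF in auto)
  also have "\<dots> \<le> (\<Sum>s\<in>{1..n div 2}. (1 / 8) ^ s)"
  proof (rule sum_mono)
    fix s assume s: "s \<in> {1..n div 2}"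
    have "card {S \<in> ?F. card S = s} \<le> card {S. S \<subseteq> {0..<n} \<and> card S = s}"
      by (intro card_mono) auto
    also have "\<dots> = n choose s" using n_subsets[of "{0..<n}" s] by simp
    finally have c: "card {S \<in> ?F. card S = s} \<le> n choose s" .
    have "(\<Sum>S\<in>{S \<in> ?F. card S = s}. ?g (card S)) = real (card {S \<in> ?F. card S = s}) * ?g s" by simp
    also have "\<dots> \<le> real (n choose s) * ?g s" using c by (intro mult_right_mono) auto
    also have "\<dots> \<le> (1 / 8) ^ s" using s by (intro binomial_decay) auto
    finally show "(\<Sum>S\<in>{S \<in> ?F. card S = s}. ?g (card S)) \<le> (1 / 8) ^ s" .
  qed
  also have "\<dots> \<le> 1 / 2"
  proof -
    have "(\<Sum>s\<in>{1..M}. (1 / 8 :: real) ^ s) \<le> 1 / 2 - (1 / 8) ^ M / 2" for M :: nat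
    proof (induction M)
      case (Suc M)
      have "0 \<le> (1 / 8 :: real) ^ M" by simp
      moreover have "(\<Sum>s\<in>{1..Suc M}. (1 / 8 :: real) ^ s) = (\<Sum>s\<in>{1..M}. (1 / 8) ^ s) + (1 / 8) ^ M / 8" by simp
      moreover have "(1 / 8 :: real) ^ Suc M = (1 / 8) ^ M / 8" by simp
      ultimately show ?case using Suc by linarith
    qed simp
    from this[of "n div 2"] show ?thesis by (rule order_trans) simp
  qed
  finally show ?thesis .
qed

section \<open>Blocks of random graphs\<close>

lemma Jensen_square:
  fixes p f :: "'a \<Rightarrow> real"
  assumes "\<And>j. j \<in> A \<Longrightarrow> 0 \<le> p j" "(\<Sum>j\<in>A. p j) = 1"
  shows "(\<Sum>j\<in>A. p j * f j)\<^sup>2 \<le> (\<Sum>j\<in>A. p j * (f j)\<^sup>2)"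
proof -
  have "0 \<le> wvar p A f" using assms by (subst wvar_eq) (auto intro!: sum_nonneg)
  then show ?thesis using assms(2) by (simp add: wvar_def)
qed

context reversible begin

text \<open>The constant is \<open>262208 = 32 \<cdot> 8194\<close>: the degree of the union of 32 graphs is \<open>32 d\<close>, and replacing
  the current opinions by those at the start of the block costs a factor \<open>2 + 8 \<cdot> 32 \<cdot> 32 = 8194\<close> in
  the Dirichlet form.\<close>

lemma uniform_block_contraction:
  assumes qd: "\<And>i. i < n \<Longrightarrow> q i = d" and n0: "0 < n" and h: "0 < h"
    and cut: "\<And>S. S \<subseteq> {..<n} \<Longrightarrow> S \<noteq> {} \<Longrightarrow> 2 * card S \<le> n \<Longrightarrow>
      \<exists>r<32. h * real (card S) \<le> (\<Sum>i\<in>S. \<Sum>j\<in>{..<n} - S. M (a + r) i j)"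
  shows "wvar q {..<n} (x (a + 32)) \<le> (1 - h\<^sup>2 / (262208 * d^3)) * wvar q {..<n} (x a)"
proof -
  define V where "V = (\<lambda>t. wvar q {..<n} (x t))"
  define Q where "Q = (\<lambda>t. V t - V (Suc t))"
  define dir where "dir = (\<lambda>t f. \<Sum>i<n. \<Sum>j<n. M t i j * (f i - f j)\<^sup>2)"
  define R where "R = V a - V (a + 32)"
  have cl: "closed_at {..<n} t" for t by (rule closed_at_UNIV)
  have d1: "1 \<le> d" using q_ge[OF n0] qd[OF n0] by simp
  have Q0: "0 \<le> Q t" for t unfolding Q_def V_def using wvar_Suc_le[OF cl] by simp
  have Vmono: "V (a + 32) \<le> V (a + r)" if "r \<le> 32" for r
    unfolding V_def using that cl by (intro wvar_window) auto
  have dirQ: "dir t (x t) \<le> d * Q t" for t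
  proof -
    have "1 / d * dir t (x t) = (\<Sum>k<n. 1 / q k * (\<Sum>j<n. M t k j * (x t k - x t j)\<^sup>2))"
      unfolding dir_def by (subst sum_distrib_left) (use qd in \<open>auto intro!: sum.cong\<close>)
    also have "\<dots> \<le> Q t" unfolding Q_def V_def by (rule edge_drop[OF cl])
    finally show ?thesis using d1 by (simp add: field_simps)
  qed
  \<comment> \<open>By Jensen: an opinion moves by an average of differences along its edges, so the
    drop of the variance controls the squared displacement. This allows all 32 Dirichlet forms to be
    evaluated at the opinions of time a.\<close>
  have move: "(\<Sum>i<n. (x (Suc t) i - x t i)\<^sup>2) \<le> Q t" for t
  proof -
    have "(x (Suc t) i - x t i)\<^sup>2 \<le> 1 / d * (\<Sum>j<n. M t i j * (x t i - x t j)\<^sup>2)" if i: "i < n" for i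
    proof -
      have "x (Suc t) i - x t i = (\<Sum>j<n. P t i j * (x t j - x t i))"
        using P_sum[OF i, of t] by (simp add: right_diff_distrib sum_subtractf flip: sum_distrib_right)
      then have "(x (Suc t) i - x t i)\<^sup>2 \<le> (\<Sum>j<n. P t i j * (x t j - x t i)\<^sup>2)"
        using Jensen_square[of "{..<n}" "P t i"] P_nonneg[OF i] P_sum[OF i] by (simp del: traj.simps)
      also have "\<dots> = 1 / d * (\<Sum>j<n. M t i j * (x t i - x t j)\<^sup>2)"
        unfolding sum_distrib_left using P_eq[OF i] qd[OF i]
        by (intro sum.cong) (auto simp: power2_commute)
      finally show ?thesis .
    qed
    then have "(\<Sum>i<n. (x (Suc t) i - x t i)\<^sup>2) \<le> (\<Sum>i<n. 1 / d * (\<Sum>j<n. M t i j * (x t i - x t j)\<^sup>2))"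
      by (intro sum_mono) auto
    also have "\<dots> = 1 / d * dir t (x t)" unfolding dir_def by (rule sum_distrib_left[symmetric])
    also have "\<dots> \<le> Q t" using dirQ[of t] d1 by (simp add: field_simps)
    finally show ?thesis .
  qed
  have telV: "(\<Sum>t<r. Q (a + t)) = V a - V (a + r)" for r
    by (induction r) (auto simp: Q_def)
  have dist: "(\<Sum>i<n. (x (a + r) i - x a i)\<^sup>2) \<le> 32 * R" if r: "r \<le> 32" for r
  proof -
    have tel: "x (a + r) i - x a i = (\<Sum>t<r. x (Suc (a + t)) i - x (a + t) i)" for i
      by (induction r) (auto simp del: traj.simps)
    have "(\<Sum>i<n. (x (a + r) i - x a i)\<^sup>2) \<le> (\<Sum>i<n. (\<Sum>t<r. (x (Suc (a + t)) i - x (a + t) i)\<^sup>2) * real (card {..<r}))"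
      unfolding tel by (intro sum_mono sum_squared_le_sum_of_squares)
    also have "\<dots> = (\<Sum>i<n. \<Sum>t<r. (x (Suc (a + t)) i - x (a + t) i)\<^sup>2) * real r"
      by (simp only: sum_distrib_right card_lessThan)
    also have "\<dots> = real r * (\<Sum>i<n. \<Sum>t<r. (x (Suc (a + t)) i - x (a + t) i)\<^sup>2)" by (rule mult.commute)
    also have "(\<Sum>i<n. \<Sum>t<r. (x (Suc (a + t)) i - x (a + t) i)\<^sup>2) = (\<Sum>t<r. \<Sum>i<n. (x (Suc (a + t)) i - x (a + t) i)\<^sup>2)"
      by (rule sum.swap)
    also have "real r * (\<Sum>t<r. \<Sum>i<n. (x (Suc (a + t)) i - x (a + t) i)\<^sup>2) \<le> real r * (\<Sum>t<r. Q (a + t))"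
      using move by (intro mult_left_mono sum_mono) auto
    also have "\<dots> = real r * (V a - V (a + r))" by (simp only: telV)
    also have "\<dots> \<le> 32 * R"
    proof (rule mult_mono)
      show "V a - V (a + r) \<le> R" using Vmono[OF r] by (simp add: R_def)
      show "0 \<le> V a - V (a + r)" unfolding telV[symmetric] using Q0 by (intro sum_nonneg) auto
    qed (use r in auto)
    finally show ?thesis .
  qed
  have rows: "(\<Sum>i<n. \<Sum>j<n. M t i j * g i) = d * (\<Sum>i<n. g i)"
    and cols: "(\<Sum>i<n. \<Sum>j<n. M t i j * g j) = d * (\<Sum>i<n. g i)" for t g
  proof -
    show r: "(\<Sum>i<n. \<Sum>j<n. M t i j * g i) = d * (\<Sum>i<n. g i)" for g
      unfolding sum_distrib_right[symmetric] sum_distrib_left using M_sum qd by (intro sum.cong) auto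
    have "(\<Sum>i<n. \<Sum>j<n. M t i j * g j) = (\<Sum>j<n. \<Sum>i<n. M t j i * g j)"
      by (subst sum.swap) (use M_sym in \<open>auto intro!: sum.cong\<close>)
    then show "(\<Sum>i<n. \<Sum>j<n. M t i j * g j) = d * (\<Sum>i<n. g i)" using r by simp
  qed
  have dir_a: "dir (a + r) (x a) \<le> 2 * d * Q (a + r) + 256 * d * R" if r: "r < 32" for r
  proof -
    define t where "t = a + r"
    define \<delta> where "\<delta> = (\<lambda>i. x t i - x a i)"
    have "dir t (x a) \<le> (\<Sum>i<n. \<Sum>j<n. 2 * (M t i j * (x t i - x t j)\<^sup>2) + 4 * (M t i j * (\<delta> i)\<^sup>2) + 4 * (M t i j * (\<delta> j)\<^sup>2))"
      unfolding dir_def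
    proof (intro sum_mono)
      fix i j assume ij: "i \<in> {..<n}" "j \<in> {..<n}"
      define u where "u = x t i - x t j"
      have "(x a i - x a j)\<^sup>2 = (u - (\<delta> i - \<delta> j))\<^sup>2" by (simp add: u_def \<delta>_def)
      also have "\<dots> \<le> 2 * u\<^sup>2 + 4 * (\<delta> i)\<^sup>2 + 4 * (\<delta> j)\<^sup>2"
      proof -
        have "2 * u\<^sup>2 + 4 * (\<delta> i)\<^sup>2 + 4 * (\<delta> j)\<^sup>2 - (u - (\<delta> i - \<delta> j))\<^sup>2 = (u + (\<delta> i - \<delta> j))\<^sup>2 + 2 * (\<delta> i + \<delta> j)\<^sup>2"
          by (simp add: power2_eq_square algebra_simps)
        moreover have "0 \<le> (u + (\<delta> i - \<delta> j))\<^sup>2 + 2 * (\<delta> i + \<delta> j)\<^sup>2" by simp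
        ultimately show ?thesis by linarith
      qed
      finally have "M t i j * (x a i - x a j)\<^sup>2 \<le> M t i j * (2 * u\<^sup>2 + 4 * (\<delta> i)\<^sup>2 + 4 * (\<delta> j)\<^sup>2)"
        using M_nonneg ij by (intro mult_left_mono) auto
      then show "M t i j * (x a i - x a j)\<^sup>2
        \<le> 2 * (M t i j * (x t i - x t j)\<^sup>2) + 4 * (M t i j * (\<delta> i)\<^sup>2) + 4 * (M t i j * (\<delta> j)\<^sup>2)"
        by (simp add: u_def distrib_left mult_ac)
    qed
    also have "\<dots> = 2 * dir t (x t) + 4 * (\<Sum>i<n. \<Sum>j<n. M t i j * (\<delta> i)\<^sup>2) + 4 * (\<Sum>i<n. \<Sum>j<n. M t i j * (\<delta> j)\<^sup>2)"
      unfolding dir_def by (simp only: sum.distrib sum_distrib_left)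
    also have "\<dots> = 2 * dir t (x t) + 8 * d * (\<Sum>i<n. (\<delta> i)\<^sup>2)"
      unfolding rows[of t "\<lambda>i. (\<delta> i)\<^sup>2"] cols[of t "\<lambda>i. (\<delta> i)\<^sup>2"] by simp
    also have "\<dots> \<le> 2 * (d * Q t) + 8 * d * (32 * R)"
      using dirQ[of t] dist[of r] r d1 unfolding t_def \<delta>_def by (intro add_mono mult_left_mono) auto
    finally show ?thesis by (simp add: t_def)
  qed
  \<comment> \<open>The union of the 32 graphs, with multiplicity. Each S has a large cut in at
    least one of them, so the union meets the cut condition with the same h.\<close>
  define w where "w = (\<lambda>i j. \<Sum>r<32. M (a + r) i j)"
  have "h\<^sup>2 / (32 * d) * wvar (\<lambda>_. 1) {..<n} (x a) \<le> (\<Sum>i<n. \<Sum>j<n. w i j * (x a i - x a j)\<^sup>2)"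
  proof (rule cheeger_inequality)
    show "0 \<le> w i j" if "i \<in> {..<n}" "j \<in> {..<n}" for i j
      unfolding w_def using M_nonneg that by (intro sum_nonneg) auto
    show "w i j = w j i" if "i \<in> {..<n}" "j \<in> {..<n}" for i j
      unfolding w_def using M_sym that by (intro sum.cong) auto
    show "(\<Sum>j<n. w i j) \<le> 32 * d" if "i \<in> {..<n}" for i
      unfolding w_def using M_sum[of i] qd[of i] that by (subst sum.swap) simp
    fix S assume S: "S \<subseteq> {..<n}" "S \<noteq> {}" "2 * card S \<le> card {..<n}"
    then obtain r where r: "r < 32" "h * real (card S) \<le> (\<Sum>i\<in>S. \<Sum>j\<in>{..<n} - S. M (a + r) i j)"
      using cut[of S] by auto
    note r(2)
    also have "(\<Sum>i\<in>S. \<Sum>j\<in>{..<n} - S. M (a + r) i j) \<le> (\<Sum>i\<in>S. \<Sum>j\<in>{..<n} - S. w i j)"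
    proof (intro sum_mono)
      fix i j assume "i \<in> S" "j \<in> {..<n} - S"
      then show "M (a + r) i j \<le> w i j"
        unfolding w_def using S(1) M_nonneg r(1) by (intro member_le_sum) auto
    qed
    finally show "h * real (card S) \<le> (\<Sum>i\<in>S. \<Sum>j\<in>{..<n} - S. w i j)" .
  qed (use n0 h d1 in auto)
  also have "\<dots> = (\<Sum>r<32. dir (a + r) (x a))"
  proof -
    have "(\<Sum>i<n. \<Sum>j<n. w i j * (x a i - x a j)\<^sup>2) = (\<Sum>i<n. \<Sum>r<32. \<Sum>j<n. M (a + r) i j * (x a i - x a j)\<^sup>2)"
      unfolding w_def sum_distrib_right by (intro sum.cong refl sum.swap)
    also have "\<dots> = (\<Sum>r<32. dir (a + r) (x a))" unfolding dir_def by (rule sum.swap)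
    finally show ?thesis .
  qed
  also have "\<dots> \<le> (\<Sum>r<32. 2 * d * Q (a + r) + 256 * d * R)"
    using dir_a by (intro sum_mono) auto
  also have "\<dots> = 2 * d * (\<Sum>r<32. Q (a + r)) + 32 * (256 * d * R)"
    by (simp add: sum.distrib sum_distrib_left)
  also have "\<dots> = 8194 * d * R" unfolding telV R_def by simp
  finally have main: "h\<^sup>2 / (32 * d) * wvar (\<lambda>_. 1) {..<n} (x a) \<le> 8194 * d * R" .
  have "V a = d * wvar (\<lambda>_. 1) {..<n} (x a)"
    unfolding V_def using qd d1 by (intro wvar_const) auto
  then have "h\<^sup>2 / (32 * d\<^sup>2) * V a \<le> 8194 * d * R" using main d1 by (simp add: power2_eq_square)
  then have "h\<^sup>2 / (262208 * d^3) * V a \<le> R"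
    using d1 by (simp add: field_simps power2_eq_square power3_eq_cube)
  then show ?thesis unfolding R_def V_def by (simp add: left_diff_distrib)
qed

end

section \<open>Random graphs as reversible systems\<close>

definition ran_M :: "(nat \<Rightarrow> (nat \<times> nat) set) \<Rightarrow> nat \<Rightarrow> nat \<Rightarrow> nat \<Rightarrow> real" where
  "ran_M \<omega> t i j = (if i = j \<or> (i, j) \<in> \<omega> t then 1 else 0)"

lemma ran_M_sum:
  assumes "\<omega> t \<in> reg_graphs n (d - 1)" "0 < d" "i < n"
  shows "(\<Sum>j<n. ran_M \<omega> t i j) = real d"
proof -
  note R = reg_graphD[OF assms(1)]
  have "(\<Sum>j<n. ran_M \<omega> t i j) = real (card {j \<in> {..<n}. i = j \<or> (i, j) \<in> \<omega> t})"
    unfolding ran_M_def by (simp add: sum.If_cases Collect_conj_eq Int_commute lessThan_def)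
  also have "{j \<in> {..<n}. i = j \<or> (i, j) \<in> \<omega> t} = insert i {j. (i, j) \<in> \<omega> t}"
    using assms(3) R(7) by auto
  also have "card (insert i {j. (i, j) \<in> \<omega> t}) = d" using R(3,4,6) assms(2,3) by simp
  finally show ?thesis .
qed

lemma ran_rev_system:
  assumes G: "\<And>t. \<omega> t \<in> reg_graphs n (d - 1)" and d: "0 < d"
  shows "rev_system n (1 / real d) (ran_P d \<omega>) (\<lambda>_. real d) (ran_M \<omega>)"
proof -
  have P: "ran_P d \<omega> t i j = ran_M \<omega> t i j / real d" for t i j by (simp add: ran_P_def ran_M_def)
  have sym: "(i, j) \<in> \<omega> t \<longleftrightarrow> (j, i) \<in> \<omega> t" for i j t using reg_graphD(2)[OF G] by blast
  have "(\<Sum>j<n. ran_P d \<omega> t i j) = 1" if "i < n" for t i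
    unfolding P sum_divide_distrib[symmetric] ran_M_sum[OF G d that] using d by simp
  then have "stoch_system n (1 / real d) (ran_P d \<omega>)"
    unfolding stoch_system_def using d sym by (auto simp: ran_P_def)
  moreover have "ran_M \<omega> t i j = ran_M \<omega> t j i" for t i j using sym by (simp add: ran_M_def)
  moreover have "ran_M \<omega> t i j \<noteq> 0 \<longleftrightarrow> ran_P d \<omega> t i j > 0" for t i j
    using d by (simp add: ran_M_def ran_P_def)
  moreover have "ran_M \<omega> t i j \<noteq> 0 \<longrightarrow> ran_M \<omega> t i j \<ge> 1" for t i j by (simp add: ran_M_def)
  moreover have "(\<Sum>j<n. ran_M \<omega> t i j) = real d" if "i < n" for t i by (rule ran_M_sum[OF G d that])
  ultimately show ?thesis unfolding rev_system_def using P by simp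
qed

text \<open>The time t may depend on S: no single graph has to expand every set, only the union
  does. A block is a function on all times, of which the first 32 matter.\<close>

definition good_block :: "nat \<Rightarrow> nat \<Rightarrow> (nat \<Rightarrow> (nat \<times> nat) set) \<Rightarrow> bool" where
  "good_block n k \<beta> \<longleftrightarrow> (\<forall>S\<in>{S. S \<subseteq> {0..<n} \<and> S \<noteq> {} \<and> 2 * card S \<le> n}. \<exists>t<32. \<beta> t \<notin> bad_graphs n k S)"

text \<open>A graph that is not bad for S satisfies the cut condition for S with h = 1/8, and
  16781312 = 64 * 262208.\<close>

lemma good_block_contraction:
  assumes G: "\<And>t. \<omega> t \<in> reg_graphs n (d - 1)" and d: "0 < d" and n0: "0 < n"
    and good: "good_block n (d - 1) (\<lambda>t. \<omega> (a + t))"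
  shows "wvar (\<lambda>_. real d) {..<n} (traj n (ran_P d \<omega>) x0 (a + 32))
    \<le> (1 - 1 / (16781312 * (real d)^3)) * wvar (\<lambda>_. real d) {..<n} (traj n (ran_P d \<omega>) x0 a)"
proof -
  interpret reversible n "1 / real d" "ran_P d \<omega>" x0 "\<lambda>_. real d" "ran_M \<omega>"
    using ran_rev_system[OF G d] d by unfold_locales (auto simp: rev_system_def)
  have "wvar (\<lambda>_. real d) {..<n} (x (a + 32))
    \<le> (1 - (1 / 8)\<^sup>2 / (262208 * (real d)^3)) * wvar (\<lambda>_. real d) {..<n} (x a)"
  proof (rule uniform_block_contraction)
    fix S assume S: "S \<subseteq> {..<n}" "S \<noteq> {}" "2 * card S \<le> n"
    then obtain r where r: "r < 32" "\<omega> (a + r) \<notin> bad_graphs n (d - 1) S"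
      using good unfolding good_block_def by (auto simp: lessThan_atLeast0)
    have fin: "finite S" using S(1) finite_subset by blast
    have "card S \<le> 8 * card (crossing S (\<omega> (a + r)))"
      using r(2) G[of "a + r"] by (simp add: bad_graphs_def)
    then have "1 / 8 * real (card S) \<le> real (card (crossing S (\<omega> (a + r))))" by linarith
    also have "\<dots> = (\<Sum>i\<in>S. \<Sum>j\<in>{..<n} - S. ran_M \<omega> (a + r) i j)"
    proof -
      have "(\<Sum>i\<in>S. \<Sum>j\<in>{..<n} - S. ran_M \<omega> (a + r) i j)
          = (\<Sum>p\<in>S \<times> ({..<n} - S). if p \<in> \<omega> (a + r) then 1 else 0)"
        unfolding sum.cartesian_product by (intro sum.cong) (auto simp: ran_M_def)
      also have "\<dots> = real (card (S \<times> ({..<n} - S) \<inter> \<omega> (a + r)))"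
        using fin by (simp add: sum.inter_restrict[symmetric])
      also have "S \<times> ({..<n} - S) \<inter> \<omega> (a + r) = crossing S (\<omega> (a + r))"
        using reg_graphD(7)[OF G[of "a + r"]] by (auto simp: crossing_def)
      finally show ?thesis by simp
    qed
    finally show "\<exists>r<32. 1 / 8 * real (card S) \<le> (\<Sum>i\<in>S. \<Sum>j\<in>{..<n} - S. ran_M \<omega> (a + r) i j)"
      using r(1) by blast
  qed (use n0 in auto)
  then show ?thesis by (simp add: power2_eq_square)
qed


text \<open>\<open>T_eps\<close> is the counting measure of the set of long times, so any
  nonnegative series with terms at least 1 there dominates it; the infinite case needs no separate
  treatment.\<close>

lemma T_eps_le_suminf:
  fixes g :: "nat \<Rightarrow> ennreal"
  assumes "\<And>t. t \<in> long_edge_times n \<epsilon> P x0 \<Longrightarrow> 1 \<le> g t"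
  shows "T_eps n \<epsilon> P x0 \<le> (\<Sum>t. g t)"
proof -
  let ?L = "long_edge_times n \<epsilon> P x0"
  have "T_eps n \<epsilon> P x0 = emeasure (count_space UNIV) ?L"
    by (simp add: T_eps_def emeasure_count_space infinity_ennreal_def)
  also have "\<dots> = (\<integral>\<^sup>+t. indicator ?L t \<partial>count_space UNIV)" by simp
  also have "\<dots> = (\<Sum>t. indicator ?L t)" by (rule nn_integral_count_space_nat)
  also have "\<dots> \<le> (\<Sum>t. g t)"
    using assms by (intro suminf_le) (auto simp: indicator_def)
  finally show ?thesis .
qed

lemma good_block_cong:
  assumes "\<And>t. t < 32 \<Longrightarrow> \<beta> t = \<beta>' t"
  shows "good_block n k \<beta> \<longleftrightarrow> good_block n k \<beta>'"
proof -
  have "(\<exists>t<32. \<beta> t \<notin> X) \<longleftrightarrow> (\<exists>t<32. \<beta>' t \<notin> X)" for X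
    using assms by (intro ex_cong) simp
  then show ?thesis by (simp only: good_block_def)
qed

section \<open>Expectations over independent blocks\<close>

locale regular_graph_sequence =
  fixes n k :: nat
  assumes nonempty: "reg_graphs n k \<noteq> {}" and k3: "3 \<le> k"
begin

abbreviation "N \<equiv> measure_pmf (pmf_of_set (reg_graphs n k))"

sublocale seq: sequence_space N
  by unfold_locales

text \<open>u will be the power s of the contraction factor of a good block, while a bad block
  contributes 1. The weight depends on the graphs alone, not on the initial opinions.\<close>

definition weight :: "real \<Rightarrow> (nat \<Rightarrow> (nat \<times> nat) set) \<Rightarrow> ennreal" where
  "weight u \<beta> = (if good_block n k \<beta> then ennreal u else 1)"

definition weights :: "real \<Rightarrow> nat \<Rightarrow> (nat \<Rightarrow> (nat \<times> nat) set) \<Rightarrow> ennreal" where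
  "weights u b \<omega> = (\<Prod>j<b. weight u (\<lambda>t. \<omega> (32 * j + t)))"

lemma pred_component: "Measurable.pred seq.S (\<lambda>\<omega>. \<omega> t \<in> B)"
proof -
  have "(\<lambda>\<omega>. \<omega> t) \<in> measurable seq.S N" by (rule measurable_component_singleton) simp
  then show ?thesis by (rule measurable_compose) simp
qed

lemma sets_good_block: "{\<omega> \<in> space seq.S. good_block n k (\<lambda>t. \<omega> (a + t))} \<in> sets seq.S"
proof -
  let ?F = "{S. S \<subseteq> {0..<n} \<and> S \<noteq> {} \<and> 2 * card S \<le> n}"
  let ?B = "\<lambda>S t. {\<omega> \<in> space seq.S. \<omega> (a + t) \<in> bad_graphs n k S}"
  have "finite ?F" by (rule finite_subset[of _ "Pow {0..<n}"]) auto
  moreover have B: "?B S t \<in> sets seq.S" for S t using pred_component[of "a + t"] by (simp only: pred_def)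
  moreover have "(\<Inter>t\<in>{..<32}. ?B S t) \<in> sets seq.S" for S
  proof (rule sets.finite_INT)
    have "(0::nat) \<in> {..<32}" by simp
    then show "{..<32::nat} \<noteq> {}" by blast
  qed (use B in auto)
  ultimately have "space seq.S - (\<Union>S\<in>?F. \<Inter>t\<in>{..<32}. ?B S t) \<in> sets seq.S"
    by (intro sets.Diff sets.top sets.finite_UN) auto
  moreover have "{\<omega> \<in> space seq.S. good_block n k (\<lambda>t. \<omega> (a + t))} = space seq.S - (\<Union>S\<in>?F. \<Inter>t\<in>{..<32}. ?B S t)"
    unfolding good_block_def by auto
  ultimately show ?thesis by simp
qed

lemma pred_good_block: "Measurable.pred seq.S (\<lambda>\<omega>. good_block n k (\<lambda>t. \<omega> (a + t)))"
  using sets_good_block by (simp only: pred_def)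

lemma weight_measurable: "(\<lambda>\<omega>. weight u (\<lambda>t. \<omega> (a + t))) \<in> borel_measurable seq.S"
  unfolding weight_def using pred_good_block[of a] by measurable

lemma weights_measurable: "weights u b \<in> borel_measurable seq.S"
proof (induction b)
  case (Suc b)
  have "weights u (Suc b) = (\<lambda>\<omega>. weights u b \<omega> * weight u (\<lambda>t. \<omega> (32 * b + t)))"
    by (rule ext) (simp add: weights_def)
  then show ?case using Suc weight_measurable[of u "32 * b"] by simp
qed (simp add: weights_def[abs_def])

text \<open>For a fixed S the 32 graphs are independent, so all are bad with probability p^32;
  \<open>bad_graphs_union_bound\<close> sums this over S.\<close>

lemma prob_bad_block: "emeasure seq.S {\<omega> \<in> space seq.S. \<not> good_block n k \<omega>} \<le> ennreal (1 / 2)"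
proof -
  define F where "F = {S. S \<subseteq> {0..<n} \<and> S \<noteq> {} \<and> 2 * card S \<le> n}"
  let ?B = "\<lambda>S. {\<omega> \<in> space seq.S. \<forall>t\<in>{..<32}. \<omega> t \<in> bad_graphs n k S}"
  let ?p = "\<lambda>S. real (card (bad_graphs n k S)) / real (card (reg_graphs n k))"
  have finF: "finite F" by (rule finite_subset[of _ "Pow {0..<n}"]) (auto simp: F_def)
  have eq: "{\<omega> \<in> space seq.S. \<not> good_block n k \<omega>} = (\<Union>S\<in>F. ?B S)"
  proof -
    have gb: "\<not> good_block n k \<omega> \<longleftrightarrow> (\<exists>S\<in>F. \<forall>t\<in>{..<32}. \<omega> t \<in> bad_graphs n k S)" for \<omega>
      by (simp add: good_block_def F_def Ball_def)
    show ?thesis unfolding gb by (rule set_eqI) (simp only: mem_Collect_eq UN_iff, metis)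
  qed
  have "emeasure seq.S {\<omega> \<in> space seq.S. \<not> good_block n k \<omega>} \<le> (\<Sum>S\<in>F. emeasure seq.S (?B S))"
  proof -
    have "?B S \<in> sets seq.S" for S
      by (rule sets.sets_Collect_finite_All) (use pred_component in \<open>auto simp only: pred_def finite_lessThan\<close>)
    then have "emeasure seq.S (\<Union>S\<in>F. ?B S) \<le> (\<Sum>S\<in>F. emeasure seq.S (?B S))"
      using finF by (intro emeasure_subadditive_finite) auto
    then show ?thesis using eq by simp
  qed
  also have "\<dots> = (\<Sum>S\<in>F. ennreal (?p S ^ 32))"
  proof (rule sum.cong[OF refl])
    fix S
    have "emeasure seq.S (?B S) = (\<Prod>t\<in>{..<32::nat}. emeasure N (bad_graphs n k S))"
      by (rule seq.emeasure_PiM_Collect) auto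
    also have "emeasure N (bad_graphs n k S) = ennreal (?p S)"
    proof -
      have "reg_graphs n k \<inter> bad_graphs n k S = bad_graphs n k S" by (auto simp: bad_graphs_def)
      then show ?thesis using emeasure_pmf_of_set[OF nonempty finite_reg_graphs, of "bad_graphs n k S"] by simp
    qed
    finally show "emeasure seq.S (?B S) = ennreal (?p S ^ 32)" by (simp add: ennreal_power)
  qed
  also have "\<dots> = ennreal (\<Sum>S\<in>F. ?p S ^ 32)" by (rule sum_ennreal) simp
  also have "\<dots> \<le> ennreal (1 / 2)" unfolding F_def by (rule ennreal_leI[OF bad_graphs_union_bound[OF k3]])
  finally show ?thesis .
qed

lemma expected_weight:
  assumes u: "0 \<le> u" "u \<le> 1"
  shows "(\<integral>\<^sup>+\<omega>. weight u \<omega> \<partial>seq.S) \<le> ennreal ((1 + u) / 2)"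
proof -
  let ?B = "{\<omega> \<in> space seq.S. \<not> good_block n k \<omega>}"
  have B: "?B \<in> sets seq.S" using pred_good_block[of 0] by (simp add: pred_def)
  have "(\<integral>\<^sup>+\<omega>. weight u \<omega> \<partial>seq.S) = (\<integral>\<^sup>+\<omega>. ennreal u + ennreal (1 - u) * indicator ?B \<omega> \<partial>seq.S)"
    by (rule nn_integral_cong) (use u in \<open>auto simp: weight_def indicator_def simp flip: ennreal_plus\<close>)
  also have "\<dots> = ennreal u + ennreal (1 - u) * emeasure seq.S ?B"
    using B seq.P.emeasure_space_1 by (subst nn_integral_add) (auto simp: nn_integral_cmult_indicator)
  also have "\<dots> \<le> ennreal u + ennreal (1 - u) * ennreal (1 / 2)"
    using prob_bad_block by (intro add_left_mono mult_left_mono) auto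
  also have "\<dots> = ennreal (u + (1 - u) * (1 / 2))"
  proof -
    have "ennreal (u + (1 - u) * (1 / 2)) = ennreal u + ennreal ((1 - u) * (1 / 2))"
      using u by (intro ennreal_plus) auto
    also have "ennreal ((1 - u) * (1 / 2)) = ennreal (1 - u) * ennreal (1 / 2)"
      using u by (intro ennreal_mult) auto
    finally show ?thesis by (rule sym)
  qed
  also have "u + (1 - u) * (1 / 2) = (1 + u) / 2" by (simp add: field_simps)
  finally show ?thesis .
qed

text \<open>Gluing an independent sequence behind the first 32 graphs preserves the product measure
  (\<open>comb_seq\<close>), so the blocks are independent and identically distributed.\<close>

lemma expected_weights: "(\<integral>\<^sup>+\<omega>. weights u b \<omega> \<partial>seq.S) = (\<integral>\<^sup>+\<omega>. weight u \<omega> \<partial>seq.S) ^ b"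
proof (induction b)
  case 0
  then show ?case by (simp add: weights_def seq.P.emeasure_space_1)
next
  case (Suc b)
  let ?f = "\<lambda>(\<omega>, \<omega>'). comb_seq 32 \<omega> \<omega>'"
  have m0: "weight u \<in> borel_measurable seq.S" using weight_measurable[of u 0] by simp
  have split: "weights u (Suc b) (comb_seq 32 \<omega> \<omega>') = weight u \<omega> * weights u b \<omega>'" for \<omega> \<omega>'
  proof -
    have "weight u (\<lambda>t. comb_seq 32 \<omega> \<omega>' (32 * 0 + t)) = weight u \<omega>"
      unfolding weight_def using good_block_cong[of "\<lambda>t. comb_seq 32 \<omega> \<omega>' (32 * 0 + t)" \<omega>]
      by (simp add: comb_seq_less)
    moreover have "(\<lambda>t. comb_seq 32 \<omega> \<omega>' (32 * Suc j + t)) = (\<lambda>t. \<omega>' (32 * j + t))" for j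
      by (auto simp: comb_seq_def)
    ultimately show ?thesis unfolding weights_def prod.lessThan_Suc_shift by simp
  qed
  have "(\<integral>\<^sup>+\<omega>. weights u (Suc b) \<omega> \<partial>seq.S)
      = (\<integral>\<^sup>+\<omega>. weights u (Suc b) \<omega> \<partial>distr (seq.S \<Otimes>\<^sub>M seq.S) seq.S ?f)"
    by (simp only: seq.PiM_comb_seq)
  also have "\<dots> = (\<integral>\<^sup>+z. weights u (Suc b) (?f z) \<partial>(seq.S \<Otimes>\<^sub>M seq.S))"
    by (rule nn_integral_distr[OF measurable_comb_seq]) (simp add: weights_measurable)
  also have "\<dots> = (\<integral>\<^sup>+z. weight u (fst z) * weights u b (snd z) \<partial>(seq.S \<Otimes>\<^sub>M seq.S))"
    by (intro nn_integral_cong) (auto simp: split)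
  also have "\<dots> = (\<integral>\<^sup>+\<omega>. \<integral>\<^sup>+\<omega>'. weight u \<omega> * weights u b \<omega>' \<partial>seq.S \<partial>seq.S)"
  proof -
    have "(\<lambda>z. weight u (fst z) * weights u b (snd z)) \<in> borel_measurable (seq.S \<Otimes>\<^sub>M seq.S)"
      using m0 weights_measurable[of u b] by measurable
    from seq.P.nn_integral_fst[OF this] show ?thesis by simp
  qed
  also have "\<dots> = (\<integral>\<^sup>+\<omega>. weight u \<omega> * (\<integral>\<^sup>+\<omega>'. weights u b \<omega>' \<partial>seq.S) \<partial>seq.S)"
    using weights_measurable by (intro nn_integral_cong nn_integral_cmult)
  also have "\<dots> = (\<integral>\<^sup>+\<omega>. weight u \<omega> \<partial>seq.S) * (\<integral>\<^sup>+\<omega>'. weights u b \<omega>' \<partial>seq.S)"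
    using m0 by (rule nn_integral_multc)
  finally show ?case using Suc by simp
qed

lemma AE_reg_graphs: "AE \<omega> in seq.S. \<forall>t. \<omega> t \<in> reg_graphs n k"
proof (subst AE_all_countable, rule allI)
  fix t
  have "AE E in N. E \<in> reg_graphs n k"
    using nonempty finite_reg_graphs by (simp add: AE_measure_pmf_iff)
  then show "AE \<omega> in seq.S. \<omega> t \<in> reg_graphs n k" by (rule seq.AE_component[rotated]) simp
qed

end

lemma suminf_blocks_le:
  fixes \<kappa> :: real
  assumes "0 \<le> \<kappa>" "\<kappa> < 1"
  shows "(\<Sum>t. ennreal (\<kappa> ^ (t div 32))) \<le> ennreal (32 / (1 - \<kappa>))"
proof (rule suminf_le_const)
  fix M :: nat
  have "(\<Sum>t<M. \<kappa> ^ (t div 32)) \<le> (\<Sum>t<M * 32. \<kappa> ^ (t div 32))"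
    using assms by (intro sum_mono2) auto
  also have "\<dots> = (\<Sum>b<M. \<Sum>t\<in>{b * 32..<b * 32 + 32}. \<kappa> ^ (t div 32))"
    by (rule sum.nat_group[symmetric])
  also have "\<dots> = (\<Sum>b<M. 32 * \<kappa> ^ b)"
  proof (rule sum.cong[OF refl])
    fix b
    have "(\<Sum>t\<in>{b * 32..<b * 32 + 32}. \<kappa> ^ (t div 32)) = (\<Sum>t\<in>{b * 32..<b * 32 + 32}. \<kappa> ^ b)"
    proof (rule sum.cong[OF refl])
      fix t assume "t \<in> {b * 32..<b * 32 + 32}"
      then have "t div 32 = b" by auto
      then show "\<kappa> ^ (t div 32) = \<kappa> ^ b" by simp
    qed
    then show "(\<Sum>t\<in>{b * 32..<b * 32 + 32}. \<kappa> ^ (t div 32)) = 32 * \<kappa> ^ b" by simp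
  qed
  also have "\<dots> = 32 * ((1 - \<kappa> ^ M) / (1 - \<kappa>))"
    using assms by (simp add: sum_distrib_left[symmetric] sum_gp_strict)
  also have "\<dots> \<le> 32 * (1 / (1 - \<kappa>))"
    using assms by (intro mult_left_mono divide_right_mono) auto
  finally have "(\<Sum>t<M. \<kappa> ^ (t div 32)) \<le> 32 / (1 - \<kappa>)" by simp
  then show "(\<Sum>t<M. ennreal (\<kappa> ^ (t div 32))) \<le> ennreal (32 / (1 - \<kappa>))"
    using assms by (subst sum_ennreal) (auto intro: ennreal_leI)
qed simp

section \<open>The theorem\<close>

text \<open>The majorant of \<open>T_ran\<close> is a measurable function of the graphs that does
  not mention x0, so the supremum over initial opinions is settled before the expectation is taken.
  With s = 1 / (L + 1), the expected power of the potential bound shrinks by a factor of at most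
  \<kappa> per block, and 1 - \<kappa> is at least s * \<gamma> / 2, of order 1/L.\<close>

lemma expected_T_ran:
  assumes d: "3 < d" "d \<le> n" "even (n * (d - 1))" and eps: "0 < \<epsilon>" "1 \<le> ln (1 / \<epsilon>)"
  shows "(\<integral>\<^sup>+\<omega>. T_ran n d \<epsilon> \<omega> \<partial>ran_space n d) \<le> ennreal (128 * exp 3 * (16781312 * (real d)^3) * ln (1 / \<epsilon>))"
proof -
  interpret regular_graph_sequence n "d - 1"
    using reg_graphs_nonempty[of "d - 1" n] d by unfold_locales auto
  have S: "ran_space n d = seq.S" by (simp add: ran_space_def)
  have n0: "0 < n" and d0: "0 < d" using d by auto
  define l where "l = ln (1 / \<epsilon>)"
  define s where "s = 1 / (l + 1)"
  define \<gamma> where "\<gamma> = 1 / (16781312 * (real d)^3)"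
  define u where "u = (1 - \<gamma>) powr s"
  have l1: "1 \<le> l" using eps(2) by (simp only: l_def)
  have s: "0 < s" "s \<le> 1" using l1 by (auto simp: s_def)
  have g: "0 < \<gamma>" "\<gamma> \<le> 1"
  proof -
    have "1 \<le> (real d)^3" using d0 by simp
    then have "1 \<le> 16781312 * (real d)^3" by linarith
    then show "\<gamma> \<le> 1" unfolding \<gamma>_def by (subst divide_le_eq_1_pos) linarith+
    show "0 < \<gamma>" unfolding \<gamma>_def using d0 by simp
  qed
  have u: "0 \<le> u" "u \<le> 1 - s * \<gamma>"
    unfolding u_def using powr_one_minus_le[of \<gamma> s] g s by auto
  have sg: "0 < s * \<gamma>" using s g by simp
  have u1: "u \<le> 1" using u(2) sg by linarith
  have pointwise: "T_ran n d \<epsilon> \<omega> \<le> (\<Sum>t. ennreal (exp 3) * weights u (t div 32) \<omega>)"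
    if G: "\<forall>t. \<omega> t \<in> reg_graphs n (d - 1)" for \<omega>
    unfolding T_ran_def
  proof (rule SUP_least)
    fix x0 assume "x0 \<in> {x0. qvar n (\<lambda>_. real d) x0 \<le> 1}"
    then have q1: "qvar n (\<lambda>_. real d) x0 \<le> 1" by simp
    have G': "\<omega> t \<in> reg_graphs n (d - 1)" for t using G by blast
    interpret reversible n "1 / real d" "ran_P d \<omega>" x0 "\<lambda>_. real d" "ran_M \<omega>"
      using ran_rev_system[OF G' d0] d0 by unfold_locales (auto simp: rev_system_def)
    define V where "V = (\<lambda>t. wvar (\<lambda>_. real d) {..<n} (x t))"
    \<comment> \<open>z b bounds the variance after b blocks: a good block contracts it, a bad one
      at least does not increase it. Its power s is the product of the weights.\<close>
    define z where "z b = (\<Prod>j<b. if good_block n (d - 1) (\<lambda>t. \<omega> (32 * j + t)) then 1 - \<gamma> else 1)" for b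
    have z0: "0 \<le> z b" for b unfolding z_def using g by (intro prod_nonneg) auto
    have pair: "(x t i - x t j)\<^sup>2 / 2 \<le> V t" if "i < n" "j < n" for t i j
      unfolding V_def using d0 that by (intro wvar_ge_pair) auto
    have V0: "0 \<le> V t" for t using pair[of 0 0 t] n0 by simp
    have Vmono: "V b \<le> V a" if "a \<le> b" for a b
      unfolding V_def using that closed_at_UNIV by (intro wvar_window) auto
    have Vz: "V (32 * b) \<le> z b" for b
    proof (induction b)
      case 0
      then show ?case
        using q1 qvar_eq_wvar[OF sum_q_pos[OF n0]] by (simp add: V_def z_def)
    next
      case (Suc b)
      show ?case
      proof (cases "good_block n (d - 1) (\<lambda>t. \<omega> (32 * b + t))")
        case True
        then have "V (32 * b + 32) \<le> (1 - \<gamma>) * V (32 * b)"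
          unfolding V_def \<gamma>_def by (rule good_block_contraction[OF G' d0 n0])
        also have "\<dots> \<le> (1 - \<gamma>) * z b" using Suc g by (intro mult_left_mono) auto
        finally show ?thesis using True by (simp add: z_def mult.commute add.commute)
      next
        case False
        then show ?thesis using Suc Vmono[of "32 * b" "32 * Suc b"] by (simp add: z_def)
      qed
    qed
    have zw: "ennreal (z b powr s) = weights u b \<omega>" for b
    proof -
      have "z b powr s = (\<Prod>j<b. (if good_block n (d - 1) (\<lambda>t. \<omega> (32 * j + t)) then 1 - \<gamma> else 1) powr s)"
        unfolding z_def by (rule prod_powr_distrib)
      also have "\<dots> = (\<Prod>j<b. if good_block n (d - 1) (\<lambda>t. \<omega> (32 * j + t)) then u else 1)"
        by (intro prod.cong) (auto simp: u_def)
      finally have "ennreal (z b powr s) = (\<Prod>j<b. ennreal (if good_block n (d - 1) (\<lambda>t. \<omega> (32 * j + t)) then u else 1))"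
        using u(1) by (simp add: prod_ennreal)
      then show ?thesis unfolding weights_def weight_def by (simp add: if_distrib cong: if_cong)
    qed
    have budget: "(2 / \<epsilon>\<^sup>2) powr s \<le> exp 3"
    proof -
      have "exp 1 \<le> exp (ln (1 / \<epsilon>))" using eps(2) by (simp only: exp_le_cancel_iff)
      then have "2 \<le> 1 / \<epsilon>" using eps(1) exp_ge_add_one_self[of 1] by simp
      then have "2 * (1 / \<epsilon>\<^sup>2) \<le> 1 / \<epsilon> * (1 / \<epsilon>\<^sup>2)" by (intro mult_right_mono) auto
      then have "2 / \<epsilon>\<^sup>2 \<le> 1 / \<epsilon> ^ 3" by (simp add: power2_eq_square power3_eq_cube)
      from powr_budget[OF eps _ _ this, of 1] show ?thesis by (simp add: s_def l_def)
    qed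
    show "T_eps n \<epsilon> (ran_P d \<omega>) x0 \<le> (\<Sum>t. ennreal (exp 3) * weights u (t div 32) \<omega>)"
    proof (rule T_eps_le_suminf)
      fix t assume "t \<in> long_edge_times n \<epsilon> (ran_P d \<omega>) x0"
      then obtain i j where ij: "i < n" "j < n" "\<epsilon> \<le> \<bar>x t i - x t j\<bar>" by (auto simp: long_edge_times_def)
      have "\<epsilon>\<^sup>2 \<le> (x t i - x t j)\<^sup>2" using ij(3) eps(1) by (metis abs_le_square_iff abs_of_pos)
      also have "\<dots> \<le> 2 * V t" using pair[OF ij(1,2), of t] by simp
      also have "\<dots> \<le> 2 * z (t div 32)" using Vmono[of "32 * (t div 32)" t] Vz[of "t div 32"] by simp
      finally have "1 \<le> 2 / \<epsilon>\<^sup>2 * z (t div 32)" using eps(1) by (simp add: field_simps)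
      then have "1 \<le> (2 / \<epsilon>\<^sup>2 * z (t div 32)) powr s" using s by (intro ge_one_powr_ge_zero) auto
      also have "\<dots> = (2 / \<epsilon>\<^sup>2) powr s * z (t div 32) powr s" by (rule powr_mult)
      also have "\<dots> \<le> exp 3 * z (t div 32) powr s" using budget by (intro mult_right_mono) auto
      finally have "ennreal 1 \<le> ennreal (exp 3 * z (t div 32) powr s)" by (rule ennreal_leI)
      then show "1 \<le> ennreal (exp 3) * weights u (t div 32) \<omega>"
        by (simp add: ennreal_mult zw)
    qed
  qed
  define \<kappa> where "\<kappa> = (1 + u) / 2"
  have k: "0 \<le> \<kappa>" "\<kappa> < 1" "s * \<gamma> / 2 \<le> 1 - \<kappa>" 
  proof -
    have "2 * \<kappa> = 1 + u" by (simp add: \<kappa>_def)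
    then show "0 \<le> \<kappa>" "\<kappa> < 1" "s * \<gamma> / 2 \<le> 1 - \<kappa>" using u sg by linarith+
  qed
  have "(\<integral>\<^sup>+\<omega>. T_ran n d \<epsilon> \<omega> \<partial>ran_space n d) \<le> (\<integral>\<^sup>+\<omega>. (\<Sum>t. ennreal (exp 3) * weights u (t div 32) \<omega>) \<partial>seq.S)"
    unfolding S by (rule nn_integral_mono_AE, rule eventually_mono[OF AE_reg_graphs]) (rule pointwise)
  also have "\<dots> = (\<Sum>t. \<integral>\<^sup>+\<omega>. ennreal (exp 3) * weights u (t div 32) \<omega> \<partial>seq.S)"
    using weights_measurable by (intro nn_integral_suminf) auto
  also have "\<dots> = (\<Sum>t. ennreal (exp 3) * (\<integral>\<^sup>+\<omega>. weight u \<omega> \<partial>seq.S) ^ (t div 32))"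
    by (simp only: nn_integral_cmult[OF weights_measurable] expected_weights)
  also have "\<dots> \<le> (\<Sum>t. ennreal (exp 3) * ennreal (\<kappa> ^ (t div 32)))"
  proof (intro suminf_le mult_left_mono)
    fix t
    have "(\<integral>\<^sup>+\<omega>. weight u \<omega> \<partial>seq.S) ^ (t div 32) \<le> ennreal \<kappa> ^ (t div 32)"
      unfolding \<kappa>_def using expected_weight[OF u(1) u1] by (intro power_mono) auto
    then show "(\<integral>\<^sup>+\<omega>. weight u \<omega> \<partial>seq.S) ^ (t div 32) \<le> ennreal (\<kappa> ^ (t div 32))"
      using k by (simp add: ennreal_power)
  qed auto
  also have "\<dots> = ennreal (exp 3) * (\<Sum>t. ennreal (\<kappa> ^ (t div 32)))" by simp
  also have "\<dots> \<le> ennreal (exp 3) * ennreal (32 / (1 - \<kappa>))"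
    using suminf_blocks_le[OF k(1,2)] by (intro mult_left_mono) auto
  also have "\<dots> = ennreal (exp 3 * (32 / (1 - \<kappa>)))" using k by (intro ennreal_mult[symmetric]) auto
  \<comment> \<open>128 = 32 * 2 * 2: the block length, the probability 1/2 of a good block, and L +
    1 \<le> 2 * L.\<close>
  also have "\<dots> \<le> ennreal (128 * exp 3 * (16781312 * (real d)^3) * ln (1 / \<epsilon>))"
  proof (rule ennreal_leI)
    have "32 / (1 - \<kappa>) \<le> 32 / (s * \<gamma> / 2)" using k sg by (intro divide_left_mono) auto
    also have "\<dots> = 64 * (l + 1) * (16781312 * (real d)^3)"
      unfolding s_def \<gamma>_def using l1 d0 by (simp add: field_simps)
    also have "\<dots> \<le> 64 * (l + l) * (16781312 * (real d)^3)" using l1 by (intro mult_right_mono mult_left_mono) auto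
    finally have "exp 3 * (32 / (1 - \<kappa>)) \<le> exp 3 * (64 * (l + l) * (16781312 * (real d)^3))"
      by (intro mult_left_mono) auto
    then show "exp 3 * (32 / (1 - \<kappa>)) \<le> 128 * exp 3 * (16781312 * (real d)^3) * ln (1 / \<epsilon>)"
      unfolding l_def[symmetric] by (simp add: mult_ac)
  qed
  finally show ?thesis .
qed

text \<open>For m \<ge> 2 * C the division by m gives C * (1 + L/m) \<le> L/2 + L/2, so nothing is
  lost; for the finitely many smaller m the factor (2 * C)^m goes into c.\<close>

lemma power_absorb:
  fixes C :: real
  assumes C: "1 \<le> C"
  obtains c where "1 \<le> c" "\<And>B L m. 0 \<le> B \<Longrightarrow> 2 * C \<le> L \<Longrightarrow> 0 < m \<Longrightarrow>
    (C * B * (1 + L / real m)) ^ m \<le> c * (B * L) ^ m"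
proof
  let ?c = "(2 * C) ^ nat \<lceil>2 * C\<rceil>"
  show c1: "1 \<le> ?c" using C by (intro one_le_power) auto
  fix B L :: real and m :: nat
  assume B: "0 \<le> B" and L: "2 * C \<le> L" and m: "0 < m"
  have L0: "0 < L" "1 \<le> L" using L C by auto
  have "(C * (1 + L / real m)) ^ m \<le> ?c * L ^ m"
  proof (cases "2 * C \<le> real m")
    case True
    have "C * (1 + L / real m) = C + C / real m * L" by (simp add: distrib_left)
    also have "\<dots> \<le> L / 2 + 1 / 2 * L"
      using L L0 True m by (intro add_mono mult_right_mono) (auto simp: divide_le_eq)
    finally have "C * (1 + L / real m) \<le> L" by simp
    then have "(C * (1 + L / real m)) ^ m \<le> L ^ m" using C L0 by (intro power_mono) auto
    also have "\<dots> \<le> ?c * L ^ m" using mult_right_mono[OF c1, of "L ^ m"] L0 by simp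
    finally show ?thesis .
  next
    case False
    have "L / real m \<le> L / 1" using m L0 by (intro divide_left_mono) auto
    then have "C * (1 + L / real m) \<le> C * (L + L)" using C L0 by (intro mult_left_mono) auto
    then have "(C * (1 + L / real m)) ^ m \<le> (2 * C * L) ^ m" using C L0 by (intro power_mono) auto
    also have "\<dots> = (2 * C) ^ m * L ^ m" by (simp add: power_mult_distrib)
    also have "\<dots> \<le> ?c * L ^ m"
    proof (intro mult_right_mono power_increasing)
      show "m \<le> nat \<lceil>2 * C\<rceil>" using False by linarith
    qed (use C L0 in auto)
    finally show ?thesis .
  qed
  then have "B ^ m * (C * (1 + L / real m)) ^ m \<le> B ^ m * (?c * L ^ m)" using B by (intro mult_left_mono) auto
  then show "(C * B * (1 + L / real m)) ^ m \<le> ?c * (B * L) ^ m"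
    by (simp add: power_mult_distrib mult_ac)
qed

lemma T_eps_empty: "T_eps 0 \<epsilon> P x0 = 0"
  by (simp add: T_eps_def long_edge_times_def)

lemma (in averaging) one_le_n_components: "0 < n \<Longrightarrow> 1 \<le> n_components n (E t)"
  unfolding n_components_eq by (rule comps_nonempty[OF closed_at_UNIV]) auto

lemma T_gen_le:
  assumes c: "\<And>B L m. 0 \<le> B \<Longrightarrow> 40 * exp 3 \<le> L \<Longrightarrow> 0 < m \<Longrightarrow>
      (20 * exp 3 * B * (1 + L / real m)) ^ m \<le> c * (B * L) ^ m" "1 \<le> c"
    and rho: "0 < \<rho>" "\<rho> \<le> 1/2" and eps: "0 < \<epsilon>" "40 * exp 3 \<le> ln (1 / \<epsilon>)"
  shows "T_gen n \<rho> m \<epsilon> \<le> ennreal (exp 1 * c * (1 / \<rho>) ^ (n - 1) * (real m * real n * ln (1 / \<epsilon>)) ^ m)"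
  unfolding T_gen_def
proof (rule SUP_least)
  let ?R = "exp 1 * c * (1 / \<rho>) ^ (n - 1) * (real m * real n * ln (1 / \<epsilon>)) ^ m"
  fix z assume z: "z \<in> {(P, x0 :: nat \<Rightarrow> real). stoch_system n \<rho> P
      \<and> (\<forall>t. n_components n (graph_edges n P t) \<le> m) \<and> (\<forall>i<n. 0 \<le> x0 i \<and> x0 i \<le> 1)}"
  obtain P x0 where zz: "z = (P, x0)" by (metis surj_pair)
  have st: "stoch_system n \<rho> P" and comp: "\<forall>t. n_components n (graph_edges n P t) \<le> m"
    and x01: "\<forall>i<n. 0 \<le> x0 i \<and> x0 i \<le> 1" using z by (auto simp: zz)
  interpret averaging n \<rho> P x0 using st rho by unfold_locales
  have l0: "0 \<le> ln (1 / \<epsilon>)" "1 \<le> ln (1 / \<epsilon>)" using eps(2) exp_ge_add_one_self[of 3] by linarith+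
  have "T_eps n \<epsilon> P x0 \<le> ennreal ?R"
  proof (cases "n = 0")
    case False
    then have n0: "0 < n" by simp
    \<comment> \<open>With n > 0 every graph has a component, so m = 0 admits no system.\<close>
    then have m0: "0 < m" using one_le_n_components[of 0] comp by (metis One_nat_def Suc_le_eq le_trans)
    show ?thesis
    proof (rule T_eps_le)
      fix b
      have "real (cnt \<epsilon> {..<n} 0 b)
        \<le> exp 1 * (1 / \<rho>) ^ (n - 1) * (20 * exp 3 * (real m * real n) * (1 + ln (1 / \<epsilon>) / real m)) ^ m"
        using rho(2) comp n0 m0 x01 eps(1) l0(2) by (intro cnt_le_general) auto
      also have "\<dots> \<le> exp 1 * (1 / \<rho>) ^ (n - 1) * (c * (real m * real n * ln (1 / \<epsilon>)) ^ m)"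
        using c(1)[of "real m * real n" "ln (1 / \<epsilon>)" m] eps(2) m0 rho(1) by (intro mult_left_mono) auto
      finally show "real (cnt \<epsilon> {..<n} 0 b) \<le> ?R" by (simp add: mult_ac)
      show "0 \<le> ?R" using c(2) rho(1) l0(1) by (intro mult_nonneg_nonneg zero_le_power) auto
    qed
  qed (simp add: T_eps_empty)
  then show "(case z of (P, x0) \<Rightarrow> T_eps n \<epsilon> P x0) \<le> ennreal ?R" by (simp add: zz)
qed

lemma T_rev_le:
  assumes c: "\<And>B L m. 0 \<le> B \<Longrightarrow> 40 * exp 3 \<le> L \<Longrightarrow> 0 < m \<Longrightarrow>
      (20 * exp 3 * B * (1 + L / real m)) ^ m \<le> c * (B * L) ^ m" "1 \<le> c"
    and rho: "0 < \<rho>" "\<rho> \<le> 1/2" and eps: "0 < \<epsilon>" "40 * exp 3 \<le> ln (1 / \<epsilon>)"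
  shows "T_rev n \<rho> m \<epsilon> \<le> ennreal (c * ((real n)\<^sup>2 / \<rho> * ln (1 / \<epsilon>)) ^ m)"
  unfolding T_rev_def
proof (rule SUP_least)
  let ?R = "c * ((real n)\<^sup>2 / \<rho> * ln (1 / \<epsilon>)) ^ m"
  fix z assume z: "z \<in> {(P, q, M, x0). rev_system n \<rho> P q M
      \<and> (\<forall>t. n_components n (graph_edges n P t) \<le> m) \<and> qvar n q x0 \<le> 1}"
  obtain P q M x0 where zz: "z = (P, q, M, x0)" by (metis surj_pair)
  have rev: "rev_system n \<rho> P q M" and comp: "\<forall>t. n_components n (graph_edges n P t) \<le> m"
    and q1: "qvar n q x0 \<le> 1" using z by (auto simp: zz)
  interpret reversible n \<rho> P x0 q M using rev rho by unfold_locales (auto simp: rev_system_def)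
  have l0: "0 \<le> ln (1 / \<epsilon>)" "1 \<le> ln (1 / \<epsilon>)" using eps(2) exp_ge_add_one_self[of 3] by linarith+
  have "T_eps n \<epsilon> P x0 \<le> ennreal ?R"
  proof (cases "n = 0")
    case False
    then have n0: "0 < n" by simp
    then have m0: "0 < m" using one_le_n_components[of 0] comp by (metis One_nat_def Suc_le_eq le_trans)
    show ?thesis
    proof (rule T_eps_le)
      fix b
      have "real (cnt \<epsilon> {..<n} 0 b) \<le> (20 * exp 3 * ((real n)\<^sup>2 / \<rho>) * (1 + ln (1 / \<epsilon>) / real m)) ^ m"
        using rho(2) comp n0 m0 q1 eps(1) l0(2) by (intro cnt_le) auto
      also have "\<dots> \<le> c * ((real n)\<^sup>2 / \<rho> * ln (1 / \<epsilon>)) ^ m"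
        using eps(2) m0 rho(1) by (intro c(1)) auto
      finally show "real (cnt \<epsilon> {..<n} 0 b) \<le> c * ((real n)\<^sup>2 / \<rho> * ln (1 / \<epsilon>)) ^ m" .
      show "0 \<le> c * ((real n)\<^sup>2 / \<rho> * ln (1 / \<epsilon>)) ^ m"
        using c(2) rho(1) l0(1) by (intro mult_nonneg_nonneg zero_le_power) auto
    qed
  qed (simp add: T_eps_empty)
  then show "(case z of (P, q, M, x0) \<Rightarrow> T_eps n \<epsilon> P x0) \<le> ennreal ?R" by (simp add: zz)
qed

lemma T_exp_le:
  assumes c: "\<And>B L m. 0 \<le> B \<Longrightarrow> 40 * exp 3 \<le> L \<Longrightarrow> 0 < m \<Longrightarrow>
      (20 * exp 3 * B * (1 + L / real m)) ^ m \<le> c * (B * L) ^ m" "1 \<le> c"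
    and rho: "0 < \<rho>" and eps: "0 < \<epsilon>" "40 * exp 3 \<le> ln (1 / \<epsilon>)" and h: "0 < h"
  shows "T_exp n \<rho> d h m \<epsilon> \<le> ennreal (c * ((real d)^3 * real m * real n / h\<^sup>2 * ln (1 / \<epsilon>)) ^ m)"
    and "T_exp n \<rho> d h 1 \<epsilon> \<le> ennreal (4 * (real d)^3 / h\<^sup>2 * ln (1 / \<epsilon>))"
proof -
  have l0: "0 \<le> ln (1 / \<epsilon>)" "1 \<le> ln (1 / \<epsilon>)" using eps(2) exp_ge_add_one_self[of 3] by linarith+
  \<comment> \<open>Both bounds share the reduction to finite windows, which may assume h \<le> d:
    otherwise \<open>long_at_h_le\<close> rules out long edges altogether.\<close>
  have gen: "T_exp n \<rho> d h m \<epsilon> \<le> ennreal R"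
    if R: "0 \<le> R" and bound: "\<And>P q M x0 b. exp_system n \<rho> d h P q M \<Longrightarrow>
      (\<And>t. n_components n (graph_edges n P t) \<le> m) \<Longrightarrow> qvar n q x0 \<le> 1 \<Longrightarrow> 0 < n \<Longrightarrow> 0 < m \<Longrightarrow> h \<le> real d \<Longrightarrow>
      averaging n \<rho> P \<Longrightarrow> real (averaging.cnt n P x0 \<epsilon> {..<n} 0 b) \<le> R" for R m
    unfolding T_exp_def
  proof (rule SUP_least)
    fix z assume z: "z \<in> {(P, q, M, x0). exp_system n \<rho> d h P q M
        \<and> (\<forall>t. n_components n (graph_edges n P t) \<le> m) \<and> qvar n q x0 \<le> 1}"
    obtain P q M x0 where zz: "z = (P, q, M, x0)" by (metis surj_pair)
    have ex: "exp_system n \<rho> d h P q M" and comp: "\<forall>t. n_components n (graph_edges n P t) \<le> m"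
      and q1: "qvar n q x0 \<le> 1" using z by (auto simp: zz)
    interpret expander n \<rho> P x0 q M d h
      using ex rho h by unfold_locales (auto simp: exp_system_def rev_system_def)
    have "T_eps n \<epsilon> P x0 \<le> ennreal R"
    proof (cases "n = 0")
      case False
      then have n0: "0 < n" by simp
      then have m0: "0 < m" using one_le_n_components[of 0] comp by (metis One_nat_def Suc_le_eq le_trans)
      show ?thesis
      proof (rule T_eps_le[OF _ R])
        fix b
        show "real (cnt \<epsilon> {..<n} 0 b) \<le> R"
        proof (cases "h \<le> real d")
          case True
          then show ?thesis using bound[OF ex _ q1 n0 m0] comp averaging_axioms by blast
        next
          case False
          then have "cnt \<epsilon> {..<n} 0 b = 0"
            using long_at_h_le[OF closed_at_UNIV _ eps(1)] by (intro cnt_zero) blast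
          then show ?thesis using R by simp
        qed
      qed
    qed (simp add: T_eps_empty)
    then show "(case z of (P, q, M, x0) \<Rightarrow> T_eps n \<epsilon> P x0) \<le> ennreal R" by (simp add: zz)
  qed
  show "T_exp n \<rho> d h m \<epsilon> \<le> ennreal (c * ((real d)^3 * real m * real n / h\<^sup>2 * ln (1 / \<epsilon>)) ^ m)"
  proof (rule gen)
    show "0 \<le> c * ((real d)^3 * real m * real n / h\<^sup>2 * ln (1 / \<epsilon>)) ^ m"
      using c(2) l0(1) by (intro mult_nonneg_nonneg zero_le_power) auto
    fix P q M x0 b
    assume ex: "exp_system n \<rho> d h P q M" and comp: "\<And>t. n_components n (graph_edges n P t) \<le> m"
      and q1: "qvar n q x0 \<le> 1" and n0: "0 < n" and m0: "0 < m" and hd: "h \<le> real d"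
    interpret expander n \<rho> P x0 q M d h
      using ex rho h by unfold_locales (auto simp: exp_system_def rev_system_def)
    have "real (cnt \<epsilon> {..<n} 0 b)
        \<le> (20 * exp 3 * ((real d)^3 * real m * real n / h\<^sup>2) * (1 + ln (1 / \<epsilon>) / real m)) ^ m"
      by (rule cnt_le_expander[OF hd comp n0 m0 q1 eps(1) l0(2)])
    also have "\<dots> \<le> c * ((real d)^3 * real m * real n / h\<^sup>2 * ln (1 / \<epsilon>)) ^ m"
      using eps(2) m0 by (intro c(1)) auto
    finally show "real (cnt \<epsilon> {..<n} 0 b) \<le> c * ((real d)^3 * real m * real n / h\<^sup>2 * ln (1 / \<epsilon>)) ^ m" .
  qed
  show "T_exp n \<rho> d h 1 \<epsilon> \<le> ennreal (4 * (real d)^3 / h\<^sup>2 * ln (1 / \<epsilon>))"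
  proof (rule gen)
    show "0 \<le> 4 * (real d)^3 / h\<^sup>2 * ln (1 / \<epsilon>)"
      using l0(1) by (intro mult_nonneg_nonneg) auto
    fix P q M x0 b
    assume ex: "exp_system n \<rho> d h P q M" and comp: "\<And>t. n_components n (graph_edges n P t) \<le> 1"
      and q1: "qvar n q x0 \<le> 1" and n0: "0 < n" and hd: "h \<le> real d"
    interpret expander n \<rho> P x0 q M d h
      using ex rho h by unfold_locales (auto simp: exp_system_def rev_system_def)
    show "real (cnt \<epsilon> {..<n} 0 b) \<le> 4 * (real d)^3 / h\<^sup>2 * ln (1 / \<epsilon>)"
      by (rule cnt_le_connected[OF hd comp n0 q1 eps(1) l0(2)])
  qed
qed

theorem theorem2:
  shows "(\<exists>c>0. \<exists>\<epsilon>0>0. \<forall>\<epsilon>. 0 < \<epsilon> \<and> \<epsilon> < \<epsilon>0 \<longrightarrow>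
            (\<forall>n \<rho>. 0 < \<rho> \<and> \<rho> \<le> 1/2 \<longrightarrow>
               (\<forall>m. T_gen n \<rho> m \<epsilon>
                      \<le> ennreal (c * (1/\<rho>)^(n - 1) * (real m * real n * ln (1/\<epsilon>))^m))
             \<and> (\<forall>m. T_rev n \<rho> m \<epsilon> \<le> ennreal (c * ((real n)\<^sup>2 / \<rho> * ln (1/\<epsilon>))^m))
             \<and> (\<forall>d h. h > 0 \<longrightarrow>
                  (\<forall>m. T_exp n \<rho> d h m \<epsilon>
                        \<le> ennreal (c * ((real d)^3 * real m * real n / h\<^sup>2 * ln (1/\<epsilon>))^m))
                \<and> T_exp n \<rho> d h 1 \<epsilon> \<le> ennreal (c * (real d)^3 / h\<^sup>2 * ln (1/\<epsilon>)))))
     \<and> (\<forall>d::nat. d > 3 \<longrightarrow>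
          (\<exists>c>0. \<exists>\<epsilon>0>0. \<forall>\<epsilon>. 0 < \<epsilon> \<and> \<epsilon> < \<epsilon>0 \<longrightarrow>
             (\<forall>n. d \<le> n \<and> even (n * (d - 1)) \<longrightarrow>
                (\<integral>\<^sup>+ \<omega>. T_ran n d \<epsilon> \<omega> \<partial>ran_space n d) \<le> ennreal (c * ln (1/\<epsilon>)))))"
proof (intro conjI allI impI)
  have "1 \<le> 20 * exp (3::real)" using exp_ge_add_one_self[of 3] by linarith
  then obtain c0 where c0: "1 \<le> c0" "\<And>B L m. 0 \<le> B \<Longrightarrow> 2 * (20 * exp 3) \<le> L \<Longrightarrow> 0 < m \<Longrightarrow>
    (20 * exp 3 * B * (1 + L / real m)) ^ m \<le> c0 * (B * L) ^ m"
    using power_absorb by metis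
  have absorb: "(20 * exp 3 * B * (1 + L / real m)) ^ m \<le> c0 * (B * L) ^ m"
    if "0 \<le> B" "40 * exp 3 \<le> L" "0 < m" for B L :: real and m
    using c0(2)[of B L m] that by simp
  \<comment> \<open>One constant for all classes: exp 1 * c0 serves the general bound, c0 the
    reversible and expander bounds, and 4 the connected expanders.\<close>
  define c where "c = exp 1 * c0 + 4"
  have e1: "1 \<le> exp (1::real)" by simp
  have cc: "exp 1 * c0 \<le> c" "c0 \<le> c" "4 \<le> c" "0 < c"
  proof -
    have "1 * c0 \<le> exp 1 * c0" by (rule mult_right_mono[OF e1]) (use c0(1) in simp)
    then show "exp 1 * c0 \<le> c" "c0 \<le> c" "4 \<le> c" "0 < c" unfolding c_def using c0(1) by linarith+
  qed
  show "\<exists>c>0. \<exists>\<epsilon>0>0. \<forall>\<epsilon>. 0 < \<epsilon> \<and> \<epsilon> < \<epsilon>0 \<longrightarrow>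
            (\<forall>n \<rho>. 0 < \<rho> \<and> \<rho> \<le> 1/2 \<longrightarrow>
               (\<forall>m. T_gen n \<rho> m \<epsilon>
                      \<le> ennreal (c * (1/\<rho>)^(n - 1) * (real m * real n * ln (1/\<epsilon>))^m))
             \<and> (\<forall>m. T_rev n \<rho> m \<epsilon> \<le> ennreal (c * ((real n)\<^sup>2 / \<rho> * ln (1/\<epsilon>))^m))
             \<and> (\<forall>d h. h > 0 \<longrightarrow>
                  (\<forall>m. T_exp n \<rho> d h m \<epsilon>
                        \<le> ennreal (c * ((real d)^3 * real m * real n / h\<^sup>2 * ln (1/\<epsilon>))^m))
                \<and> T_exp n \<rho> d h 1 \<epsilon> \<le> ennreal (c * (real d)^3 / h\<^sup>2 * ln (1/\<epsilon>))))"
  proof (rule exI[of _ c], rule conjI[OF cc(4)], rule exI[of _ "exp (- (40 * exp 3))"], intro conjI allI impI)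
    fix \<epsilon> \<rho> h :: real and n m d :: nat
    assume "0 < \<epsilon> \<and> \<epsilon> < exp (- (40 * exp 3))" "0 < \<rho> \<and> \<rho> \<le> 1/2"
    then have eps: "0 < \<epsilon>" "\<epsilon> < exp (- (40 * exp 3))" and rho: "0 < \<rho>" "\<rho> \<le> 1/2" by auto
    \<comment> \<open>The threshold for \<epsilon> is chosen so that L \<ge> 2 * C with C = 20 * exp
      3, the condition of \<open>power_absorb\<close>.\<close>
    have "ln \<epsilon> \<le> ln (exp (- (40 * exp 3)))" using eps by (subst ln_le_cancel_iff) auto
    then have L: "40 * exp 3 \<le> ln (1 / \<epsilon>)" using eps(1) by (simp add: ln_div)
    have l0: "0 \<le> ln (1 / \<epsilon>)" using L exp_ge_zero[of 3] by linarith
    have "T_gen n \<rho> m \<epsilon> \<le> ennreal (exp 1 * c0 * (1 / \<rho>) ^ (n - 1) * (real m * real n * ln (1 / \<epsilon>)) ^ m)"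
      by (rule T_gen_le[OF absorb c0(1) rho eps(1) L])
    also have "\<dots> \<le> ennreal (c * (1 / \<rho>) ^ (n - 1) * (real m * real n * ln (1 / \<epsilon>)) ^ m)"
      using cc(1) rho l0 by (intro ennreal_leI mult_right_mono zero_le_power mult_nonneg_nonneg) auto
    finally show "T_gen n \<rho> m \<epsilon> \<le> ennreal (c * (1/\<rho>)^(n - 1) * (real m * real n * ln (1/\<epsilon>))^m)" .
    have "T_rev n \<rho> m \<epsilon> \<le> ennreal (c0 * ((real n)\<^sup>2 / \<rho> * ln (1 / \<epsilon>)) ^ m)"
      by (rule T_rev_le[OF absorb c0(1) rho eps(1) L])
    also have "\<dots> \<le> ennreal (c * ((real n)\<^sup>2 / \<rho> * ln (1 / \<epsilon>)) ^ m)"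
      using cc(2) rho l0 by (intro ennreal_leI mult_right_mono zero_le_power mult_nonneg_nonneg) auto
    finally show "T_rev n \<rho> m \<epsilon> \<le> ennreal (c * ((real n)\<^sup>2 / \<rho> * ln (1/\<epsilon>))^m)" .
    assume h: "h > 0"
    have "T_exp n \<rho> d h m \<epsilon> \<le> ennreal (c0 * ((real d)^3 * real m * real n / h\<^sup>2 * ln (1 / \<epsilon>)) ^ m)"
      by (rule T_exp_le(1)[OF absorb c0(1) rho(1) eps(1) L h])
    also have "\<dots> \<le> ennreal (c * ((real d)^3 * real m * real n / h\<^sup>2 * ln (1 / \<epsilon>)) ^ m)"
      using cc(2) l0 by (intro ennreal_leI mult_right_mono zero_le_power mult_nonneg_nonneg) auto
    finally show "T_exp n \<rho> d h m \<epsilon> \<le> ennreal (c * ((real d)^3 * real m * real n / h\<^sup>2 * ln (1/\<epsilon>))^m)" .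
    have "T_exp n \<rho> d h 1 \<epsilon> \<le> ennreal (4 * (real d)^3 / h\<^sup>2 * ln (1 / \<epsilon>))"
      by (rule T_exp_le(2)[OF absorb c0(1) rho(1) eps(1) L h])
    also have "\<dots> \<le> ennreal (c * (real d)^3 / h\<^sup>2 * ln (1 / \<epsilon>))"
      using cc(3) l0 by (intro ennreal_leI mult_right_mono divide_right_mono) auto
    finally show "T_exp n \<rho> d h 1 \<epsilon> \<le> ennreal (c * (real d)^3 / h\<^sup>2 * ln (1/\<epsilon>))" .
  qed simp
next
  \<comment> \<open>Here d is fixed before the constant, which therefore takes up the factor d^3;
    \<open>d \<le> n\<close> and the parity condition guarantee that regular graphs exist.\<close>
  fix d :: nat
  assume d: "d > 3"
  show "\<exists>c>0. \<exists>\<epsilon>0>0. \<forall>\<epsilon>. 0 < \<epsilon> \<and> \<epsilon> < \<epsilon>0 \<longrightarrow>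
             (\<forall>n. d \<le> n \<and> even (n * (d - 1)) \<longrightarrow>
                (\<integral>\<^sup>+ \<omega>. T_ran n d \<epsilon> \<omega> \<partial>ran_space n d) \<le> ennreal (c * ln (1/\<epsilon>)))"
  proof (rule exI[of _ "128 * exp 3 * (16781312 * (real d)^3)"], rule conjI, use d in simp,
      rule exI[of _ "exp (- 1)"], intro conjI allI impI)
    fix \<epsilon> :: real and n :: nat
    assume "0 < \<epsilon> \<and> \<epsilon> < exp (- 1)" and n: "d \<le> n \<and> even (n * (d - 1))"
    then have eps: "0 < \<epsilon>" "\<epsilon> < exp (- 1)" by auto
    have "ln \<epsilon> \<le> ln (exp (- 1))" using eps by (subst ln_le_cancel_iff) auto
    then have "1 \<le> ln (1 / \<epsilon>)" using eps(1) by (simp add: ln_div)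
    then show "(\<integral>\<^sup>+ \<omega>. T_ran n d \<epsilon> \<omega> \<partial>ran_space n d)
        \<le> ennreal (128 * exp 3 * (16781312 * (real d)^3) * ln (1/\<epsilon>))"
      using expected_T_ran d n eps(1) by blast
  qed simp
qed

end
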